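(* Let $d\ge 1$ be an integer and $\alpha\in(0,2)$ with $d>\alpha$. Let $\Omega\subset\mathbb{R}^d$ be a bounded domain. There exist constants $\beta=\beta(\Omega)>0$ and $C_2(\Omega)>0$, depending only on $d$, $\alpha$ and $\Omega$, such that for every $v\in L^1(\Omega)$ with $v\ge 0$ and $\Gamma(v)\le\beta$, $$\lambda_1(v)\le C_2(\Omega)\,\Gamma(v),$$ where $\lambda_1(v)$ is the first eigenvalue of the operator $-\Delta_N^{\alpha/2}+v$ in $\Omega$ and $\Gamma(v)$ is the scattering length of $v$.
   Context: Symmetric stable process: $X_t$ is the symmetric $\alpha$-stable Lévy process in $\mathbb{R}^d$, i.e. $\mathbf{E}^0(\exp(i\xi\cdot X_t))=\exp(-t|\xi|^\alpha)$; $\mathbf{E}^x$ is expectation for the process started at $x$. Scattering length: for $0\le v\in L^1(\mathbb{R}^d)$, the capacitory potential of $v$ is $U_v(x)=\mathbf{E}^x\left(1-e^{-\int_0^\infty v(X_s)\,ds}\right)$, the capacitory measure of $v$ has density $\mu_v(x)=v(x)(1-U_v(x))$ with respect to Lebesgue measure, and the scattering length is $\Gamma(v)=\int_{\mathbb{R}^d}d\mu_v(x)=\int_{\mathbb{R}^d}v(x)(1-U_v(x))\,dx$. A function $v\in L^1(\Omega)$ is regarded as a function on $\mathbb{R}^d$ by extending it by zero outside $\Omega$. "Neumann" fractional Laplacian: $\Delta_N^{\alpha/2}$ is the self-adjoint operator on $L^2(\Omega)$ such that $-\Delta_N^{\alpha/2}$ has quadratic form $$\mathcal{E}_Y(u,u)=\int_\Omega\int_\Omega\frac{(u(x)-u(y))^2}{|x-y|^{d+\alpha}}\,dx\,dy$$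 with domain the fractional Sobolev space $W^{\alpha/2,2}(\Omega)=\{u\in L^2(\Omega):\mathcal{E}_Y(u,u)<\infty\}$. The first eigenvalue (bottom of the spectrum) of $-\Delta_N^{\alpha/2}+v$ is given by the Rayleigh quotient $$\lambda_1(v)=\inf_{0\ne\varphi\in W^{\alpha/2,2}(\Omega)}\frac{\mathcal{E}_Y(\varphi,\varphi)+\int_\Omega v\varphi^2}{\int_\Omega\varphi^2}.$$ *)

theory Defs
  imports "HOL-Probability.Probability"
begin

locale levy_process = prob_space M
  for M :: "'w measure" and X :: "real \<Rightarrow> 'w \<Rightarrow> 'a::euclidean_space" +
  assumes random_variable_process: "\<And>t. 0 \<le> t \<Longrightarrow> random_variable borel (X t)"
    and start_zero: "AE \<omega> in M. X 0 \<omega> = 0"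
    and independent_increments:
      "\<And>(t :: nat \<Rightarrow> real) n. 0 \<le> t 0 \<Longrightarrow> mono t \<Longrightarrow>
         indep_vars (\<lambda>_. borel) (\<lambda>i \<omega>. X (t (Suc i)) \<omega> - X (t i) \<omega>) {..<n}"
    and stationary_increments:
      "\<And>s t. 0 \<le> s \<Longrightarrow> s \<le> t \<Longrightarrow>
         distr M borel (\<lambda>\<omega>. X t \<omega> - X s \<omega>) = distr M borel (X (t - s))"
    and right_continuous_paths:
      "\<And>\<omega> t. \<omega> \<in> space M \<Longrightarrow> 0 \<le> t \<Longrightarrow> ((\<lambda>s. X s \<omega>) \<longlongrightarrow> X t \<omega>) (at_right t)"
    and left_limits_paths:
      "\<And>\<omega> t. \<omega> \<in> space M \<Longrightarrow> 0 < t \<Longrightarrow> \<exists>l. ((\<lambda>s. X s \<omega>) \<longlongrightarrow> l) (at_left t)"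

text \<open>The process is started at \<open>0\<close>; under the law with starting point \<open>x\<close> it is \<open>x + X\<close>.\<close>

locale symmetric_stable_process = levy_process M X
  for \<alpha> :: real and M :: "'w measure" and X :: "real \<Rightarrow> 'w \<Rightarrow> 'a::euclidean_space" +
  assumes characteristic_function:
    "\<And>t \<xi>. 0 \<le> t \<Longrightarrow>
       (\<integral>\<omega>. iexp (\<xi> \<bullet> X t \<omega>) \<partial>M) = complex_of_real (exp (- t * norm \<xi> powr \<alpha>))"

text \<open>\<open>e\<^sup>-\<^sup>a\<close> for \<open>a\<close> in \<open>[0,\<infinity>]\<close>, where \<open>e\<^sup>-\<^sup>\<infinity> = 0\<close>: the time integral of \<open>v\<close> along a path may be
  infinite.\<close>

definition exp_neg :: "ennreal \<Rightarrow> real" where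
  "exp_neg a = (if a = \<infinity> then 0 else exp (- enn2real a))"

definition capacitory_potential ::
    "'w measure \<Rightarrow> (real \<Rightarrow> 'w \<Rightarrow> 'a::euclidean_space) \<Rightarrow> ('a \<Rightarrow> real) \<Rightarrow> 'a \<Rightarrow> real" where
  "capacitory_potential M X v x =
     (\<integral>\<omega>. (1 - exp_neg (\<integral>\<^sup>+s\<in>{0..}. ennreal (v (x + X s \<omega>)) \<partial>lborel)) \<partial>M)"

definition capacitory_density ::
    "'w measure \<Rightarrow> (real \<Rightarrow> 'w \<Rightarrow> 'a::euclidean_space) \<Rightarrow> ('a \<Rightarrow> real) \<Rightarrow> 'a \<Rightarrow> real" where
  "capacitory_density M X v x = v x * (1 - capacitory_potential M X v x)"

definition scattering_length ::
    "'w measure \<Rightarrow> (real \<Rightarrow> 'w \<Rightarrow> 'a::euclidean_space) \<Rightarrow> ('a \<Rightarrow> real) \<Rightarrow> real" where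
  "scattering_length M X v = (\<integral>x. capacitory_density M X v x \<partial>lborel)"

definition zero_extension :: "'a set \<Rightarrow> ('a \<Rightarrow> real) \<Rightarrow> 'a \<Rightarrow> real" where
  "zero_extension \<Omega> v x = (if x \<in> \<Omega> then v x else 0)"

text \<open>On the diagonal the integrand is \<open>0 / 0 = 0\<close>; the diagonal is a null set.\<close>

definition neumann_form :: "real \<Rightarrow> 'a::euclidean_space set \<Rightarrow> ('a \<Rightarrow> real) \<Rightarrow> ennreal" where
  "neumann_form \<alpha> \<Omega> u =
     (\<integral>\<^sup>+x\<in>\<Omega>. (\<integral>\<^sup>+y\<in>\<Omega>.
        ennreal ((u x - u y)\<^sup>2 / norm (x - y) powr (real DIM('a) + \<alpha>)) \<partial>lborel) \<partial>lborel)"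

text \<open>The Sobolev space with exponents \<open>\<alpha>/2\<close> and \<open>2\<close>, as a set of functions rather than of
  classes modulo null sets.\<close>

definition frac_sobolev :: "real \<Rightarrow> 'a::euclidean_space set \<Rightarrow> ('a \<Rightarrow> real) set" where
  "frac_sobolev \<alpha> \<Omega> =
     {u. set_borel_measurable lborel \<Omega> u \<and> set_integrable lborel \<Omega> (\<lambda>x. (u x)\<^sup>2)
         \<and> neumann_form \<alpha> \<Omega> u < \<infinity>}"

text \<open>The bottom of the spectrum, by its Rayleigh quotient. For \<open>v\<close> that is merely integrable the
  potential term can be infinite on part of the Sobolev space, so the infimum is taken in
  \<open>[0,\<infinity>]\<close>. The condition that \<open>\<phi>\<close> is nonzero refers to classes modulo null sets.\<close>

definition first_eigenvalue ::
    "real \<Rightarrow> 'a::euclidean_space set \<Rightarrow> ('a \<Rightarrow> real) \<Rightarrow> ennreal" where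
  "first_eigenvalue \<alpha> \<Omega> v =
     (INF \<phi> \<in> {\<phi> \<in> frac_sobolev \<alpha> \<Omega>. \<not> (AE x in lborel. x \<in> \<Omega> \<longrightarrow> \<phi> x = 0)}.
        (neumann_form \<alpha> \<Omega> \<phi> + (\<integral>\<^sup>+x\<in>\<Omega>. ennreal (v x * (\<phi> x)\<^sup>2) \<partial>lborel))
          / (\<integral>\<^sup>+x\<in>\<Omega>. ennreal ((\<phi> x)\<^sup>2) \<partial>lborel))"

end

(* Test the Rayleigh quotient with 1 - u, where u(x) is the probability that the process started at x
   and killed at rate v dies before a large time T; then u is integrable with 0 \<le> u \<le> 1, and
   Gamma_T, the integral of v (1 - u), decreases to Gamma(v) as T grows.

   Energy. On the skeleton walk with time step delta, one-step analysis of the killed walk gives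
   u - P u \<le> P ((1 - exp (-delta v)) (1 - u)), P being the transition operator. Pairing with translates
   of u bounds the increment of the autocorrelation of u by delta times the integral of v (1 - u).
   Averaging over Gaussian translations turns this into a bound for the integral of
   (1 - exp (-delta |xi|^alpha)) / delta times the power spectrum of u, so that delta \<rightarrow> 0 and Fatou's
   lemma bound the spectral energy of u by Gamma_T. Continuity of translations in L1 makes the
   skeleton converge, although v is merely integrable.

   The integral of (1 - cos (xi.y)) / |y|^(d+alpha) is at most C |xi|^alpha, so the spectral energy
   controls the Gagliardo form; as d > alpha, it also controls the integral of u against a Gaussian,
   hence on Omega, and for small Gamma(v) the denominator of the Rayleigh quotient stays away from 0. *)

theory Submission
  imports Defs
begin

section \<open>Translations in the mean\<close>

text \<open>The finite horizon is forced. For nonzero v the infinite-horizon potential decays no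
  faster than |x|^(alpha-d) and is not integrable, whereas the probability of dying before T has
  integral at most T times that of v; only then do autocorrelation and Fourier integrals of u make
  sense at once. As v is merely integrable, no generator equation for u is at hand. The skeleton
  walk needs nothing beyond a bounded one-step operator, at the price of an inequality in place of
  an equation. The bound on the autocorrelation increment is uniform in the translation, and this is
  what allows averaging. A spatial Gaussian average of width 1/sigma is a frequency average of width
  sigma, so Fourier inversion and Plancherel appear only in regularised form, with absolutely
  convergent integrals; sigma tends to infinity only after the kernel |y|^-(d+alpha) has been
  integrated. The condition d > alpha makes |xi|^-alpha locally integrable, and this is the weight
  dual to |xi|^alpha in the bound for the Gaussian average of u.\<close>

lemma distr_lborel_translation:
  fixes a :: "'a::euclidean_space"
  shows "distr lborel borel (\<lambda>x. x + a) = lborel"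
proof -
  have "(\<lambda>x. x + a) = (+) a" by (auto simp: fun_eq_iff add.commute)
  then show ?thesis by (simp add: lborel_distr_plus)
qed

lemma nn_integral_lborel_translation:
  fixes a :: "'a::euclidean_space"
  assumes "f \<in> borel_measurable borel"
  shows "(\<integral>\<^sup>+x. f (x + a) \<partial>lborel) = (\<integral>\<^sup>+x. f x \<partial>lborel)"
  using assms by (subst (2) distr_lborel_translation[of a, symmetric]) (simp add: nn_integral_distr)

lemma integrable_lborel_translation:
  fixes a :: "'a::euclidean_space" and f :: "'a \<Rightarrow> real"
  assumes "integrable lborel f"
  shows "integrable lborel (\<lambda>x. f (x + a))"
  using integrable_distr[of "\<lambda>x. x + a" lborel borel f] assms
  by (simp add: distr_lborel_translation)

lemma integral_lborel_translation:
  fixes a :: "'a::euclidean_space" and f :: "'a \<Rightarrow> real"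
  assumes "f \<in> borel_measurable borel"
  shows "(\<integral>x. f (x + a) \<partial>lborel) = (\<integral>x. f x \<partial>lborel)"
  using assms by (subst (2) distr_lborel_translation[of a, symmetric]) (simp add: integral_distr)

text \<open>For open \<open>O\<close> the product \<open>1\<^sub>O(x) 1\<^sub>O(x + h)\<close> tends pointwise to \<open>1\<^sub>O(x)\<close> as \<open>h\<close> tends to \<open>0\<close>;
  general sets are approximated by open ones from outside.\<close>

lemma translation_L1_tendsto:
  fixes f :: "'a::euclidean_space \<Rightarrow> real" and h :: "nat \<Rightarrow> 'a"
  assumes "integrable lborel f" and h: "h \<longlonglongrightarrow> 0"
  shows "(\<lambda>n. \<integral>x. \<bar>f (x + h n) - f x\<bar> \<partial>lborel) \<longlonglongrightarrow> 0"
proof -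
  \<comment> \<open>Convergence of translates passes to L1 limits, because translating both
    functions does not change their L1 distance. This closure is used twice: from open sets to Borel
    sets, and from simple functions to integrable ones.\<close>
  have approx: "(\<lambda>n. \<integral>x. \<bar>f (x + h n) - f x\<bar> \<partial>lborel) \<longlonglongrightarrow> 0"
    if f: "integrable lborel f"
      and g: "\<And>e. e > 0 \<Longrightarrow> \<exists>g. integrable lborel g \<and> (\<integral>x. \<bar>f x - g x\<bar> \<partial>lborel) < e \<and>
            (\<lambda>n. \<integral>x. \<bar>g (x + h n) - g x\<bar> \<partial>lborel) \<longlonglongrightarrow> 0"
    for f :: "'a \<Rightarrow> real"
  proof (rule LIMSEQ_I)
    fix r :: real assume "0 < r"
    then obtain g where [simp]: "integrable lborel g" and fg: "(\<integral>x. \<bar>f x - g x\<bar> \<partial>lborel) < r / 4"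
      and lim: "(\<lambda>n. \<integral>x. \<bar>g (x + h n) - g x\<bar> \<partial>lborel) \<longlonglongrightarrow> 0"
      using g[of "r/4"] by auto
    obtain n0 where n0: "\<And>n. n \<ge> n0 \<Longrightarrow> (\<integral>x. \<bar>g (x + h n) - g x\<bar> \<partial>lborel) < r / 4"
      using LIMSEQ_D[OF lim, of "r/4"] \<open>0 < r\<close> by force
    have [measurable]: "f \<in> borel_measurable borel" "g \<in> borel_measurable borel"
      using f borel_measurable_integrable[of lborel g] borel_measurable_integrable[of lborel f] by auto
    have "norm ((\<integral>x. \<bar>f (x + h n) - f x\<bar> \<partial>lborel) - 0) < r" if "n \<ge> n0" for n
    proof -
      have [simp]: "integrable lborel (\<lambda>x. f (x + h n))" "integrable lborel (\<lambda>x. g (x + h n))"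
        using f by (auto intro: integrable_lborel_translation)
      have "(\<integral>x. \<bar>f (x + h n) - f x\<bar> \<partial>lborel) \<le>
          (\<integral>x. \<bar>f (x + h n) - g (x + h n)\<bar> + \<bar>g (x + h n) - g x\<bar> + \<bar>f x - g x\<bar> \<partial>lborel)"
        using f by (intro integral_mono) auto
      also have "\<dots> = (\<integral>x. \<bar>f (x + h n) - g (x + h n)\<bar> \<partial>lborel) + (\<integral>x. \<bar>g (x + h n) - g x\<bar> \<partial>lborel)
            + (\<integral>x. \<bar>f x - g x\<bar> \<partial>lborel)"
        using f by simp
      also have "(\<integral>x. \<bar>f (x + h n) - g (x + h n)\<bar> \<partial>lborel) = (\<integral>x. \<bar>f x - g x\<bar> \<partial>lborel)"
        by (rule integral_lborel_translation[of "\<lambda>x. \<bar>f x - g x\<bar>"]) simp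
      finally show ?thesis using fg n0[OF that] \<open>0 < r\<close> by simp
    qed
    then show "\<exists>no. \<forall>n\<ge>no. norm ((\<integral>x. \<bar>f (x + h n) - f x\<bar> \<partial>lborel) - 0) < r" by auto
  qed
  have opn: "(\<lambda>n. \<integral>x. \<bar>indicator U (x + h n) - indicator U x :: real\<bar> \<partial>lborel) \<longlonglongrightarrow> 0"
    if "open U" and fin: "emeasure lborel U < \<infinity>" for U :: "'a set"
  proof -
    have [measurable]: "U \<in> sets borel" using \<open>open U\<close> by simp
    have U: "integrable lborel (\<lambda>x. indicator U x :: real)" using fin by simp
    have Ut: "integrable lborel (\<lambda>x. indicator U (x + a) :: real)" for a
      by (rule integrable_lborel_translation[OF U])
    have UU: "integrable lborel (\<lambda>x. indicator U x * indicator U (x + a) :: real)" for a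
      by (rule Bochner_Integration.integrable_bound[OF U]) (auto simp: indicator_def)
    have pt: "(\<lambda>n. indicator U x * indicator U (x + h n) :: real) \<longlonglongrightarrow> indicator U x" for x
    proof (cases "x \<in> U")
      case True
      have "(\<lambda>n. x + h n) \<longlonglongrightarrow> x" using tendsto_add[OF tendsto_const h, of x] by simp
      then have "eventually (\<lambda>n. x + h n \<in> U) sequentially"
        using \<open>open U\<close> True topological_tendstoD by blast
      then show ?thesis
        by (intro tendsto_eventually, elim eventually_mono) (use True in auto)
    qed simp
    have "(\<lambda>n. \<integral>x. indicator U x * indicator U (x + h n) \<partial>lborel) \<longlonglongrightarrow> (\<integral>x. indicator U x \<partial>lborel :: real)"
      by (rule integral_dominated_convergence[where w="indicator U"])
        (use U pt in \<open>auto intro!: AE_I2 mult_left_le simp: indicator_le_1\<close>)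
    then have "(\<lambda>n. 2 * (\<integral>x. indicator U x \<partial>lborel :: real) - 2 * (\<integral>x. indicator U x * indicator U (x + h n) \<partial>lborel))
        \<longlonglongrightarrow> 2 * (\<integral>x. indicator U x \<partial>lborel) - 2 * (\<integral>x. indicator U x \<partial>lborel)"
      by (intro tendsto_intros)
    \<comment> \<open>Since indicators are idempotent, \<open>|a - b| = a + b - 2 * a * b\<close>
      for \<open>a\<close>, \<open>b\<close> in {0, 1}; the limit of the product integral therefore
      settles the L1 distance.\<close>
    moreover have "(\<integral>x. \<bar>indicator U (x + h n) - indicator U x :: real\<bar> \<partial>lborel) =
       2 * (\<integral>x. indicator U x \<partial>lborel :: real) - 2 * (\<integral>x. indicator U x * indicator U (x + h n) \<partial>lborel)" for n
    proof -
      have "(\<integral>x. \<bar>indicator U (x + h n) - indicator U x :: real\<bar> \<partial>lborel) =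
        (\<integral>x. indicator U (x + h n) + indicator U x - 2 * (indicator U x * indicator U (x + h n) :: real) \<partial>lborel)"
        by (intro Bochner_Integration.integral_cong) (auto simp: indicator_def)
      also have "\<dots> = (\<integral>x. indicator U (x + h n) \<partial>lborel) + (\<integral>x. indicator U x \<partial>lborel)
           - 2 * (\<integral>x. indicator U x * indicator U (x + h n) \<partial>lborel)"
        using U Ut[of "h n"] UU[of "h n"] by simp
      also have "(\<integral>x. indicator U (x + h n) \<partial>lborel) = (\<integral>x. indicator U x \<partial>lborel :: real)"
        by (rule integral_lborel_translation) simp
      finally show ?thesis by simp
    qed
    ultimately show ?thesis by simp
  qed
  from assms(1) show ?thesis
  proof (induction f rule: integrable_induct)
    case (base A c)
    then have A: "A \<in> sets borel" "emeasure lborel A < \<infinity>" by auto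
    have "(\<lambda>n. \<integral>x. \<bar>indicator A (x + h n) - indicator A x :: real\<bar> \<partial>lborel) \<longlonglongrightarrow> 0"
    proof (rule approx)
      show "integrable lborel (indicator A :: 'a \<Rightarrow> real)" using A by simp
      fix e :: real assume "0 < e"
      obtain U where U: "open U" "A \<subseteq> U" "emeasure lborel (U - A) < e"
        using outer_regular_lborel[OF A(1) \<open>0 < e\<close>] by blast
      have [measurable]: "U \<in> sets borel" "A \<in> sets borel" using U A by auto
      have "emeasure lborel U = emeasure lborel A + emeasure lborel (U - A)"
        using U by (subst plus_emeasure) (auto simp: Un_absorb1)
      also have "\<dots> < \<infinity>" using A(2) order.strict_trans[OF U(3) ennreal_less_top]
        by (simp only: infinity_ennreal_def ennreal_add_less_top)
      finally have fin: "emeasure lborel U < \<infinity>" .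
      have "(\<integral>x. \<bar>indicator A x - indicator U x\<bar> \<partial>lborel) = (\<integral>x. indicator (U - A) x \<partial>lborel :: real)"
        using U by (intro Bochner_Integration.integral_cong) (auto simp: indicator_def)
      also have "\<dots> = measure lborel (U - A)" by simp
      also have "\<dots> < e" using U(3) \<open>0 < e\<close>
        by (simp add: measure_def enn2real_less_iff order.strict_trans[OF _ ennreal_less_top])
      finally show "\<exists>g. integrable lborel g \<and> (\<integral>x. \<bar>indicator A x - g x\<bar> \<partial>lborel) < e \<and>
            (\<lambda>n. \<integral>x. \<bar>g (x + h n) - g x\<bar> \<partial>lborel) \<longlonglongrightarrow> 0"
        using opn[OF U(1) fin] fin by (intro exI[of _ "indicator U"]) auto
    qed
    have "\<bar>indicator A (x + h n) *\<^sub>R c - indicator A x *\<^sub>R c\<bar> =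
        \<bar>c\<bar> * \<bar>indicator A (x + h n) - indicator A x\<bar>" for x n
      by (simp add: left_diff_distrib[symmetric] abs_mult)
    with tendsto_mult_left[OF \<open>(\<lambda>n. \<integral>x. \<bar>indicator A (x + h n) - indicator A x :: real\<bar> \<partial>lborel) \<longlonglongrightarrow> 0\<close>,
        of "\<bar>c\<bar>"]
    show ?case by simp
  next
    case (add f g)
    have [simp]: "integrable lborel (\<lambda>x. f (x + h n))" "integrable lborel (\<lambda>x. g (x + h n))" for n
      using add.hyps by (auto intro: integrable_lborel_translation)
    show ?case
    proof (rule tendsto_sandwich[OF _ _ tendsto_const])
      show "\<forall>\<^sub>F n in sequentially. (\<integral>x. \<bar>f (x + h n) + g (x + h n) - (f x + g x)\<bar> \<partial>lborel) \<le>
        (\<integral>x. \<bar>f (x + h n) - f x\<bar> \<partial>lborel) + (\<integral>x. \<bar>g (x + h n) - g x\<bar> \<partial>lborel)"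
      proof (intro always_eventually allI)
        fix n
        have "(\<integral>x. \<bar>f (x + h n) + g (x + h n) - (f x + g x)\<bar> \<partial>lborel) \<le>
            (\<integral>x. \<bar>f (x + h n) - f x\<bar> + \<bar>g (x + h n) - g x\<bar> \<partial>lborel)"
          using add.hyps by (intro integral_mono) auto
        then show "(\<integral>x. \<bar>f (x + h n) + g (x + h n) - (f x + g x)\<bar> \<partial>lborel) \<le>
            (\<integral>x. \<bar>f (x + h n) - f x\<bar> \<partial>lborel) + (\<integral>x. \<bar>g (x + h n) - g x\<bar> \<partial>lborel)"
          using add.hyps by simp
      qed
      show "(\<lambda>n. (\<integral>x. \<bar>f (x + h n) - f x\<bar> \<partial>lborel) + (\<integral>x. \<bar>g (x + h n) - g x\<bar> \<partial>lborel)) \<longlonglongrightarrow> 0"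
        using tendsto_add[OF add.IH] by simp
    qed simp
  next
    case (lim f s)
    \<comment> \<open>The approximants supplied by \<open>integrable_induct\<close> satisfy
      \<open>|s i x| \<le> 2 * |f x|\<close>, hence the factor 3 in the dominating function.\<close>
    have sf: "(\<lambda>i. \<integral>x. \<bar>f x - s i x\<bar> \<partial>lborel) \<longlonglongrightarrow> (\<integral>x. \<bar>f x - f x\<bar> \<partial>lborel)"
      using lim.hyps
    proof (intro integral_dominated_convergence[where w="\<lambda>x. 3 * \<bar>f x\<bar>"] AE_I2)
      fix x :: 'a assume "x \<in> space lborel"
      then show "(\<lambda>i. \<bar>f x - s i x\<bar>) \<longlonglongrightarrow> \<bar>f x - f x\<bar>"
        using lim.hyps(2)[of x] by (intro tendsto_intros) auto
    next
      fix i and x :: 'a show "norm \<bar>f x - s i x\<bar> \<le> 3 * \<bar>f x\<bar>"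
        using lim.hyps(3)[of x i] by simp
    qed auto
    show ?case
    proof (rule approx[OF lim.hyps(4)])
      fix e :: real assume "0 < e"
      then have "\<forall>\<^sub>F i in sequentially. (\<integral>x. \<bar>f x - s i x\<bar> \<partial>lborel) < e"
        using sf by (intro order_tendstoD(2)[OF sf]) simp
      then obtain i where "(\<integral>x. \<bar>f x - s i x\<bar> \<partial>lborel) < e" 
        by (meson eventually_sequentially order_refl)
      then show "\<exists>g. integrable lborel g \<and> (\<integral>x. \<bar>f x - g x\<bar> \<partial>lborel) < e \<and>
            (\<lambda>n. \<integral>x. \<bar>g (x + h n) - g x\<bar> \<partial>lborel) \<longlonglongrightarrow> 0"
        using lim by (intro exI[of _ "s i"]) auto
    qed
  qed
qed

section \<open>The Gaussian weight and its Fourier transform\<close>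

text \<open>The product form is chosen so that integrals reduce to one dimension through the product
  measure; \<open>gauss_eq\<close> supplies the radial form.\<close>

definition gauss :: "'a::euclidean_space \<Rightarrow> real" where
  "gauss x = (\<Prod>b\<in>Basis. std_normal_density (x \<bullet> b))"

lemma borel_measurable_gauss [measurable]: "gauss \<in> borel_measurable borel"
  unfolding gauss_def by measurable

lemma norm_sq_eq_sum_Basis: "(norm (x::'a::euclidean_space))\<^sup>2 = (\<Sum>b\<in>Basis. (x \<bullet> b)\<^sup>2)"
  by (subst power2_norm_eq_inner, subst euclidean_inner) (simp add: power2_eq_square)

lemma gauss_eq:
  fixes x :: "'a::euclidean_space"
  shows "gauss x = gauss (0::'a) * exp (- (norm x)\<^sup>2 / 2)"
proof -
  have "gauss x = (\<Prod>b\<in>(Basis::'a set). 1 / sqrt (2 * pi)) * (\<Prod>b\<in>Basis. exp (- (x \<bullet> b)\<^sup>2 / 2))"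
    by (simp add: gauss_def std_normal_density_def prod_dividef prod.distrib[symmetric] power_divide)
  also have "(\<Prod>b\<in>Basis. exp (- (x \<bullet> b)\<^sup>2 / 2)) = exp (\<Sum>b\<in>Basis. - (x \<bullet> b)\<^sup>2 / 2)"
    by (simp add: exp_sum)
  also have "(\<Sum>b\<in>Basis. - (x \<bullet> b)\<^sup>2 / 2) = - (norm x)\<^sup>2 / 2"
    by (subst norm_sq_eq_sum_Basis) (simp add: sum_negf sum_divide_distrib)
  also have "(\<Prod>b\<in>(Basis::'a set). 1 / sqrt (2 * pi)) = gauss (0::'a)"
    by (simp add: gauss_def std_normal_density_def)
  finally show ?thesis .
qed

lemma gauss_zero_pos: "gauss (0::'a::euclidean_space) > 0"
  by (simp add: gauss_def std_normal_density_def)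

lemma gauss_nonneg: "gauss x \<ge> 0"
  by (subst gauss_eq) (simp add: less_imp_le[OF gauss_zero_pos])

abbreviation gauss_measure :: "'a::euclidean_space measure" where
  "gauss_measure \<equiv> density lborel (\<lambda>x. ennreal (gauss x))"

interpretation lborel_Basis: product_sigma_finite "\<lambda>_. lborel :: real measure" ..

text \<open>The density and the character both factor over \<open>Basis\<close>, and
  \<open>lborel\<close> is the image of a product of one-dimensional Lebesgue measures, so the known
  one-dimensional characteristic function suffices. Up to the factor \<open>gauss 0\<close> the
  Gaussian is thus its own Fourier transform, which later replaces Fourier inversion.\<close>

lemma gauss_char_complex:
  fixes w :: "'a::euclidean_space"
  shows "integrable lborel (\<lambda>x. gauss x *\<^sub>R iexp (x \<bullet> w))"
    and "(\<integral>x. gauss x *\<^sub>R iexp (x \<bullet> w) \<partial>lborel) = complex_of_real (exp (- (norm w)\<^sup>2 / 2))"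
proof -
  define f where "f b t = std_normal_density t *\<^sub>R iexp (t * (w \<bullet> b))" for b t
  have f: "integrable lborel (f b)" for b
    unfolding f_def using integrable_normal_moment[of 1 0 0]
    by (rule Bochner_Integration.integrable_bound) (auto simp: norm_exp_eq_Re)
  have fint: "(\<integral>t. f b t \<partial>lborel) = complex_of_real (exp (- (w \<bullet> b)\<^sup>2 / 2))" for b
    using fun_cong[OF char_std_normal_distribution, of "w \<bullet> b"]
    by (simp add: char_def f_def integral_density mult.commute)
  let ?B = "Basis :: 'a set"
  have eq: "(\<Prod>b\<in>?B. f b (p b)) = gauss (\<Sum>b\<in>?B. p b *\<^sub>R b) *\<^sub>R iexp ((\<Sum>b\<in>?B. p b *\<^sub>R b) \<bullet> w)" for p
  proof -
    have "gauss (\<Sum>b\<in>?B. p b *\<^sub>R b) = (\<Prod>b\<in>?B. std_normal_density (p b))"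
      unfolding gauss_def by (intro prod.cong) (simp_all add: inner_sum_left_Basis)
    then show ?thesis
      by (simp add: f_def scaleR_conv_of_real prod.distrib exp_sum[symmetric] inner_sum_left
        sum_distrib_left inner_commute[of w])
  qed
  have "integrable (\<Pi>\<^sub>M b\<in>?B. lborel) (\<lambda>p. \<Prod>b\<in>?B. f b (p b))"
    by (intro lborel_Basis.product_integrable_prod f) auto
  then show "integrable lborel (\<lambda>x. gauss x *\<^sub>R iexp (x \<bullet> w))"
    unfolding eq by (subst lborel_eq) (simp add: integrable_distr_eq)
  have "(\<integral>x. gauss x *\<^sub>R iexp (x \<bullet> w) \<partial>lborel) = (\<integral>p. (\<Prod>b\<in>?B. f b (p b)) \<partial>(\<Pi>\<^sub>M b\<in>?B. lborel))"
    unfolding eq by (subst lborel_eq) (simp add: integral_distr)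
  also have "\<dots> = (\<Prod>b\<in>?B. \<integral>t. f b t \<partial>lborel)"
    by (intro lborel_Basis.product_integral_prod f) auto
  also have "\<dots> = complex_of_real (exp (\<Sum>b\<in>?B. - (w \<bullet> b)\<^sup>2 / 2))"
    by (simp add: fint exp_sum)
  also have "(\<Sum>b\<in>?B. - (w \<bullet> b)\<^sup>2 / 2) = - (norm w)\<^sup>2 / 2"
    by (subst norm_sq_eq_sum_Basis) (simp add: sum_negf sum_divide_distrib)
  finally show "(\<integral>x. gauss x *\<^sub>R iexp (x \<bullet> w) \<partial>lborel) = complex_of_real (exp (- (norm w)\<^sup>2 / 2))" .
qed

lemma gauss_integral:
  shows integrable_gauss: "integrable lborel (gauss :: 'a::euclidean_space \<Rightarrow> real)"
    and integral_gauss: "(\<integral>x. gauss (x::'a) \<partial>lborel) = 1"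
proof -
  have "integrable lborel (\<lambda>x. Re (gauss x *\<^sub>R iexp (x \<bullet> (0::'a))))"
    by (intro integrable_Re gauss_char_complex)
  then show "integrable lborel (gauss :: 'a \<Rightarrow> real)" by simp
  have "(\<integral>x. Re (gauss x *\<^sub>R iexp (x \<bullet> (0::'a))) \<partial>lborel) = 1"
    by (subst integral_Re[OF gauss_char_complex(1)], subst gauss_char_complex(2)) simp
  then show "(\<integral>x. gauss (x::'a) \<partial>lborel) = 1" by simp
qed

interpretation gauss_measure: prob_space "gauss_measure :: 'a::euclidean_space measure"
proof
  show "emeasure gauss_measure (space gauss_measure) = 1"
    by (simp add: emeasure_density nn_integral_eq_integral integrable_gauss integral_gauss gauss_nonneg)
qed

lemma gauss_measure_cos:
  fixes w :: "'a::euclidean_space"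
  shows "(\<integral>x. cos (x \<bullet> w) \<partial>gauss_measure) = exp (- (norm w)\<^sup>2 / 2)"
proof -
  have "(\<integral>x. cos (x \<bullet> w) \<partial>gauss_measure) = (\<integral>x. Re (gauss x *\<^sub>R iexp (x \<bullet> w)) \<partial>lborel)"
    by (subst integral_density) (auto simp: gauss_nonneg Re_exp)
  also have "\<dots> = exp (- (norm w)\<^sup>2 / 2)"
    by (subst integral_Re[OF gauss_char_complex(1)], subst gauss_char_complex(2)) simp
  finally show ?thesis .
qed

section \<open>Radial integrals\<close>

text \<open>The condition on \<open>q\<close> makes the power integrable at 0, the one on
  \<open>r\<close> at infinity. The breakpoint \<open>a\<close> stays free so that it can follow the
  scale of the integrand.\<close>

lemma nn_integral_le_powr_split:
  fixes f :: "real \<Rightarrow> real"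
  assumes "q > -1" "r < -1" "a > 0" "A \<ge> 0" "B \<ge> 0"
    and small: "\<And>s. 0 < s \<Longrightarrow> s \<le> a \<Longrightarrow> f s \<le> A * s powr q"
    and large: "\<And>s. a \<le> s \<Longrightarrow> f s \<le> B * s powr r"
  shows "(\<integral>\<^sup>+s. ennreal (f s) * indicator {0<..} s \<partial>lborel) \<le>
    ennreal (A * (a powr (q + 1) / (q + 1)) + B * (- (a powr (r + 1)) / (r + 1)))"
proof -
  have 1: "(\<integral>\<^sup>+s. ennreal (indicator {0..a} s * (A * s powr q)) \<partial>lborel) = ennreal (A * (a powr (q + 1) / (q + 1)))"
    using assms
    by (intro nn_integral_has_integral_lebesgue has_integral_mult_right has_integral_powr_from_0 mult_nonneg_nonneg)
      simp_all
  have 2: "(\<integral>\<^sup>+s. ennreal (indicator {a..} s * (B * s powr r)) \<partial>lborel) = ennreal (B * (- (a powr (r + 1)) / (r + 1)))"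
    using assms
    by (intro nn_integral_has_integral_lebesgue has_integral_mult_right has_integral_powr_to_inf mult_nonneg_nonneg)
      simp_all
  have "(\<integral>\<^sup>+s. ennreal (f s) * indicator {0<..} s \<partial>lborel) \<le>
      (\<integral>\<^sup>+s. ennreal (indicator {0..a} s * (A * s powr q)) + ennreal (indicator {a..} s * (B * s powr r)) \<partial>lborel)"
  proof (intro nn_integral_mono)
    fix s :: real
    show "ennreal (f s) * indicator {0<..} s \<le>
      ennreal (indicator {0..a} s * (A * s powr q)) + ennreal (indicator {a..} s * (B * s powr r))"
    proof -
      consider "s \<le> 0" | "0 < s" "s \<le> a" | "a < s" by linarith
      then show ?thesis
      proof cases
        case 2
        then show ?thesis using ennreal_leI[OF small[of s]] by (intro add_increasing2) simp_all
      next
        case 3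
        then show ?thesis using ennreal_leI[OF large[of s]] \<open>a > 0\<close> by (intro add_increasing) simp_all
      qed simp
    qed
  qed
  also have "\<dots> = ennreal (A * (a powr (q + 1) / (q + 1))) + ennreal (B * (- (a powr (r + 1)) / (r + 1)))"
    by (subst nn_integral_add) (auto simp: 1 2)
  also have "\<dots> = ennreal (A * (a powr (q + 1) / (q + 1)) + B * (- (a powr (r + 1)) / (r + 1)))"
    using assms by (intro ennreal_plus[symmetric] mult_nonneg_nonneg divide_nonneg_pos divide_nonpos_neg) simp_all
  finally show ?thesis .
qed

text \<open>Layer cake: \<open>|y|\<^sup>-\<^sup>p\<close> is the integral of \<open>p s\<^sup>-\<^sup>p\<^sup>-\<^sup>1\<close> over \<open>s \<ge> |y|\<close>.\<close>

lemma nn_integral_radial_le: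
  fixes k :: "real \<Rightarrow> real"
  assumes p: "p > 0" and [measurable]: "k \<in> borel_measurable borel"
    and k: "\<And>r. 0 \<le> r \<Longrightarrow> 0 \<le> k r" and mono: "\<And>r s. 0 \<le> r \<Longrightarrow> r \<le> s \<Longrightarrow> k r \<le> k s"
  shows "(\<integral>\<^sup>+y. ennreal (norm (y::'a::euclidean_space) powr (- p) * k (norm y)) \<partial>lborel) \<le>
    ennreal (unit_ball_vol DIM('a) * p) *
      (\<integral>\<^sup>+s. ennreal (s powr (real DIM('a) - p - 1) * k s) * indicator {0<..} s \<partial>lborel)"
proof -
  define F where "F y s = (if 0 < s \<and> norm y \<le> s then ennreal (p * s powr (- p - 1) * k s) else 0)"
    for y :: 'a and s :: real
  have [measurable]: "case_prod F \<in> borel_measurable (lborel \<Otimes>\<^sub>M lborel)"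
    unfolding F_def[abs_def] case_prod_beta by measurable
  have "(\<integral>\<^sup>+y. ennreal (norm (y::'a) powr (- p) * k (norm y)) \<partial>lborel) \<le> (\<integral>\<^sup>+y. (\<integral>\<^sup>+s. F y s \<partial>lborel) \<partial>lborel)"
  proof (rule nn_integral_mono)
    fix y :: 'a
    show "ennreal (norm y powr (- p) * k (norm y)) \<le> (\<integral>\<^sup>+s. F y s \<partial>lborel)"
    \<comment> \<open>At the origin \<open>0 powr (- p)\<close> is 0, so only
      \<open>y \<noteq> 0\<close> has content.\<close>
    proof (cases "y = 0")
      case False
      define r where "r = norm y"
      have r: "r > 0" using False by (simp add: r_def)
      have "(\<integral>\<^sup>+s. ennreal (indicator {r..} s * (k r * (p * s powr (- p - 1)))) \<partial>lborel) =
          ennreal (k r * (p * (- (r powr (- p - 1 + 1)) / (- p - 1 + 1))))"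
        using p r k[of r]
        by (intro nn_integral_has_integral_lebesgue has_integral_mult_right has_integral_powr_to_inf mult_nonneg_nonneg)
          simp_all
      also have "k r * (p * (- (r powr (- p - 1 + 1)) / (- p - 1 + 1))) = r powr (- p) * k r"
        using p by simp
      finally have "ennreal (r powr (- p) * k r) =
          (\<integral>\<^sup>+s. ennreal (indicator {r..} s * (k r * (p * s powr (- p - 1)))) \<partial>lborel)" ..
      \<comment> \<open>Since \<open>k r \<le> k s\<close> for \<open>s \<ge> r\<close>, the factor
        moves inside the layer-cake integral. After the interchange the inner integral over
        \<open>y\<close> is then just the volume of a ball.\<close>
      also have "\<dots> \<le> (\<integral>\<^sup>+s. F y s \<partial>lborel)"
      proof (rule nn_integral_mono)
        fix s
        show "ennreal (indicator {r..} s * (k r * (p * s powr (- p - 1)))) \<le> F y s"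
          using mono[of r s] p r
          by (cases "r \<le> s")
            (auto simp: F_def r_def[symmetric] mult.commute[of "k _"] intro!: ennreal_leI mult_left_mono)
      qed
      finally show ?thesis by (simp add: r_def)
    qed simp
  qed
  also have "\<dots> = (\<integral>\<^sup>+s. (\<integral>\<^sup>+y. F y s \<partial>lborel) \<partial>lborel)"
    by (rule lborel_pair.Fubini') simp
  also have "\<dots> = (\<integral>\<^sup>+s. ennreal (unit_ball_vol DIM('a) * p) *
      (ennreal (s powr (real DIM('a) - p - 1) * k s) * indicator {0<..} s) \<partial>lborel)"
  proof (rule nn_integral_cong)
    fix s :: real
    show "(\<integral>\<^sup>+y. F y s \<partial>lborel) = ennreal (unit_ball_vol DIM('a) * p) *
      (ennreal (s powr (real DIM('a) - p - 1) * k s) * indicator {0<..} s)"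
    proof (cases "s > 0")
      case True
      have "(\<integral>\<^sup>+y. F y s \<partial>lborel) = (\<integral>\<^sup>+y. ennreal (p * s powr (- p - 1) * k s) * indicator (cball (0::'a) s) y \<partial>lborel)"
        using True by (intro nn_integral_cong) (auto simp: F_def indicator_def)
      also have "\<dots> = ennreal (p * s powr (- p - 1) * k s) * ennreal (unit_ball_vol DIM('a) * s ^ DIM('a))"
        using True by (simp add: nn_integral_cmult_indicator emeasure_cball)
      also have "\<dots> = ennreal (unit_ball_vol DIM('a) * p * (s powr (real DIM('a) - p - 1) * k s))"
      proof -
        have "s powr (real DIM('a) - p - 1) = s ^ DIM('a) * s powr (- p - 1)"
          using True by (simp add: powr_realpow[symmetric] powr_add[symmetric] algebra_simps)
        then show ?thesis
          using True p k[of s] by (simp add: ennreal_mult'[symmetric] mult_ac)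
      qed
      finally show ?thesis
        using True p k[of s] by (simp add: ennreal_mult)
    qed (simp add: F_def)
  qed
  also have "\<dots> = ennreal (unit_ball_vol DIM('a) * p) *
      (\<integral>\<^sup>+s. ennreal (s powr (real DIM('a) - p - 1) * k s) * indicator {0<..} s \<partial>lborel)"
    by (subst nn_integral_cmult) auto
  finally show ?thesis .
qed

lemma one_minus_cos_le: "1 - cos (t::real) \<le> min 2 (t\<^sup>2 / 2)"
proof -
  have "1 - cos t = 2 * (sin (t / 2))\<^sup>2"
    using cos_double_sin[of "t / 2"] by simp
  also have "(sin (t / 2))\<^sup>2 \<le> (t / 2)\<^sup>2"
    using abs_sin_x_le_abs_x[of "t / 2"] by (metis abs_le_square_iff)
  finally show ?thesis
    using cos_ge_minus_one[of t] by (simp add: power2_eq_square)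
qed

text \<open>One half of the identity expressing \<open>|\<xi>|\<^sup>\<alpha>\<close> through the Levy measure.\<close>

lemma nn_integral_one_minus_cos_le:
  assumes "0 < \<alpha>" "\<alpha> < 2"
  shows "\<exists>C>0. \<forall>\<xi>::'a::euclidean_space.
    (\<integral>\<^sup>+y. ennreal ((1 - cos (\<xi> \<bullet> y)) / norm y powr (real DIM('a) + \<alpha>)) \<partial>lborel) \<le> ennreal (C * norm \<xi> powr \<alpha>)"
proof -
  let ?d = "real DIM('a)"
  \<comment> \<open>The first factor is the layer-cake constant for \<open>p = d + \<alpha>\<close>.
    After scaling by \<open>norm \<xi>\<close>, the two summands are the integrals of
    \<open>s powr (1 - \<alpha>) / 2\<close> over (0, 1) and of
    \<open>2 * s powr (- \<alpha> - 1)\<close> over (1, infinity); the first converges because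
    \<open>\<alpha> < 2\<close>, the second because \<open>\<alpha> > 0\<close>.\<close>
  define C where "C = unit_ball_vol ?d * (?d + \<alpha>) * (1 / (2 * (2 - \<alpha>)) + 2 / \<alpha>)"
  have "C > 0" using assms by (auto simp: C_def intro!: mult_pos_pos add_pos_pos)
  moreover have "(\<integral>\<^sup>+y. ennreal ((1 - cos (\<xi> \<bullet> y)) / norm y powr (?d + \<alpha>)) \<partial>lborel) \<le> ennreal (C * norm \<xi> powr \<alpha>)" for \<xi> :: 'a
  proof (cases "\<xi> = 0")
    case False
    define a where "a = norm \<xi>"
    have a: "a > 0" using False by (simp add: a_def)
    \<comment> \<open>A radial majorant of \<open>1 - cos (\<xi> \<bullet> y)\<close> that is
      increasing, as the layer-cake bound demands. Splitting the remaining integral at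
      \<open>1 / a\<close> makes both parts multiples of \<open>a powr \<alpha>\<close>.\<close>
    define k where "k s = min 2 (a\<^sup>2 * s\<^sup>2 / 2)" for s :: real
    have [measurable]: "k \<in> borel_measurable borel" unfolding k_def[abs_def] by measurable
    have k_mono: "k r \<le> k s" if "0 \<le> r" "r \<le> s" for r s
      unfolding k_def using that by (intro min.mono divide_right_mono mult_left_mono power_mono) auto
    have "(\<integral>\<^sup>+y. ennreal ((1 - cos (\<xi> \<bullet> y)) / norm y powr (?d + \<alpha>)) \<partial>lborel) \<le>
        (\<integral>\<^sup>+y. ennreal (norm (y::'a) powr (- (?d + \<alpha>)) * k (norm y)) \<partial>lborel)"
    proof (intro nn_integral_mono ennreal_leI)
      fix y :: 'a
      have "(\<xi> \<bullet> y)\<^sup>2 \<le> a\<^sup>2 * (norm y)\<^sup>2"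
        using Cauchy_Schwarz_ineq2[of \<xi> y] power_mono[of "\<bar>\<xi> \<bullet> y\<bar>" "norm \<xi> * norm y" 2]
        by (simp add: a_def power_mult_distrib)
      then have "1 - cos (\<xi> \<bullet> y) \<le> k (norm y)"
        using one_minus_cos_le[of "\<xi> \<bullet> y"] by (auto simp: k_def)
      then show "(1 - cos (\<xi> \<bullet> y)) / norm y powr (?d + \<alpha>) \<le> norm y powr (- (?d + \<alpha>)) * k (norm y)"
        by (simp only: powr_minus divide_inverse mult.commute[of _ "inverse _"]) (intro mult_left_mono, auto)
    qed
    also have "\<dots> \<le> ennreal (unit_ball_vol ?d * (?d + \<alpha>)) *
      (\<integral>\<^sup>+s. ennreal (s powr (?d - (?d + \<alpha>) - 1) * k s) * indicator {0<..} s \<partial>lborel)"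
      using assms
      by (intro nn_integral_radial_le k_mono) (auto simp: k_def)
    also have "(\<integral>\<^sup>+s. ennreal (s powr (?d - (?d + \<alpha>) - 1) * k s) * indicator {0<..} s \<partial>lborel) \<le>
      ennreal (a\<^sup>2 / 2 * ((1 / a) powr (1 - \<alpha> + 1) / (1 - \<alpha> + 1)) + 2 * (- ((1 / a) powr (- \<alpha> - 1 + 1)) / (- \<alpha> - 1 + 1)))"
    proof (rule nn_integral_le_powr_split)
      fix s :: real assume s: "0 < s"
      have "s powr (- \<alpha> - 1) * s\<^sup>2 = s powr (1 - \<alpha>)"
        using s powr_add[of s "- \<alpha> - 1" 2] by (simp add: powr_numeral)
      moreover have "s powr (- \<alpha> - 1) * k s \<le> s powr (- \<alpha> - 1) * (a\<^sup>2 * s\<^sup>2 / 2)"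
        by (intro mult_left_mono) (auto simp: k_def)
      ultimately show "s powr (?d - (?d + \<alpha>) - 1) * k s \<le> a\<^sup>2 / 2 * s powr (1 - \<alpha>)"
        by (simp add: algebra_simps)
    next
      fix s :: real assume s: "1 / a \<le> s"
      have "s powr (- \<alpha> - 1) * k s \<le> s powr (- \<alpha> - 1) * 2"
        by (intro mult_left_mono) (auto simp: k_def)
      then show "s powr (?d - (?d + \<alpha>) - 1) * k s \<le> 2 * s powr (- \<alpha> - 1)"
        by (simp add: algebra_simps)
    qed (use assms a in auto)
    also have "a\<^sup>2 / 2 * ((1 / a) powr (1 - \<alpha> + 1) / (1 - \<alpha> + 1)) + 2 * (- ((1 / a) powr (- \<alpha> - 1 + 1)) / (- \<alpha> - 1 + 1))
      = (1 / (2 * (2 - \<alpha>)) + 2 / \<alpha>) * a powr \<alpha>"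
    proof -
      have "(1 / a) powr (2 - \<alpha>) = a powr \<alpha> / a\<^sup>2"
        using a by (simp add: powr_divide powr_diff)
      moreover have "(1 / a) powr (- \<alpha>) = a powr \<alpha>"
        using a by (simp add: powr_divide powr_minus)
      ultimately show ?thesis using a assms by (simp add: field_simps)
    qed
    finally show ?thesis using assms
      by (simp add: C_def a_def ennreal_mult'[symmetric] mult.assoc mult_left_mono)
  qed simp
  ultimately show ?thesis by blast
qed

text \<open>The singularity at the origin is integrable because \<open>\<alpha>\<close> is below the
  dimension; outside the unit ball the power is at most 1 and the Gaussian mass is enough. The value
  bounds the dual weight when the average of \<open>u\<close> is estimated by its spectral
  energy.\<close>

lemma gauss_measure_powr_finite:
  assumes "0 < \<alpha>" "\<alpha> < real DIM('a::euclidean_space)"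
  shows "(\<integral>\<^sup>+x. ennreal (norm (x::'a) powr (- \<alpha>)) \<partial>gauss_measure) < \<infinity>"
proof -
  let ?d = "real DIM('a)"
  \<comment> \<open>On the unit ball \<open>norm x powr (- \<alpha>)\<close> equals
    \<open>norm x powr (- (?d + 1)) * k (norm x)\<close>. Raising the exponent to
    \<open>?d + 1\<close> makes the remaining factor increasing, and the cap at 1 leaves the
    integrable tail \<open>s powr (- 2)\<close>.\<close>
  define k where "k s = min 1 (s powr (?d + 1 - \<alpha>))" for s :: real
  have [measurable]: "k \<in> borel_measurable borel" unfolding k_def[abs_def] by measurable
  have "(\<integral>\<^sup>+x. ennreal (norm (x::'a) powr (- \<alpha>)) \<partial>gauss_measure) =
     (\<integral>\<^sup>+x. ennreal (gauss x) * ennreal (norm (x::'a) powr (- \<alpha>)) \<partial>lborel)"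
    by (simp add: nn_integral_density)
  also have "\<dots> \<le> (\<integral>\<^sup>+x. ennreal (gauss x) + ennreal (gauss (0::'a)) *
      ennreal (norm (x::'a) powr (- (?d + 1)) * k (norm x)) \<partial>lborel)"
  proof (rule nn_integral_mono)
    fix x :: 'a
    have g0: "gauss x \<le> gauss (0::'a)"
      by (subst gauss_eq) (simp add: mult_left_le less_imp_le[OF gauss_zero_pos])
    show "ennreal (gauss x) * ennreal (norm x powr (- \<alpha>)) \<le> ennreal (gauss x) + ennreal (gauss (0::'a)) *
      ennreal (norm x powr (- (?d + 1)) * k (norm x))"
    proof (cases "norm x \<le> 1")
      case True
      then have "k (norm x) = norm x powr (?d + 1 - \<alpha>)"
        using assms by (auto simp: k_def intro!: min_absorb2 powr_le1)
      then have "norm x powr (- (?d + 1)) * k (norm x) = norm x powr (- \<alpha>)"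
        by (simp add: powr_add[symmetric])
      then show ?thesis
        using g0 by (intro add_increasing) (auto intro!: mult_right_mono ennreal_leI simp del: minus_add_distrib)
    next
      case False
      then have "norm x powr (- \<alpha>) \<le> 1"
        using assms powr_mono[of "- \<alpha>" 0 "norm x"] by (auto split: if_splits)
      then have "ennreal (gauss x) * ennreal (norm x powr (- \<alpha>)) \<le> ennreal (gauss x) * 1"
        by (intro mult_left_mono) auto
      then show ?thesis by (intro add_increasing2) auto
    qed
  qed
  also have "\<dots> = (\<integral>\<^sup>+x. ennreal (gauss (x::'a)) \<partial>lborel) + ennreal (gauss (0::'a)) *
      (\<integral>\<^sup>+x. ennreal (norm (x::'a) powr (- (?d + 1)) * k (norm x)) \<partial>lborel)"
    by (simp add: nn_integral_add nn_integral_cmult)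
  also have "\<dots> < \<infinity>"
  proof -
    have "(\<integral>\<^sup>+x. ennreal (gauss (x::'a)) \<partial>lborel) < \<infinity>"
      using integrable_gauss[where 'a='a] by (simp add: nn_integral_eq_integral gauss_nonneg)
    moreover have "(\<integral>\<^sup>+x. ennreal (norm (x::'a) powr (- (?d + 1)) * k (norm x)) \<partial>lborel) \<le>
      ennreal (unit_ball_vol ?d * (?d + 1)) *
        (\<integral>\<^sup>+s. ennreal (s powr (?d - (?d + 1) - 1) * k s) * indicator {0<..} s \<partial>lborel)"
      using assms unfolding k_def by (intro nn_integral_radial_le min.mono powr_mono2) auto
    moreover have "(\<integral>\<^sup>+s. ennreal (s powr (?d - (?d + 1) - 1) * k s) * indicator {0<..} s \<partial>lborel) \<le>
      ennreal (1 * (1 powr (?d - 1 - \<alpha> + 1) / (?d - 1 - \<alpha> + 1)) + 1 * (- (1 powr (- 2 + 1)) / (- 2 + 1)))"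
    proof (rule nn_integral_le_powr_split)
      fix s :: real assume s: "0 < s"
      have "s powr (- 2) * k s \<le> s powr (- 2) * s powr (?d + 1 - \<alpha>)"
        by (intro mult_left_mono) (auto simp: k_def)
      also have "\<dots> = s powr (?d - 1 - \<alpha>)"
        using s by (simp add: powr_add[symmetric] algebra_simps)
      finally show "s powr (?d - (?d + 1) - 1) * k s \<le> 1 * s powr (?d - 1 - \<alpha>)"
        by simp
    next
      fix s :: real assume s: "1 \<le> s"
      have "s powr (- 2) * k s \<le> s powr (- 2) * 1"
        by (intro mult_left_mono) (auto simp: k_def)
      then show "s powr (?d - (?d + 1) - 1) * k s \<le> 1 * s powr (- 2)"
        by simp
    qed (use assms in auto)
    ultimately have "(\<integral>\<^sup>+x. ennreal (norm (x::'a) powr (- (?d + 1)) * k (norm x)) \<partial>lborel) \<le>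
      ennreal (unit_ball_vol ?d * (?d + 1)) *
      ennreal (1 * (1 powr (?d - 1 - \<alpha> + 1) / (?d - 1 - \<alpha> + 1)) + 1 * (- (1 powr (- 2 + 1)) / (- 2 + 1)))"
      by (meson mult_left_mono order_trans zero_le)
    also have "\<dots> < \<infinity>" by (simp add: ennreal_mult_less_top)
    finally have "(\<integral>\<^sup>+x. ennreal (norm (x::'a) powr (- (?d + 1)) * k (norm x)) \<partial>lborel) < \<infinity>" .
    with \<open>(\<integral>\<^sup>+x. ennreal (gauss (x::'a)) \<partial>lborel) < \<infinity>\<close> show ?thesis
      by (simp add: ennreal_mult_less_top)
  qed
  finally show ?thesis .
qed

section \<open>Autocorrelation and power spectrum\<close>

text \<open>An integrable weight on one side and a bounded kernel over a finite measure on the other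
  make the product integrable, so Fubini applies. Every interchange of Lebesgue measure with a
  Gaussian or probabilistic average of signed integrands has this shape.\<close>

lemma integral_weight_swap:
  fixes u :: "'x \<Rightarrow> real" and k :: "'x \<Rightarrow> 'y \<Rightarrow> real"
  assumes "sigma_finite_measure M" "finite_measure N"
    and u: "integrable M u"
    and k[measurable]: "case_prod k \<in> borel_measurable (M \<Otimes>\<^sub>M N)" and bd: "\<And>x y. \<bar>k x y\<bar> \<le> K"
  shows "(\<integral>x. u x * (\<integral>y. k x y \<partial>N) \<partial>M) = (\<integral>y. (\<integral>x. u x * k x y \<partial>M) \<partial>N)"
proof -
  interpret M: sigma_finite_measure M by fact
  interpret N: finite_measure N by fact
  interpret pair_sigma_finite M N by unfold_locales
  have [measurable]: "u \<in> borel_measurable M" using u by auto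
  have kx: "integrable N (k x)" if "x \<in> space M" for x
  proof (rule N.integrable_const_bound[of _ K])
    show "k x \<in> borel_measurable N" using that by measurable
  qed (use bd in auto)
  have "integrable (M \<Otimes>\<^sub>M N) (\<lambda>(x, y). u x * k x y)"
  proof (rule Fubini_integrable)
    show "integrable M (\<lambda>x. \<integral>y. norm (case (x, y) of (x, y) \<Rightarrow> u x * k x y) \<partial>N)"
    proof (rule Bochner_Integration.integrable_bound)
      show "integrable M (\<lambda>x. u x * (\<bar>K\<bar> * measure N (space N)))" using u by simp
      show "AE x in M. norm (\<integral>y. norm (case (x, y) of (x, y) \<Rightarrow> u x * k x y) \<partial>N)
          \<le> norm (u x * (\<bar>K\<bar> * measure N (space N)))"
      proof (rule AE_I2)
        fix x assume x: "x \<in> space M"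
        have "(\<integral>y. \<bar>k x y\<bar> \<partial>N) \<le> (\<integral>y. \<bar>K\<bar> \<partial>N)"
          using kx[OF x] bd by (intro integral_mono) (auto intro: order_trans[OF _ abs_ge_self])
        then show "norm (\<integral>y. norm (case (x, y) of (x, y) \<Rightarrow> u x * k x y) \<partial>N)
          \<le> norm (u x * (\<bar>K\<bar> * measure N (space N)))"
          by (simp add: abs_mult mult_left_mono mult.commute[of "\<bar>K\<bar>"])
      qed
    qed measurable
    show "AE x in M. integrable N (\<lambda>y. case (x, y) of (x, y) \<Rightarrow> u x * k x y)"
      using kx by (intro AE_I2) simp
  qed measurable
  from Fubini_integral[OF this] show ?thesis by simp
qed

lemma lborel_integral_affine:
  fixes t :: "'a::euclidean_space" and f :: "'a \<Rightarrow> real"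
  assumes [measurable]: "f \<in> borel_measurable borel" and c: "c > 0"
  shows "(\<integral>x. f x \<partial>lborel) = c ^ DIM('a) * (\<integral>x. f (t + c *\<^sub>R x) \<partial>lborel)"
  using c by (subst lborel_affine[of c t]) (simp_all add: integral_density integral_distr)

definition autocorr :: "('a::euclidean_space \<Rightarrow> real) \<Rightarrow> 'a \<Rightarrow> real" where
  "autocorr u h = (\<integral>x. u x * u (x + h) \<partial>lborel)"

text \<open>The squared modulus of the unnormalised Fourier transform, split into cosine and sine
  parts so that everything stays real.\<close>

definition power_spectrum :: "('a::euclidean_space \<Rightarrow> real) \<Rightarrow> 'a \<Rightarrow> real" where
  "power_spectrum u \<xi> = (\<integral>x. u x * cos (\<xi> \<bullet> x) \<partial>lborel)\<^sup>2 + (\<integral>x. u x * sin (\<xi> \<bullet> x) \<partial>lborel)\<^sup>2"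

lemma power_spectrum_nonneg: "0 \<le> power_spectrum u \<xi>"
  by (simp add: power_spectrum_def)

text \<open>The common properties of the death probabilities of the skeleton walk and of the process
  before a finite time. Integrability together with the bound 1 gives square integrability, so the
  autocorrelation exists and is bounded by the integral of \<open>u\<close>.\<close>

locale potential_function =
  fixes u :: "'a::euclidean_space \<Rightarrow> real"
  assumes u_integrable: "integrable lborel u"
    and u_nonneg: "\<And>x. 0 \<le> u x" and u_le_1: "\<And>x. u x \<le> 1"
begin

lemma u_measurable[measurable]: "u \<in> borel_measurable borel"
  using u_integrable by auto

lemma integrable_mult_bounded:
  assumes [measurable]: "k \<in> borel_measurable borel" and "\<And>x. \<bar>k x\<bar> \<le> (1::real)"
  shows "integrable lborel (\<lambda>x. u x * k x)"
  by (rule Bochner_Integration.integrable_bound[OF u_integrable])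
    (use assms(2) u_nonneg in \<open>auto simp: abs_mult mult_left_le\<close>)

lemma abs_integral_mult_bounded:
  assumes [measurable]: "k \<in> borel_measurable borel" and "\<And>x. \<bar>k x\<bar> \<le> (1::real)"
  shows "\<bar>\<integral>x. u x * k x \<partial>lborel\<bar> \<le> (\<integral>x. u x \<partial>lborel)"
proof -
  have "\<bar>\<integral>x. u x * k x \<partial>lborel\<bar> \<le> (\<integral>x. \<bar>u x * k x\<bar> \<partial>lborel)" by (rule integral_abs_bound)
  also have "\<dots> \<le> (\<integral>x. u x \<partial>lborel)"
    using integrable_mult_bounded[of "\<lambda>x. \<bar>k x\<bar>"] u_integrable assms(2) u_nonneg
    by (intro integral_mono) (auto simp: abs_mult mult_left_le)
  finally show ?thesis .
qed

lemma integrable_autocorr_integrand: "integrable lborel (\<lambda>x. u x * u (x + h))"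
  by (rule integrable_mult_bounded) (use u_nonneg u_le_1 in auto)

lemma autocorr_nonneg: "0 \<le> autocorr u h"
  unfolding autocorr_def using u_nonneg by (intro integral_nonneg_AE) auto

lemma autocorr_le: "autocorr u h \<le> (\<integral>x. u x \<partial>lborel)"
  using abs_integral_mult_bounded[of "\<lambda>x. u (x + h)"] u_nonneg u_le_1 by (auto simp: autocorr_def)

lemma borel_measurable_autocorr[measurable]: "autocorr u \<in> borel_measurable borel"
  unfolding autocorr_def[abs_def] by measurable

lemma borel_measurable_power_spectrum[measurable]: "power_spectrum u \<in> borel_measurable borel"
  unfolding power_spectrum_def[abs_def] by measurable

lemma power_spectrum_le: "power_spectrum u \<xi> \<le> 2 * (\<integral>x. u x \<partial>lborel)\<^sup>2"
  using power_mono[OF abs_integral_mult_bounded[of "\<lambda>x. cos (\<xi> \<bullet> x)"], of 2]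
    power_mono[OF abs_integral_mult_bounded[of "\<lambda>x. sin (\<xi> \<bullet> x)"], of 2]
  by (auto simp: power_spectrum_def)

text \<open>The addition formulas separate \<open>x\<close>, \<open>y\<close> and \<open>z\<close>.
  The mixed terms, both \<open>C * D * sin (\<xi> \<bullet> y)\<close> with opposite signs, cancel,
  and \<open>C\<close> squared plus \<open>D\<close> squared remains.\<close>

lemma integral_cos_convolution:
  "(\<integral>x. u x * (\<integral>z. u z * cos (\<xi> \<bullet> (z - x - y)) \<partial>lborel) \<partial>lborel) = cos (\<xi> \<bullet> y) * power_spectrum u \<xi>"
proof -
  define C where "C = (\<integral>x. u x * cos (\<xi> \<bullet> x) \<partial>lborel)"
  define D where "D = (\<integral>x. u x * sin (\<xi> \<bullet> x) \<partial>lborel)"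
  have c: "integrable lborel (\<lambda>x. u x * cos (\<xi> \<bullet> x))" and s: "integrable lborel (\<lambda>x. u x * sin (\<xi> \<bullet> x))"
    by (intro integrable_mult_bounded; simp)+
  have inner_integral: "(\<integral>z. u z * cos (\<xi> \<bullet> (z - x - y)) \<partial>lborel) = C * cos (\<xi> \<bullet> x + \<xi> \<bullet> y) + D * sin (\<xi> \<bullet> x + \<xi> \<bullet> y)" for x
  proof -
    have "(\<integral>z. u z * cos (\<xi> \<bullet> (z - x - y)) \<partial>lborel) =
      (\<integral>z. u z * cos (\<xi> \<bullet> z) * cos (\<xi> \<bullet> x + \<xi> \<bullet> y) + u z * sin (\<xi> \<bullet> z) * sin (\<xi> \<bullet> x + \<xi> \<bullet> y) \<partial>lborel)"
      by (intro Bochner_Integration.integral_cong refl)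
        (simp add: inner_diff_right diff_diff_eq cos_diff algebra_simps)
    also have "\<dots> = C * cos (\<xi> \<bullet> x + \<xi> \<bullet> y) + D * sin (\<xi> \<bullet> x + \<xi> \<bullet> y)"
      using c s by (simp add: C_def D_def)
    finally show ?thesis .
  qed
  have "(\<integral>x. u x * (\<integral>z. u z * cos (\<xi> \<bullet> (z - x - y)) \<partial>lborel) \<partial>lborel) =
    (\<integral>x. (C * cos (\<xi> \<bullet> y) + D * sin (\<xi> \<bullet> y)) * (u x * cos (\<xi> \<bullet> x)) +
      (D * cos (\<xi> \<bullet> y) - C * sin (\<xi> \<bullet> y)) * (u x * sin (\<xi> \<bullet> x)) \<partial>lborel)"
    unfolding inner_integral
    by (intro Bochner_Integration.integral_cong refl) (simp add: cos_add sin_add algebra_simps)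
  also have "\<dots> = (C * cos (\<xi> \<bullet> y) + D * sin (\<xi> \<bullet> y)) * C + (D * cos (\<xi> \<bullet> y) - C * sin (\<xi> \<bullet> y)) * D"
    using c s by (simp add: C_def D_def)
  also have "\<dots> = cos (\<xi> \<bullet> y) * power_spectrum u \<xi>"
    by (simp add: power_spectrum_def C_def[symmetric] D_def[symmetric] power2_eq_square algebra_simps)
  finally show ?thesis .
qed

text \<open>After the substitution \<open>z = y + w / \<sigma>\<close> the Gaussian weight is
  replaced by its own representation as a Gaussian average of cosines. This is Fourier inversion for
  a smoothed function; the transform of \<open>u\<close> itself need not be integrable.\<close>

lemma gauss_smoothing:
  assumes "\<sigma> > 0"
  shows "(\<integral>w. u (y + (1 / \<sigma>) *\<^sub>R w) \<partial>gauss_measure) =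
    \<sigma> ^ DIM('a) * gauss (0::'a) * (\<integral>\<zeta>. (\<integral>z. u z * cos (\<sigma> *\<^sub>R \<zeta> \<bullet> (z - y)) \<partial>lborel) \<partial>gauss_measure)"
proof -
  have "(\<integral>w. u (y + (1 / \<sigma>) *\<^sub>R w) \<partial>gauss_measure) = (\<integral>w. gauss w * u (y + (1 / \<sigma>) *\<^sub>R w) \<partial>lborel)"
    by (subst integral_density) (auto simp: gauss_nonneg)
  also have "\<dots> = \<sigma> ^ DIM('a) * (\<integral>z. gauss (\<sigma> *\<^sub>R (z - y)) * u z \<partial>lborel)"
    using assms by (subst lborel_integral_affine[of _ \<sigma> "- \<sigma> *\<^sub>R y"])
      (simp_all add: scaleR_diff_right algebra_simps)
  also have "(\<integral>z. gauss (\<sigma> *\<^sub>R (z - y)) * u z \<partial>lborel) =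
      gauss (0::'a) * (\<integral>z. u z * (\<integral>\<zeta>. cos (\<sigma> *\<^sub>R \<zeta> \<bullet> (z - y)) \<partial>gauss_measure) \<partial>lborel)"
  proof -
    have "gauss (\<sigma> *\<^sub>R (z - y)) = gauss (0::'a) * (\<integral>\<zeta>. cos (\<sigma> *\<^sub>R \<zeta> \<bullet> (z - y)) \<partial>gauss_measure)" for z
      using gauss_measure_cos[of "\<sigma> *\<^sub>R (z - y)"] by (subst gauss_eq) simp
    then show ?thesis by (simp add: mult_ac)
  qed
  also have "(\<integral>z. u z * (\<integral>\<zeta>. cos (\<sigma> *\<^sub>R \<zeta> \<bullet> (z - y)) \<partial>gauss_measure) \<partial>lborel) =
      (\<integral>\<zeta>. (\<integral>z. u z * cos (\<sigma> *\<^sub>R \<zeta> \<bullet> (z - y)) \<partial>lborel) \<partial>gauss_measure)"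
    by (rule integral_weight_swap[where K=1])
      (auto simp: u_integrable gauss_measure.finite_measure_axioms lborel.sigma_finite_measure_axioms)
  finally show ?thesis by simp
qed

text \<open>The autocorrelation has the power spectrum as its Fourier transform, here in a form
  smoothed at width \<open>1 / \<sigma>\<close> in space and weighted at width
  \<open>\<sigma>\<close> in frequency. For large \<open>\<sigma>\<close> the left side approaches
  \<open>autocorr u y\<close>.\<close>

lemma autocorr_smoothing:
  assumes "\<sigma> > 0"
  shows "(\<integral>w. autocorr u (y + (1 / \<sigma>) *\<^sub>R w) \<partial>gauss_measure) =
    \<sigma> ^ DIM('a) * gauss (0::'a) * (\<integral>\<zeta>. cos (\<sigma> *\<^sub>R \<zeta> \<bullet> y) * power_spectrum u (\<sigma> *\<^sub>R \<zeta>) \<partial>gauss_measure)"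
proof -
  have "(\<integral>w. autocorr u (y + (1 / \<sigma>) *\<^sub>R w) \<partial>gauss_measure) =
    (\<integral>w. (\<integral>x. u x * u (x + y + (1 / \<sigma>) *\<^sub>R w) \<partial>lborel) \<partial>gauss_measure)"
    by (simp add: autocorr_def add.assoc)
  also have "\<dots> = (\<integral>x. u x * (\<integral>w. u (x + y + (1 / \<sigma>) *\<^sub>R w) \<partial>gauss_measure) \<partial>lborel)"
    by (rule integral_weight_swap[where K=1, symmetric])
      (use u_nonneg u_le_1 in \<open>auto simp: u_integrable gauss_measure.finite_measure_axioms lborel.sigma_finite_measure_axioms\<close>)
  also have "\<dots> = \<sigma> ^ DIM('a) * gauss (0::'a) *
      (\<integral>x. u x * (\<integral>\<zeta>. (\<integral>z. u z * cos (\<sigma> *\<^sub>R \<zeta> \<bullet> (z - x - y)) \<partial>lborel) \<partial>gauss_measure) \<partial>lborel)"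
    by (simp only: gauss_smoothing[OF assms] diff_diff_eq mult.left_commute[of "u _"] integral_mult_right_zero mult.assoc)
  also have "(\<integral>x. u x * (\<integral>\<zeta>. (\<integral>z. u z * cos (\<sigma> *\<^sub>R \<zeta> \<bullet> (z - x - y)) \<partial>lborel) \<partial>gauss_measure) \<partial>lborel) =
      (\<integral>\<zeta>. (\<integral>x. u x * (\<integral>z. u z * cos (\<sigma> *\<^sub>R \<zeta> \<bullet> (z - x - y)) \<partial>lborel) \<partial>lborel) \<partial>gauss_measure)"
    by (rule integral_weight_swap[where K="\<integral>x. u x \<partial>lborel"])
      (auto intro!: abs_integral_mult_bounded simp: u_integrable gauss_measure.finite_measure_axioms
        lborel.sigma_finite_measure_axioms)
  also have "\<dots> = (\<integral>\<zeta>. cos (\<sigma> *\<^sub>R \<zeta> \<bullet> y) * power_spectrum u (\<sigma> *\<^sub>R \<zeta>) \<partial>gauss_measure)"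
    by (simp only: integral_cos_convolution)
  finally show ?thesis .
qed

lemma integrable_autocorr_gauss: "integrable gauss_measure (\<lambda>w. autocorr u (y + c *\<^sub>R w))"
  by (rule gauss_measure.integrable_const_bound[of _ "\<integral>x. u x \<partial>lborel"])
    (auto simp: autocorr_nonneg autocorr_le)

lemma integrable_power_spectrum_gauss:
  assumes [measurable]: "k \<in> borel_measurable borel" and k: "\<And>x. \<bar>k x\<bar> \<le> (1::real)"
  shows "integrable gauss_measure (\<lambda>\<zeta>. k \<zeta> * power_spectrum u (\<sigma> *\<^sub>R \<zeta>))"
proof (rule gauss_measure.integrable_const_bound[of _ "2 * (\<integral>x. u x \<partial>lborel)\<^sup>2"])
  have "\<bar>k x\<bar> * power_spectrum u (\<sigma> *\<^sub>R x) \<le> 1 * (2 * (\<integral>x. u x \<partial>lborel)\<^sup>2)" for x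
    by (intro mult_mono k power_spectrum_le power_spectrum_nonneg) simp
  then show "AE x in gauss_measure. norm (k x * power_spectrum u (\<sigma> *\<^sub>R x)) \<le> 2 * (\<integral>x. u x \<partial>lborel)\<^sup>2"
    by (simp add: abs_mult power_spectrum_nonneg)
qed measurable

text \<open>The hypothesis on \<open>B\<close> holds for every shift, so it survives the average
  over \<open>h = w / \<sigma>\<close> with Gaussian \<open>w\<close>, a probability measure. On the
  frequency side a random shift by \<open>Y\<close> multiplies the power spectrum by
  \<open>\<psi>\<close>, and the difference produces the weight \<open>1 - \<psi>\<close>.\<close>

lemma spectral_energy_le:
  fixes Y :: "'w \<Rightarrow> 'a"
  assumes "prob_space M" and [measurable]: "Y \<in> borel_measurable M"
    and \<psi>: "\<And>\<xi>. (\<integral>\<omega>. cos (\<xi> \<bullet> Y \<omega>) \<partial>M) = \<psi> \<xi>" and [measurable]: "\<psi> \<in> borel_measurable borel"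
    and B: "\<And>h. autocorr u h - (\<integral>\<omega>. autocorr u (h + Y \<omega>) \<partial>M) \<le> B" and \<sigma>: "\<sigma> > 0"
  shows "\<sigma> ^ DIM('a) * gauss (0::'a) * (\<integral>\<zeta>. (1 - \<psi> (\<sigma> *\<^sub>R \<zeta>)) * power_spectrum u (\<sigma> *\<^sub>R \<zeta>) \<partial>gauss_measure) \<le> B"
proof -
  interpret M: prob_space M by fact
  let ?c = "\<sigma> ^ DIM('a) * gauss (0::'a)"
  let ?J = "\<lambda>y. \<integral>w. autocorr u (y + (1 / \<sigma>) *\<^sub>R w) \<partial>gauss_measure"
  have \<psi>_bd: "\<bar>\<psi> \<xi>\<bar> \<le> 1" for \<xi>
  proof -
    have "\<bar>\<psi> \<xi>\<bar> \<le> (\<integral>\<omega>. \<bar>cos (\<xi> \<bullet> Y \<omega>)\<bar> \<partial>M)" unfolding \<psi>[symmetric] by (rule integral_abs_bound)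
    also have "\<dots> \<le> (\<integral>\<omega>. 1 \<partial>M)"
      by (intro integral_mono M.integrable_const_bound[of _ 1]) auto
    finally show ?thesis by (simp add: M.prob_space)
  qed
  have J: "(\<integral>\<omega>. ?J (Y \<omega>) \<partial>M) = ?c * (\<integral>\<zeta>. \<psi> (\<sigma> *\<^sub>R \<zeta>) * power_spectrum u (\<sigma> *\<^sub>R \<zeta>) \<partial>gauss_measure)"
  proof -
    have "(\<integral>\<omega>. ?J (Y \<omega>) \<partial>M) = ?c * (\<integral>\<omega>. 1 * (\<integral>\<zeta>. cos (\<sigma> *\<^sub>R \<zeta> \<bullet> Y \<omega>) * power_spectrum u (\<sigma> *\<^sub>R \<zeta>) \<partial>gauss_measure) \<partial>M)"
      by (simp add: autocorr_smoothing[OF \<sigma>])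
    also have "(\<integral>\<omega>. 1 * (\<integral>\<zeta>. cos (\<sigma> *\<^sub>R \<zeta> \<bullet> Y \<omega>) * power_spectrum u (\<sigma> *\<^sub>R \<zeta>) \<partial>gauss_measure) \<partial>M) =
        (\<integral>\<zeta>. (\<integral>\<omega>. 1 * (cos (\<sigma> *\<^sub>R \<zeta> \<bullet> Y \<omega>) * power_spectrum u (\<sigma> *\<^sub>R \<zeta>)) \<partial>M) \<partial>gauss_measure)"
    proof (rule integral_weight_swap[where K="1 * (2 * (\<integral>x. u x \<partial>lborel)\<^sup>2)"])
      fix x y
      show "\<bar>cos (\<sigma> *\<^sub>R y \<bullet> Y x) * power_spectrum u (\<sigma> *\<^sub>R y)\<bar> \<le> 1 * (2 * (\<integral>x. u x \<partial>lborel)\<^sup>2)"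
        unfolding abs_mult by (intro mult_mono) (auto simp: power_spectrum_nonneg power_spectrum_le)
    qed (auto simp: gauss_measure.finite_measure_axioms M.sigma_finite_measure_axioms)
    finally show ?thesis by (simp only: mult_1 integral_mult_left_zero \<psi>)
  qed
  \<comment> \<open>The same average with the Gaussian integral outermost, which is the order in
    which the hypothesis on \<open>B\<close> can be used.\<close>
  have swap: "(\<integral>\<omega>. ?J (Y \<omega>) \<partial>M) = (\<integral>w. (\<integral>\<omega>. autocorr u ((1 / \<sigma>) *\<^sub>R w + Y \<omega>) \<partial>M) \<partial>gauss_measure)"
    using integral_weight_swap[of M gauss_measure "\<lambda>_. 1" "\<lambda>\<omega> w. autocorr u (Y \<omega> + (1 / \<sigma>) *\<^sub>R w)" "\<integral>x. u x \<partial>lborel"]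
    by (simp add: M.sigma_finite_measure_axioms gauss_measure.finite_measure_axioms autocorr_nonneg autocorr_le add.commute)
  have int: "integrable gauss_measure (\<lambda>w. \<integral>\<omega>. autocorr u ((1 / \<sigma>) *\<^sub>R w + Y \<omega>) \<partial>M)"
  proof (rule gauss_measure.integrable_const_bound[of _ "\<integral>x. u x \<partial>lborel"])
    have "(\<integral>\<omega>. autocorr u (h + Y \<omega>) \<partial>M) \<le> (\<integral>\<omega>. (\<integral>x. u x \<partial>lborel) \<partial>M)" for h
      by (rule integral_mono[OF M.integrable_const_bound[of _ "\<integral>x. u x \<partial>lborel"]])
        (auto simp: autocorr_nonneg autocorr_le)
    moreover have "0 \<le> (\<integral>\<omega>. autocorr u (h + Y \<omega>) \<partial>M)" for h
      by (rule integral_nonneg_AE) (simp add: autocorr_nonneg)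
    ultimately have "\<bar>\<integral>\<omega>. autocorr u (h + Y \<omega>) \<partial>M\<bar> \<le> (\<integral>x. u x \<partial>lborel)" for h
      by (simp add: M.prob_space)
    then show "AE w in gauss_measure. norm (\<integral>\<omega>. autocorr u ((1 / \<sigma>) *\<^sub>R w + Y \<omega>) \<partial>M) \<le> (\<integral>x. u x \<partial>lborel)"
      by simp
  qed measurable
  have "?c * (\<integral>\<zeta>. (1 - \<psi> (\<sigma> *\<^sub>R \<zeta>)) * power_spectrum u (\<sigma> *\<^sub>R \<zeta>) \<partial>gauss_measure) =
    ?c * (\<integral>\<zeta>. cos (\<sigma> *\<^sub>R \<zeta> \<bullet> 0) * power_spectrum u (\<sigma> *\<^sub>R \<zeta>) - \<psi> (\<sigma> *\<^sub>R \<zeta>) * power_spectrum u (\<sigma> *\<^sub>R \<zeta>) \<partial>gauss_measure)"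
    by (simp add: left_diff_distrib)
  also have "\<dots> = ?J 0 - (\<integral>\<omega>. ?J (Y \<omega>) \<partial>M)"
    by (subst J, subst autocorr_smoothing[OF \<sigma>], subst Bochner_Integration.integral_diff,
      (intro integrable_power_spectrum_gauss \<psi>_bd; simp)+)
      (simp add: right_diff_distrib)
  also have "\<dots> = (\<integral>w. autocorr u ((1 / \<sigma>) *\<^sub>R w) - (\<integral>\<omega>. autocorr u ((1 / \<sigma>) *\<^sub>R w + Y \<omega>) \<partial>M) \<partial>gauss_measure)"
    using int integrable_autocorr_gauss[of 0 "1 / \<sigma>"] by (simp add: swap)
  also have "\<dots> \<le> (\<integral>w. B \<partial>(gauss_measure :: 'a measure))"
    using int integrable_autocorr_gauss[of 0 "1 / \<sigma>"] by (intro integral_mono B) auto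
  also have "\<dots> = B" using gauss_measure.prob_space[where 'a='a] by simp
  finally show ?thesis .
qed

end

section \<open>From spectral energy to the Gagliardo form and to a Gaussian average\<close>

interpretation gauss_lborel: pair_sigma_finite "gauss_measure :: 'a::euclidean_space measure" "lborel :: 'a measure" ..

context potential_function
begin

text \<open>As \<open>u\<close> is at most 1, the increment of the autocorrelation at any
  \<open>y\<close> is bounded by the L1 distance of \<open>u\<close> and its translate by
  \<open>h n\<close>, which does not involve \<open>y\<close>.\<close>

lemma autocorr_tendsto:
  assumes "h \<longlonglongrightarrow> 0"
  shows "(\<lambda>n. autocorr u (y + h n)) \<longlonglongrightarrow> autocorr u y"
proof (rule Lim_transform_bound[where g="\<lambda>n. \<integral>x. \<bar>u (x + h n) - u x\<bar> \<partial>lborel", THEN LIM_zero_cancel])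
  show "\<forall>\<^sub>F n in sequentially. norm (autocorr u (y + h n) - autocorr u y) \<le> norm (\<integral>x. \<bar>u (x + h n) - u x\<bar> \<partial>lborel)"
  proof (intro always_eventually allI)
    fix n
    have int: "integrable lborel (\<lambda>x. u (x + a) - u (x + b))" for a b
      by (intro Bochner_Integration.integrable_diff integrable_lborel_translation u_integrable)
    have "autocorr u (y + h n) - autocorr u y = (\<integral>x. u x * (u (x + (y + h n)) - u (x + y)) \<partial>lborel)"
      unfolding autocorr_def right_diff_distrib
      by (intro Bochner_Integration.integral_diff[symmetric] integrable_autocorr_integrand)
    also have "\<bar>\<dots>\<bar> \<le> (\<integral>x. \<bar>u x * (u (x + (y + h n)) - u (x + y))\<bar> \<partial>lborel)"
      by (rule integral_abs_bound)
    also have "\<dots> \<le> (\<integral>x. \<bar>u (x + (y + h n)) - u (x + y)\<bar> \<partial>lborel)"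
      using u_nonneg u_le_1 int[of "y + h n" y]
      by (intro integral_mono_AE')
        (auto simp: abs_mult mult_left_le_one_le intro!: AE_I2)
    also have "\<dots> = (\<integral>x. \<bar>u (x + h n) - u x\<bar> \<partial>lborel)"
      using integral_lborel_translation[of "\<lambda>x. \<bar>u (x + h n) - u x\<bar>" y] by (simp add: add_ac)
    finally show "norm (autocorr u (y + h n) - autocorr u y) \<le> norm (\<integral>x. \<bar>u (x + h n) - u x\<bar> \<partial>lborel)"
      by simp
  qed
  show "(\<lambda>n. \<integral>x. \<bar>u (x + h n) - u x\<bar> \<partial>lborel) \<longlonglongrightarrow> 0"
    by (rule translation_L1_tendsto[OF u_integrable assms])
qed

lemma autocorr_smoothing_tendsto:
  "(\<lambda>n. \<integral>w. autocorr u (y + (1 / real (Suc n)) *\<^sub>R w) \<partial>gauss_measure) \<longlonglongrightarrow> autocorr u y"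
proof -
  have "(\<lambda>n. \<integral>w. autocorr u (y + (1 / real (Suc n)) *\<^sub>R w) \<partial>gauss_measure)
      \<longlonglongrightarrow> (\<integral>w. autocorr u y \<partial>(gauss_measure::'a measure))"
  proof (rule integral_dominated_convergence[where w="\<lambda>_. \<integral>x. u x \<partial>lborel"])
    have "(\<lambda>n. (1 / real (Suc n)) *\<^sub>R w) \<longlonglongrightarrow> 0" for w :: 'a
      using tendsto_scaleR[OF LIMSEQ_inverse_real_of_nat tendsto_const[of w]]
      by (simp add: inverse_eq_divide)
    then show "AE w in gauss_measure. (\<lambda>n. autocorr u (y + (1 / real (Suc n)) *\<^sub>R w)) \<longlonglongrightarrow> autocorr u y"
      by (intro AE_I2 autocorr_tendsto)
  qed (auto simp: autocorr_nonneg autocorr_le)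
  then show ?thesis using gauss_measure.prob_space[where 'a='a] by simp
qed

text \<open>Expand the square: by translation invariance both quadratic terms integrate to
  \<open>autocorr u 0\<close>. This links the double integral of the Gagliardo form with the
  autocorrelation.\<close>

lemma autocorr_zero_diff:
  "(\<integral>\<^sup>+x. ennreal ((u x - u (x + y))\<^sup>2) \<partial>lborel) = ennreal (2 * (autocorr u 0 - autocorr u y))"
proof -
  have sq: "integrable lborel (\<lambda>x. (u (x + a))\<^sup>2)" for a
    using integrable_lborel_translation[OF integrable_autocorr_integrand[of 0], of a] by (simp add: power2_eq_square)
  have trans: "(\<integral>x. (u (x + y))\<^sup>2 \<partial>lborel) = (\<integral>x. (u x)\<^sup>2 \<partial>lborel)"
    by (rule integral_lborel_translation) simp
  have expand: "(u x - u (x + y))\<^sup>2 = (u x)\<^sup>2 + (u (x + y))\<^sup>2 - 2 * (u x * u (x + y))" for x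
    by (simp add: power2_eq_square algebra_simps)
  have "integrable lborel (\<lambda>x. (u x - u (x + y))\<^sup>2)"
    unfolding expand using sq[of 0] sq[of y] integrable_autocorr_integrand[of y] by simp
  then have "(\<integral>\<^sup>+x. ennreal ((u x - u (x + y))\<^sup>2) \<partial>lborel) = ennreal (\<integral>x. (u x - u (x + y))\<^sup>2 \<partial>lborel)"
    by (intro nn_integral_eq_integral) auto
  also have "(\<integral>x. (u x - u (x + y))\<^sup>2 \<partial>lborel) = 2 * (autocorr u 0 - autocorr u y)"
    unfolding expand using sq[of 0] sq[of y] integrable_autocorr_integrand[of y] trans
    by (simp add: autocorr_def power2_eq_square)
  finally show ?thesis .
qed

text \<open>With \<open>\<xi> = \<sigma> *\<^sub>R \<zeta>\<close> the left side becomes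
  \<open>gauss 0\<close> times the integral of
  \<open>norm \<xi> powr \<alpha> * power_spectrum u \<xi>\<close> against the weight
  \<open>gauss (\<xi> / \<sigma>)\<close>. For \<open>\<sigma>\<close> tending to infinity the
  weight tends to \<open>gauss 0\<close>, and one recovers the spectral energy with the usual factor
  (2 pi)^-d. Keeping all \<open>\<sigma>\<close> keeps every integral over a probability
  measure.\<close>

definition finite_energy :: "real \<Rightarrow> real \<Rightarrow> bool" where
  "finite_energy \<alpha> \<Gamma> \<longleftrightarrow> (\<forall>\<sigma>>0. ennreal (\<sigma> ^ DIM('a) * gauss (0::'a)) *
     (\<integral>\<^sup>+\<zeta>. ennreal (norm (\<sigma> *\<^sub>R \<zeta>) powr \<alpha> * power_spectrum u (\<sigma> *\<^sub>R \<zeta>)) \<partial>gauss_measure) \<le> ennreal \<Gamma>)"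

text \<open>At fixed \<open>\<sigma>\<close> the difference of smoothed autocorrelations is a
  Gaussian average of \<open>1 - cos\<close> times the power spectrum. The integrand is nonnegative,
  so Tonelli's theorem allows the kernel to be integrated separately at each frequency, where
  \<open>C\<close> applies.\<close>

lemma smoothed_gagliardo_le:
  assumes C: "\<And>\<xi>::'a. (\<integral>\<^sup>+y. ennreal ((1 - cos (\<xi> \<bullet> y)) / norm y powr p) \<partial>lborel) \<le> ennreal (C * norm \<xi> powr \<alpha>)"
    and "C > 0" "finite_energy \<alpha> \<Gamma>" "\<sigma> > 0"
  shows "(\<integral>\<^sup>+y. ennreal (((\<integral>w. autocorr u (0 + (1 / \<sigma>) *\<^sub>R w) \<partial>gauss_measure) -
      (\<integral>w. autocorr u (y + (1 / \<sigma>) *\<^sub>R w) \<partial>gauss_measure)) / norm y powr p) \<partial>lborel) \<le> ennreal (C * \<Gamma>)"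
proof -
  let ?c = "\<sigma> ^ DIM('a) * gauss (0::'a)"
  have c: "?c \<ge> 0" using \<open>\<sigma> > 0\<close> gauss_zero_pos[where 'a='a] by simp
  have "(\<integral>\<^sup>+y. ennreal (((\<integral>w. autocorr u (0 + (1 / \<sigma>) *\<^sub>R w) \<partial>gauss_measure) -
      (\<integral>w. autocorr u (y + (1 / \<sigma>) *\<^sub>R w) \<partial>gauss_measure)) / norm y powr p) \<partial>lborel) =
      (\<integral>\<^sup>+y. ennreal ?c * (\<integral>\<^sup>+\<zeta>. ennreal (power_spectrum u (\<sigma> *\<^sub>R \<zeta>)) *
        ennreal ((1 - cos (\<sigma> *\<^sub>R \<zeta> \<bullet> y)) / norm y powr p) \<partial>gauss_measure) \<partial>lborel)"
  proof (rule nn_integral_cong)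
    fix y :: 'a
    have int: "integrable gauss_measure (\<lambda>\<zeta>. cos (\<sigma> *\<^sub>R \<zeta> \<bullet> z) * power_spectrum u (\<sigma> *\<^sub>R \<zeta>))" for z
      by (rule integrable_power_spectrum_gauss) auto
    have "(\<integral>w. autocorr u (0 + (1 / \<sigma>) *\<^sub>R w) \<partial>gauss_measure) - (\<integral>w. autocorr u (y + (1 / \<sigma>) *\<^sub>R w) \<partial>gauss_measure) =
      ?c * (\<integral>\<zeta>. cos (\<sigma> *\<^sub>R \<zeta> \<bullet> 0) * power_spectrum u (\<sigma> *\<^sub>R \<zeta>) - cos (\<sigma> *\<^sub>R \<zeta> \<bullet> y) * power_spectrum u (\<sigma> *\<^sub>R \<zeta>) \<partial>gauss_measure)"
      unfolding autocorr_smoothing[OF \<open>\<sigma> > 0\<close>]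
      by (subst Bochner_Integration.integral_diff[OF int int]) (simp add: right_diff_distrib)
    moreover have "(\<integral>\<zeta>. power_spectrum u (\<sigma> *\<^sub>R \<zeta>) * ((1 - cos (\<sigma> *\<^sub>R \<zeta> \<bullet> y)) / norm y powr p) \<partial>gauss_measure) =
      (\<integral>\<zeta>. cos (\<sigma> *\<^sub>R \<zeta> \<bullet> 0) * power_spectrum u (\<sigma> *\<^sub>R \<zeta>) - cos (\<sigma> *\<^sub>R \<zeta> \<bullet> y) * power_spectrum u (\<sigma> *\<^sub>R \<zeta>) \<partial>gauss_measure) / norm y powr p"
      by (subst integral_divide_zero[symmetric]) (simp add: right_diff_distrib mult.commute)
    ultimately have e1: "((\<integral>w. autocorr u (0 + (1 / \<sigma>) *\<^sub>R w) \<partial>gauss_measure) -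
        (\<integral>w. autocorr u (y + (1 / \<sigma>) *\<^sub>R w) \<partial>gauss_measure)) / norm y powr p =
      ?c * (\<integral>\<zeta>. power_spectrum u (\<sigma> *\<^sub>R \<zeta>) * ((1 - cos (\<sigma> *\<^sub>R \<zeta> \<bullet> y)) / norm y powr p) \<partial>gauss_measure)"
      by (simp only: times_divide_eq_right)
    have e2: "ennreal (\<integral>\<zeta>. power_spectrum u (\<sigma> *\<^sub>R \<zeta>) * ((1 - cos (\<sigma> *\<^sub>R \<zeta> \<bullet> y)) / norm y powr p) \<partial>gauss_measure) =
      (\<integral>\<^sup>+\<zeta>. ennreal (power_spectrum u (\<sigma> *\<^sub>R \<zeta>) * ((1 - cos (\<sigma> *\<^sub>R \<zeta> \<bullet> y)) / norm y powr p)) \<partial>gauss_measure)"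
    proof (rule nn_integral_eq_integral[symmetric])
      have "integrable gauss_measure (\<lambda>\<zeta>. (cos (\<sigma> *\<^sub>R \<zeta> \<bullet> 0) * power_spectrum u (\<sigma> *\<^sub>R \<zeta>) - cos (\<sigma> *\<^sub>R \<zeta> \<bullet> y) * power_spectrum u (\<sigma> *\<^sub>R \<zeta>)) / norm y powr p)"
        by (intro integrable_divide Bochner_Integration.integrable_diff int)
      then show "integrable gauss_measure (\<lambda>\<zeta>. power_spectrum u (\<sigma> *\<^sub>R \<zeta>) * ((1 - cos (\<sigma> *\<^sub>R \<zeta> \<bullet> y)) / norm y powr p))"
        by (simp add: algebra_simps)
    qed (auto simp: power_spectrum_nonneg)
    show "ennreal (((\<integral>w. autocorr u (0 + (1 / \<sigma>) *\<^sub>R w) \<partial>gauss_measure) -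
        (\<integral>w. autocorr u (y + (1 / \<sigma>) *\<^sub>R w) \<partial>gauss_measure)) / norm y powr p) =
       ennreal ?c * (\<integral>\<^sup>+\<zeta>. ennreal (power_spectrum u (\<sigma> *\<^sub>R \<zeta>)) *
        ennreal ((1 - cos (\<sigma> *\<^sub>R \<zeta> \<bullet> y)) / norm y powr p) \<partial>gauss_measure)"
      by (simp only: e1 ennreal_mult'[OF c] e2 ennreal_mult'[OF power_spectrum_nonneg])
  qed
  also have "\<dots> = ennreal ?c * (\<integral>\<^sup>+y. (\<integral>\<^sup>+\<zeta>. ennreal (power_spectrum u (\<sigma> *\<^sub>R \<zeta>)) *
        ennreal ((1 - cos (\<sigma> *\<^sub>R \<zeta> \<bullet> y)) / norm y powr p) \<partial>gauss_measure) \<partial>lborel)"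
    by (rule nn_integral_cmult) measurable
  also have "\<dots> = ennreal ?c * (\<integral>\<^sup>+\<zeta>. (\<integral>\<^sup>+y. ennreal (power_spectrum u (\<sigma> *\<^sub>R \<zeta>)) *
        ennreal ((1 - cos (\<sigma> *\<^sub>R \<zeta> \<bullet> y)) / norm y powr p) \<partial>lborel) \<partial>gauss_measure)"
    by (rule arg_cong[where f="(*) (ennreal ?c)"], rule gauss_lborel.Fubini') measurable
  also have "\<dots> \<le> ennreal ?c * (\<integral>\<^sup>+\<zeta>. ennreal C * ennreal (norm (\<sigma> *\<^sub>R \<zeta>) powr \<alpha> * power_spectrum u (\<sigma> *\<^sub>R \<zeta>)) \<partial>gauss_measure)"
  proof (intro mult_left_mono nn_integral_mono)
    fix \<zeta> :: 'a
    have "(\<integral>\<^sup>+y. ennreal (power_spectrum u (\<sigma> *\<^sub>R \<zeta>)) * ennreal ((1 - cos (\<sigma> *\<^sub>R \<zeta> \<bullet> y)) / norm y powr p) \<partial>lborel) =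
      ennreal (power_spectrum u (\<sigma> *\<^sub>R \<zeta>)) * (\<integral>\<^sup>+y. ennreal ((1 - cos (\<sigma> *\<^sub>R \<zeta> \<bullet> y)) / norm y powr p) \<partial>lborel)"
      by (rule nn_integral_cmult) measurable
    also have "\<dots> \<le> ennreal (power_spectrum u (\<sigma> *\<^sub>R \<zeta>)) * ennreal (C * norm (\<sigma> *\<^sub>R \<zeta>) powr \<alpha>)"
      by (intro mult_left_mono C) simp
    also have "\<dots> = ennreal C * ennreal (norm (\<sigma> *\<^sub>R \<zeta>) powr \<alpha> * power_spectrum u (\<sigma> *\<^sub>R \<zeta>))"
      using \<open>C > 0\<close> by (simp add: ennreal_mult'[symmetric] power_spectrum_nonneg mult_ac)
    finally show "(\<integral>\<^sup>+y. ennreal (power_spectrum u (\<sigma> *\<^sub>R \<zeta>)) * ennreal ((1 - cos (\<sigma> *\<^sub>R \<zeta> \<bullet> y)) / norm y powr p) \<partial>lborel)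
      \<le> ennreal C * ennreal (norm (\<sigma> *\<^sub>R \<zeta>) powr \<alpha> * power_spectrum u (\<sigma> *\<^sub>R \<zeta>))" .
  qed simp
  also have "\<dots> = ennreal C *
     (ennreal ?c * (\<integral>\<^sup>+\<zeta>. ennreal (norm (\<sigma> *\<^sub>R \<zeta>) powr \<alpha> * power_spectrum u (\<sigma> *\<^sub>R \<zeta>)) \<partial>gauss_measure))"
    by (subst nn_integral_cmult) (measurable, simp only: mult_ac)
  also have "\<dots> \<le> ennreal C * ennreal \<Gamma>"
    using assms by (intro mult_left_mono) (simp_all add: finite_energy_def)
  also have "\<dots> = ennreal (C * \<Gamma>)" using \<open>C > 0\<close> by (simp add: ennreal_mult')
  finally show ?thesis .
qed

lemma gagliardo_le:
  assumes C: "\<And>\<xi>::'a. (\<integral>\<^sup>+y. ennreal ((1 - cos (\<xi> \<bullet> y)) / norm y powr p) \<partial>lborel) \<le> ennreal (C * norm \<xi> powr \<alpha>)"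
    and "C > 0" "finite_energy \<alpha> \<Gamma>"
  shows "(\<integral>\<^sup>+y. ennreal ((autocorr u 0 - autocorr u y) / norm y powr p) \<partial>lborel) \<le> ennreal (C * \<Gamma>)"
proof -
  define f where "f n y = ennreal (((\<integral>w. autocorr u (0 + (1 / real (Suc n)) *\<^sub>R w) \<partial>gauss_measure) -
      (\<integral>w. autocorr u (y + (1 / real (Suc n)) *\<^sub>R w) \<partial>gauss_measure)) / norm y powr p)" for n :: nat and y :: 'a
  have [measurable]: "f n \<in> borel_measurable borel" for n unfolding f_def by measurable
  have lim: "(\<lambda>n. f n y) \<longlonglongrightarrow> ennreal ((autocorr u 0 - autocorr u y) / norm y powr p)" for y
  \<comment> \<open>At \<open>y = 0\<close> the numerators and the denominator are all 0, so both
    sides are 0 by convention; elsewhere the denominator is a nonzero constant.\<close>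
  proof (cases "y = 0")
    case False
    then show ?thesis unfolding f_def
      by (intro tendsto_ennrealI tendsto_divide tendsto_diff autocorr_smoothing_tendsto tendsto_const) auto
  qed (simp add: f_def)
  have "(\<integral>\<^sup>+y. ennreal ((autocorr u 0 - autocorr u y) / norm y powr p) \<partial>lborel) = (\<integral>\<^sup>+y. liminf (\<lambda>n. f n y) \<partial>lborel)"
    by (intro nn_integral_cong) (simp add: lim_imp_Liminf[OF _ lim])
  also have "\<dots> \<le> liminf (\<lambda>n. \<integral>\<^sup>+y. f n y \<partial>lborel)"
    by (rule nn_integral_liminf) simp
  also have "\<dots> \<le> ennreal (C * \<Gamma>)"
  proof (rule Liminf_le[OF _ always_eventually])
    show "\<forall>n. (\<integral>\<^sup>+y. f n y \<partial>lborel) \<le> ennreal (C * \<Gamma>)"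
      unfolding f_def using smoothed_gagliardo_le[OF assms] by simp
  qed simp
  finally show ?thesis .
qed

text \<open>The form sees only differences, so \<open>1 - u\<close> may be replaced by
  \<open>u\<close>, and nonnegativity allows \<open>\<Omega>\<close> to be enlarged to the whole
  space. Integrating over \<open>x\<close> at fixed \<open>h = y - x\<close> then leaves twice the
  autocorrelation increment, which explains the factor 2.\<close>

lemma neumann_form_le:
  assumes C: "\<And>\<xi>::'a. (\<integral>\<^sup>+y. ennreal ((1 - cos (\<xi> \<bullet> y)) / norm y powr (real DIM('a) + \<alpha>)) \<partial>lborel) \<le> ennreal (C * norm \<xi> powr \<alpha>)"
    and "C > 0" "finite_energy \<alpha> \<Gamma>"
  shows "neumann_form \<alpha> \<Omega> (\<lambda>x. 1 - u x) \<le> ennreal (2 * C * \<Gamma>)"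
proof -
  let ?p = "real DIM('a) + \<alpha>"
  have "neumann_form \<alpha> \<Omega> (\<lambda>x. 1 - u x) \<le> (\<integral>\<^sup>+x. (\<integral>\<^sup>+y. ennreal ((u x - u y)\<^sup>2 / norm (x - y) powr ?p) \<partial>lborel) \<partial>lborel)"
    unfolding neumann_form_def
  proof (rule nn_integral_mono)
    fix x
    have "(\<integral>\<^sup>+y. ennreal (((1 - u x) - (1 - u y))\<^sup>2 / norm (x - y) powr ?p) * indicator \<Omega> y \<partial>lborel) * indicator \<Omega> x
      \<le> (\<integral>\<^sup>+y. ennreal (((1 - u x) - (1 - u y))\<^sup>2 / norm (x - y) powr ?p) * indicator \<Omega> y \<partial>lborel)"
      by (simp add: indicator_def)
    also have "\<dots> \<le> (\<integral>\<^sup>+y. ennreal ((u x - u y)\<^sup>2 / norm (x - y) powr ?p) \<partial>lborel)"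
      by (intro nn_integral_mono) (auto simp: indicator_def power2_commute)
    finally show "(\<integral>\<^sup>+y. ennreal (((1 - u x) - (1 - u y))\<^sup>2 / norm (x - y) powr ?p) * indicator \<Omega> y \<partial>lborel) * indicator \<Omega> x
      \<le> (\<integral>\<^sup>+y. ennreal ((u x - u y)\<^sup>2 / norm (x - y) powr ?p) \<partial>lborel)" .
  qed
  also have "\<dots> = (\<integral>\<^sup>+x. (\<integral>\<^sup>+h. ennreal ((u x - u (x + h))\<^sup>2 / norm h powr ?p) \<partial>lborel) \<partial>lborel)"
  proof (rule nn_integral_cong)
    fix x
    show "(\<integral>\<^sup>+y. ennreal ((u x - u y)\<^sup>2 / norm (x - y) powr ?p) \<partial>lborel) = (\<integral>\<^sup>+h. ennreal ((u x - u (x + h))\<^sup>2 / norm h powr ?p) \<partial>lborel)"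
      by (subst nn_integral_lborel_translation[of _ x, symmetric]) (simp_all add: add.commute)
  qed
  also have "\<dots> = (\<integral>\<^sup>+h. (\<integral>\<^sup>+x. ennreal ((u x - u (x + h))\<^sup>2 / norm h powr ?p) \<partial>lborel) \<partial>lborel)"
    by (rule lborel_pair.Fubini') measurable
  also have "\<dots> = (\<integral>\<^sup>+h. 2 * ennreal ((autocorr u 0 - autocorr u h) / norm h powr ?p) \<partial>lborel)"
  proof (rule nn_integral_cong)
    fix h :: 'a
    have "(\<integral>\<^sup>+x. ennreal ((u x - u (x + h))\<^sup>2 / norm h powr ?p) \<partial>lborel) =
        (\<integral>\<^sup>+x. ennreal (1 / norm h powr ?p) * ennreal ((u x - u (x + h))\<^sup>2) \<partial>lborel)"
      by (intro nn_integral_cong) (simp add: ennreal_mult'[symmetric])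
    also have "\<dots> = ennreal (1 / norm h powr ?p) * ennreal (2 * (autocorr u 0 - autocorr u h))"
      by (subst nn_integral_cmult) (simp_all add: autocorr_zero_diff)
    also have "\<dots> = ennreal (2 * ((autocorr u 0 - autocorr u h) / norm h powr ?p))"
      by (simp add: ennreal_mult'[symmetric])
    also have "\<dots> = 2 * ennreal ((autocorr u 0 - autocorr u h) / norm h powr ?p)"
      by (simp only: ennreal_mult'[of 2, OF zero_le_numeral] ennreal_numeral)
    finally show "(\<integral>\<^sup>+x. ennreal ((u x - u (x + h))\<^sup>2 / norm h powr ?p) \<partial>lborel) =
      2 * ennreal ((autocorr u 0 - autocorr u h) / norm h powr ?p)" .
  qed
  also have "\<dots> = 2 * (\<integral>\<^sup>+h. ennreal ((autocorr u 0 - autocorr u h) / norm h powr ?p) \<partial>lborel)"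
    by (rule nn_integral_cmult) measurable
  also have "\<dots> \<le> 2 * ennreal (C * \<Gamma>)"
    by (intro mult_left_mono gagliardo_le[OF assms]) simp
  also have "\<dots> = ennreal (2 * C * \<Gamma>)" by (simp add: ennreal_mult' mult.assoc)
  finally show ?thesis .
qed

text \<open>The weight \<open>exp (- (norm x)\<^sup>2 / 2)\<close> is a Gaussian average of cosines,
  so the left side is a Gaussian average of the real part of the Fourier transform of
  \<open>u\<close>. Young's inequality bounds it by the spectral energy and the dual weight;
  \<open>\<eta>\<close> is left free to be balanced against the size of the domain.\<close>

lemma gauss_average_le:
  assumes fin: "(\<integral>\<^sup>+x. ennreal (norm (x::'a) powr (- \<alpha>)) \<partial>gauss_measure) \<le> ennreal K"
    and "finite_energy \<alpha> \<Gamma>" "\<eta> > 0" "\<Gamma> \<ge> 0" "K \<ge> 0"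
  shows "(\<integral>x. u x * exp (- (norm x)\<^sup>2 / 2) \<partial>lborel) \<le> \<eta> * \<Gamma> / gauss (0::'a) + K / (4 * \<eta>)"
proof -
  let ?C = "\<lambda>\<zeta>. \<integral>x. u x * cos (\<zeta> \<bullet> x) \<partial>lborel"
  have "(\<integral>x. u x * exp (- (norm x)\<^sup>2 / 2) \<partial>lborel) = (\<integral>x. u x * (\<integral>\<zeta>. cos (\<zeta> \<bullet> x) \<partial>gauss_measure) \<partial>lborel)"
    by (simp add: gauss_measure_cos)
  also have "\<dots> = (\<integral>\<zeta>. ?C \<zeta> \<partial>gauss_measure)"
    by (rule integral_weight_swap[where K=1])
      (auto simp: u_integrable gauss_measure.finite_measure_axioms lborel.sigma_finite_measure_axioms)
  also have "ennreal \<dots> \<le> (\<integral>\<^sup>+\<zeta>. ennreal (?C \<zeta>) \<partial>gauss_measure)"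
  \<comment> \<open>For an integrable function, dropping the negative part can only increase the
    integral; for a non-integrable one the Bochner integral has the default value 0.\<close>
  proof (cases "integrable gauss_measure ?C")
    case True
    have "ennreal (\<integral>\<zeta>. ?C \<zeta> \<partial>gauss_measure) \<le> ennreal (\<integral>\<zeta>. max 0 (?C \<zeta>) \<partial>gauss_measure)"
      using True by (intro ennreal_leI integral_mono) auto
    also have "\<dots> = (\<integral>\<^sup>+\<zeta>. ennreal (max 0 (?C \<zeta>)) \<partial>gauss_measure)"
      using True by (intro nn_integral_eq_integral[symmetric]) auto
    also have "\<dots> = (\<integral>\<^sup>+\<zeta>. ennreal (?C \<zeta>) \<partial>gauss_measure)"
      by (intro nn_integral_cong) (auto simp: max_def ennreal_neg)
    finally show ?thesis .
  qed (simp add: not_integrable_integral_eq)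
  also have "\<dots> \<le> (\<integral>\<^sup>+\<zeta>. ennreal \<eta> * ennreal (norm \<zeta> powr \<alpha> * power_spectrum u \<zeta>) + ennreal (1 / (4 * \<eta>)) * ennreal (norm \<zeta> powr (- \<alpha>)) \<partial>gauss_measure)"
  proof (rule nn_integral_mono_AE)
    have "AE \<zeta> in gauss_measure. \<zeta> \<noteq> (0::'a)"
      by (subst AE_density) (use AE_lborel_singleton[of "0::'a"] in auto)
    then show "AE \<zeta> in gauss_measure. ennreal (?C \<zeta>) \<le> ennreal \<eta> * ennreal (norm \<zeta> powr \<alpha> * power_spectrum u \<zeta>) + ennreal (1 / (4 * \<eta>)) * ennreal (norm \<zeta> powr (- \<alpha>))"
    proof eventually_elim
      fix \<zeta> :: 'a assume "\<zeta> \<noteq> 0"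
      define a where "a = norm \<zeta> powr \<alpha>"
      have a: "a > 0" using \<open>\<zeta> \<noteq> 0\<close> by (simp add: a_def)
      \<comment> \<open>Expanding this square is Young's inequality with weight \<open>a\<close>.
        The division by \<open>a\<close> is the reason for discarding the null set
        \<open>\<zeta> = 0\<close>.\<close>
      have "0 \<le> (2 * \<eta> * a * ?C \<zeta> - 1)\<^sup>2 / (4 * \<eta> * a)" using a \<open>\<eta> > 0\<close> by simp
      also have "\<dots> = \<eta> * (a * (?C \<zeta>)\<^sup>2) - ?C \<zeta> + 1 / (4 * \<eta>) * (1 / a)"
        using a \<open>\<eta> > 0\<close> by (simp add: field_simps power2_eq_square)
      finally have "?C \<zeta> \<le> \<eta> * (a * (?C \<zeta>)\<^sup>2) + 1 / (4 * \<eta>) * (1 / a)" by simp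
      also have "\<dots> \<le> \<eta> * (a * power_spectrum u \<zeta>) + 1 / (4 * \<eta>) * (1 / a)"
        using a \<open>\<eta> > 0\<close> by (intro add_right_mono mult_left_mono) (auto simp: power_spectrum_def)
      finally show "ennreal (?C \<zeta>) \<le> ennreal \<eta> * ennreal (norm \<zeta> powr \<alpha> * power_spectrum u \<zeta>) + ennreal (1 / (4 * \<eta>)) * ennreal (norm \<zeta> powr (- \<alpha>))"
        using a \<open>\<eta> > 0\<close>
        by (simp add: a_def[symmetric] powr_minus ennreal_mult'[symmetric] ennreal_plus[symmetric] power_spectrum_nonneg
            inverse_eq_divide ennreal_leI del: ennreal_plus)
    qed
  qed
  also have "\<dots> = ennreal \<eta> * (\<integral>\<^sup>+\<zeta>. ennreal (norm \<zeta> powr \<alpha> * power_spectrum u \<zeta>) \<partial>gauss_measure)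
     + ennreal (1 / (4 * \<eta>)) * (\<integral>\<^sup>+\<zeta>. ennreal (norm (\<zeta>::'a) powr (- \<alpha>)) \<partial>gauss_measure)"
    by (subst nn_integral_add) (simp_all add: nn_integral_cmult)
  also have "\<dots> \<le> ennreal \<eta> * ennreal (\<Gamma> / gauss (0::'a)) + ennreal (1 / (4 * \<eta>)) * ennreal K"
  proof (intro add_mono mult_left_mono fin)
    let ?I = "\<integral>\<^sup>+\<zeta>. ennreal (norm \<zeta> powr \<alpha> * power_spectrum u \<zeta>) \<partial>gauss_measure"
    \<comment> \<open>The case \<open>\<sigma> = 1\<close>, in which the frequency weight of
      \<open>finite_energy\<close> is the standard Gaussian itself.\<close>
    have "ennreal (gauss (0::'a)) * ?I \<le> ennreal \<Gamma>"
      using \<open>finite_energy \<alpha> \<Gamma>\<close>[unfolded finite_energy_def, rule_format, of 1] by simp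
    then have "ennreal (1 / gauss (0::'a)) * (ennreal (gauss (0::'a)) * ?I) \<le> ennreal (1 / gauss (0::'a)) * ennreal \<Gamma>"
      by (intro mult_left_mono) simp_all
    then show "?I \<le> ennreal (\<Gamma> / gauss (0::'a))"
      using gauss_zero_pos[where 'a='a]
      by (simp add: mult.assoc[symmetric] ennreal_mult'[symmetric] ennreal_mult''[symmetric] less_imp_le \<open>\<Gamma> \<ge> 0\<close>)
  qed simp_all
  also have "\<dots> = ennreal (\<eta> * \<Gamma> / gauss (0::'a) + K / (4 * \<eta>))"
    using assms gauss_zero_pos[where 'a='a] by (simp add: ennreal_mult'[symmetric] flip: ennreal_plus)
  finally show ?thesis
    using assms gauss_zero_pos[where 'a='a] by (subst (asm) ennreal_le_iff) (auto simp: less_imp_le)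
qed

end

section \<open>The killed skeleton walk\<close>

context levy_process
begin

text \<open>Killing is charged at the arrival point. Therefore the discrete Feynman-Kac sum runs
  over \<open>j = 1..k\<close>, and the mass lost in a step is itself an image under the transition
  operator.\<close>

definition killed_step :: "real \<Rightarrow> ('a \<Rightarrow> real) \<Rightarrow> ('a \<Rightarrow> real) \<Rightarrow> 'a \<Rightarrow> real" where
  "killed_step \<delta> v h x = (\<integral>\<omega>. exp (- \<delta> * v (x + X \<delta> \<omega>)) * h (x + X \<delta> \<omega>) \<partial>M)"

definition survival :: "real \<Rightarrow> ('a \<Rightarrow> real) \<Rightarrow> nat \<Rightarrow> 'a \<Rightarrow> real" where
  "survival \<delta> v k = (killed_step \<delta> v ^^ k) (\<lambda>_. 1)"

lemma survival_0: "survival \<delta> v 0 x = 1"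
  and survival_Suc: "survival \<delta> v (Suc k) = killed_step \<delta> v (survival \<delta> v k)"
  by (simp_all add: survival_def)

end

locale levy_potential = levy_process M X
  for M :: "'w measure" and X :: "real \<Rightarrow> 'w \<Rightarrow> 'a::euclidean_space" +
  fixes v :: "'a \<Rightarrow> real"
  assumes v_measurable[measurable]: "v \<in> borel_measurable borel" and v_nonneg: "\<And>x. 0 \<le> v x"
    and v_integrable: "integrable lborel v"

locale levy_killing = levy_potential M X v
  for M :: "'w measure" and X :: "real \<Rightarrow> 'w \<Rightarrow> 'a::euclidean_space" and v :: "'a \<Rightarrow> real" +
  fixes \<delta> :: real
  assumes \<delta>_pos: "0 < \<delta>"
begin

lemma X_measurable[measurable]: "X \<delta> \<in> borel_measurable M"
  using random_variable_process[of \<delta>] \<delta>_pos by simp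

lemma integrable_M_bounded:
  assumes [measurable]: "f \<in> borel_measurable M" and "\<And>\<omega>. \<bar>f \<omega>\<bar> \<le> (1::real)"
  shows "integrable M f"
  by (rule integrable_const_bound[of _ 1]) (use assms(2) in auto)

lemma integral_M_bounds:
  assumes f[measurable]: "f \<in> borel_measurable M" and "\<And>\<omega>. 0 \<le> f \<omega>" "\<And>\<omega>. f \<omega> \<le> (1::real)"
  shows "0 \<le> (\<integral>\<omega>. f \<omega> \<partial>M)" "(\<integral>\<omega>. f \<omega> \<partial>M) \<le> 1"
proof -
  show "0 \<le> (\<integral>\<omega>. f \<omega> \<partial>M)" using assms by (intro integral_nonneg_AE) auto
  have "integrable M f" using assms by (intro integrable_M_bounded) (auto simp: abs_of_nonneg)
  then have "(\<integral>\<omega>. f \<omega> \<partial>M) \<le> (\<integral>\<omega>. 1 \<partial>M)" using assms by (intro integral_mono) auto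
  then show "(\<integral>\<omega>. f \<omega> \<partial>M) \<le> 1" by (simp add: prob_space)
qed

lemma exp_v: "0 < exp (- \<delta> * v x)" "exp (- \<delta> * v x) \<le> 1"
  using \<delta>_pos v_nonneg by auto

lemma killed_step_measurable[measurable]:
  assumes [measurable]: "h \<in> borel_measurable borel"
  shows "killed_step \<delta> v h \<in> borel_measurable borel"
  unfolding killed_step_def[abs_def] by measurable

lemma killed_step_bounds:
  assumes [measurable]: "h \<in> borel_measurable borel" and "\<And>x. 0 \<le> h x" "\<And>x. h x \<le> 1"
  shows "0 \<le> killed_step \<delta> v h x" "killed_step \<delta> v h x \<le> 1"
  unfolding killed_step_def using assms exp_v
  by (intro integral_M_bounds; auto simp: mult_le_one less_imp_le)+

lemma survival_measurable[measurable]: "survival \<delta> v k \<in> borel_measurable borel"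
  by (induction k) (auto simp: survival_Suc survival_0[abs_def])

lemma survival_bounds: "0 \<le> survival \<delta> v k x" "survival \<delta> v k x \<le> 1"
proof -
  have "0 \<le> survival \<delta> v k x \<and> survival \<delta> v k x \<le> 1"
    by (induction k arbitrary: x) (auto simp: survival_0 survival_Suc intro!: killed_step_bounds)
  then show "0 \<le> survival \<delta> v k x" "survival \<delta> v k x \<le> 1" by auto
qed

lemma integrable_killed:
  assumes [measurable]: "h \<in> borel_measurable borel" and "\<And>x. 0 \<le> h x" "\<And>x. h x \<le> 1"
  shows "integrable M (\<lambda>\<omega>. exp (- \<delta> * v (x + X \<delta> \<omega>)) * h (x + X \<delta> \<omega>))"
proof (rule integrable_M_bounded)
  fix \<omega>
  show "\<bar>exp (- \<delta> * v (x + X \<delta> \<omega>)) * h (x + X \<delta> \<omega>)\<bar> \<le> 1"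
    using exp_v[of "x + X \<delta> \<omega>"] assms(2,3)[of "x + X \<delta> \<omega>"] by (simp add: abs_mult mult_le_one del: mult_minus_left)
qed measurable

text \<open>The operator is monotone and does not exceed 1 on the constant 1. This monotonicity is
  what turns the exact recursion from \<open>k\<close> to \<open>Suc k\<close> into an inequality at
  a single \<open>k\<close>.\<close>

lemma survival_decreasing: "survival \<delta> v (Suc k) x \<le> survival \<delta> v k x"
proof (induction k arbitrary: x)
  case 0
  then show ?case using survival_bounds(2)[of "Suc 0" x] by (simp only: survival_0)
next
  case (Suc k)
  have "killed_step \<delta> v (survival \<delta> v (Suc k)) x \<le> killed_step \<delta> v (survival \<delta> v k) x"
    unfolding killed_step_def
    by (intro integral_mono integrable_killed mult_left_mono Suc) (auto simp: survival_bounds)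
  then show ?case by (simp only: survival_Suc)
qed

text \<open>Lebesgue measure is invariant under every single translation, hence under a random one
  that does not depend on the starting point.\<close>

lemma nn_integral_shift_process:
  assumes [measurable]: "f \<in> borel_measurable borel"
  shows "(\<integral>\<^sup>+x. (\<integral>\<^sup>+\<omega>. f (x + X \<delta> \<omega>) \<partial>M) \<partial>lborel) = (\<integral>\<^sup>+x. f x \<partial>lborel)"
proof -
  interpret pair_sigma_finite M "lborel :: 'a measure" ..
  have "(\<integral>\<^sup>+x. (\<integral>\<^sup>+\<omega>. f (x + X \<delta> \<omega>) \<partial>M) \<partial>lborel) = (\<integral>\<^sup>+\<omega>. (\<integral>\<^sup>+x. f (x + X \<delta> \<omega>) \<partial>lborel) \<partial>M)"
    by (rule Fubini') measurable
  also have "\<dots> = (\<integral>\<^sup>+\<omega>. (\<integral>\<^sup>+x. f x \<partial>lborel) \<partial>M)"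
    by (intro nn_integral_cong nn_integral_lborel_translation) simp
  finally show ?thesis by (simp add: emeasure_space_1)
qed

lemma one_minus_exp_le: "1 - exp (- \<delta> * v x) \<le> \<delta> * v x"
  using exp_ge_add_one_self[of "- \<delta> * v x"] by simp

lemma nn_integral_v_finite: "(\<integral>\<^sup>+x. ennreal (\<delta> * v x) \<partial>lborel) < \<infinity>"
  using v_integrable \<delta>_pos v_nonneg by (subst nn_integral_eq_integral) auto

text \<open>One step adds at most the integral of \<open>\<delta> * v\<close>, since the walk
  preserves Lebesgue measure. Thus \<open>k\<close> steps contribute at most
  \<open>k * \<delta>\<close> times the integral of \<open>v\<close>, a bound that grows with the
  time horizon.\<close>

lemma one_minus_survival_finite: "(\<integral>\<^sup>+x. ennreal (1 - survival \<delta> v k x) \<partial>lborel) < \<infinity>"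
proof (induction k)
  case (Suc k)
  have "(\<integral>\<^sup>+x. ennreal (1 - survival \<delta> v (Suc k) x) \<partial>lborel) \<le>
    (\<integral>\<^sup>+x. (\<integral>\<^sup>+\<omega>. ennreal (1 - survival \<delta> v k (x + X \<delta> \<omega>)) + ennreal (\<delta> * v (x + X \<delta> \<omega>)) \<partial>M) \<partial>lborel)"
  proof (rule nn_integral_mono)
    fix x
    note int = integrable_killed[OF survival_measurable survival_bounds]
    have "1 - survival \<delta> v (Suc k) x = (\<integral>\<omega>. 1 - exp (- \<delta> * v (x + X \<delta> \<omega>)) * survival \<delta> v k (x + X \<delta> \<omega>) \<partial>M)"
      unfolding survival_Suc killed_step_def
      by (subst Bochner_Integration.integral_diff) (use int in \<open>auto simp: prob_space\<close>)
    also have "ennreal \<dots> = (\<integral>\<^sup>+\<omega>. ennreal (1 - exp (- \<delta> * v (x + X \<delta> \<omega>)) * survival \<delta> v k (x + X \<delta> \<omega>)) \<partial>M)"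
      using int exp_v survival_bounds
      by (intro nn_integral_eq_integral[symmetric] Bochner_Integration.integrable_diff AE_I2)
        (auto simp: mult_le_one less_imp_le simp del: mult_minus_left)
    also have "\<dots> \<le> (\<integral>\<^sup>+\<omega>. ennreal (1 - survival \<delta> v k (x + X \<delta> \<omega>)) + ennreal (\<delta> * v (x + X \<delta> \<omega>)) \<partial>M)"
    proof (rule nn_integral_mono)
      fix \<omega>
      let ?y = "x + X \<delta> \<omega>"
      have "(1 - exp (- \<delta> * v ?y)) * survival \<delta> v k ?y \<le> (1 - exp (- \<delta> * v ?y)) * 1"
        using exp_v[of ?y] survival_bounds by (intro mult_left_mono) auto
      then have "1 - exp (- \<delta> * v ?y) * survival \<delta> v k ?y \<le> (1 - survival \<delta> v k ?y) + \<delta> * v ?y"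
        using one_minus_exp_le[of ?y] by (simp add: algebra_simps)
      then show "ennreal (1 - exp (- \<delta> * v ?y) * survival \<delta> v k ?y) \<le> ennreal (1 - survival \<delta> v k ?y) + ennreal (\<delta> * v ?y)"
        using survival_bounds \<delta>_pos v_nonneg by (subst ennreal_plus[symmetric]) (simp_all only: ennreal_leI diff_ge_0_iff_ge mult_nonneg_nonneg less_imp_le)
    qed
    finally show "ennreal (1 - survival \<delta> v (Suc k) x) \<le>
      (\<integral>\<^sup>+\<omega>. ennreal (1 - survival \<delta> v k (x + X \<delta> \<omega>)) + ennreal (\<delta> * v (x + X \<delta> \<omega>)) \<partial>M)" .
  qed
  also have "\<dots> = (\<integral>\<^sup>+x. ennreal (1 - survival \<delta> v k x) \<partial>lborel) + (\<integral>\<^sup>+x. ennreal (\<delta> * v x) \<partial>lborel)"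
    by (subst nn_integral_shift_process[of "\<lambda>x. ennreal (1 - survival \<delta> v k x) + ennreal (\<delta> * v x)"])
      (auto intro: nn_integral_add)
  also have "\<dots> < \<infinity>" using Suc nn_integral_v_finite by simp
  finally show ?case .
qed (simp add: survival_0)

sublocale surv: potential_function "\<lambda>x. 1 - survival \<delta> v k x" for k
proof
  show "integrable lborel (\<lambda>x. 1 - survival \<delta> v k x)"
    using one_minus_survival_finite[of k] survival_bounds by (intro integrableI_nonneg) auto
qed (simp_all add: survival_bounds)

lemma integrable_v_survival: "integrable lborel (\<lambda>x. v x * survival \<delta> v k x)"
  by (rule Bochner_Integration.integrable_bound[OF v_integrable])
    (auto simp: abs_mult survival_bounds v_nonneg mult_left_le)

text \<open>The shift \<open>h\<close> drops out: once the factor \<open>u x\<close> has been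
  bounded by 1, invariance of Lebesgue measure under translations and under the walk leaves the
  integral of \<open>g\<close>. Uniformity in \<open>h\<close> is exactly what
  \<open>spectral_energy_le\<close> asks for.\<close>

lemma autocorr_decay_le:
  "autocorr (\<lambda>x. 1 - survival \<delta> v k x) h - (\<integral>\<omega>. autocorr (\<lambda>x. 1 - survival \<delta> v k x) (h + X \<delta> \<omega>) \<partial>M)
    \<le> \<delta> * (\<integral>x. v x * survival \<delta> v k x \<partial>lborel)"
proof -
  define u where "u x = 1 - survival \<delta> v k x" for x
  \<comment> \<open>\<open>g\<close> is the part of the surviving mass that is lost when one more
    killing factor is charged at \<open>x\<close>; \<open>b\<close> is its average over the arrival
    point of one step.\<close>
  define g where "g x = (1 - exp (- \<delta> * v x)) * survival \<delta> v k x" for x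
  define b where "b x = (\<integral>\<omega>. g (x + X \<delta> \<omega>) \<partial>M)" for x
  have [measurable]: "u \<in> borel_measurable borel" "g \<in> borel_measurable borel"
    unfolding u_def[abs_def] g_def[abs_def] by measurable
  have [measurable]: "b \<in> borel_measurable borel" unfolding b_def[abs_def] by measurable
  have u: "0 \<le> u x" "u x \<le> 1" for x by (auto simp: u_def survival_bounds)
  have g: "0 \<le> g x" "g x \<le> 1" for x
    using exp_v[of x] survival_bounds[of k x] by (auto simp: g_def mult_le_one simp del: mult_minus_left)
  have g_le: "g x \<le> \<delta> * (v x * survival \<delta> v k x)" for x
    unfolding g_def mult.assoc[symmetric] by (intro mult_right_mono one_minus_exp_le survival_bounds)
  have g_int: "integrable M (\<lambda>\<omega>. g (x + X \<delta> \<omega>))" for x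
    using g by (intro integrable_M_bounded) (auto simp: abs_of_nonneg)
  have b: "0 \<le> b x" for x unfolding b_def using g by (intro integral_nonneg_AE) auto
  have "(\<integral>\<^sup>+x. ennreal (b x) \<partial>lborel) = (\<integral>\<^sup>+x. (\<integral>\<^sup>+\<omega>. ennreal (g (x + X \<delta> \<omega>)) \<partial>M) \<partial>lborel)"
    unfolding b_def using g g_int by (intro nn_integral_cong nn_integral_eq_integral[symmetric]) auto
  also have "\<dots> = (\<integral>\<^sup>+x. ennreal (g x) \<partial>lborel)"
    by (rule nn_integral_shift_process) simp
  also have "\<dots> \<le> (\<integral>\<^sup>+x. ennreal (\<delta> * (v x * survival \<delta> v k x)) \<partial>lborel)"
    by (intro nn_integral_mono ennreal_leI g_le)
  also have "\<dots> = ennreal (\<delta> * (\<integral>x. v x * survival \<delta> v k x \<partial>lborel))"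
    using integrable_v_survival \<delta>_pos by (subst nn_integral_eq_integral) (auto simp: v_nonneg survival_bounds)
  finally have b_nn: "(\<integral>\<^sup>+x. ennreal (b x) \<partial>lborel) \<le> ennreal (\<delta> * (\<integral>x. v x * survival \<delta> v k x \<partial>lborel))" .
  then have b_int: "integrable lborel b"
    using b by (intro integrableI_nonneg) (auto intro: le_less_trans)
  have nonneg: "0 \<le> \<delta> * (\<integral>x. v x * survival \<delta> v k x \<partial>lborel)"
    using \<delta>_pos by (intro mult_nonneg_nonneg integral_nonneg_AE) (auto simp: v_nonneg survival_bounds)
  have "ennreal (\<integral>x. b x \<partial>lborel) \<le> ennreal (\<delta> * (\<integral>x. v x * survival \<delta> v k x \<partial>lborel))"
    using b_nn b b_int by (subst (asm) nn_integral_eq_integral) auto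
  with nonneg have b_le: "(\<integral>x. b x \<partial>lborel) \<le> \<delta> * (\<integral>x. v x * survival \<delta> v k x \<partial>lborel)"
    by (simp add: ennreal_le_iff)
  have u_int: "integrable M (\<lambda>\<omega>. u (x + X \<delta> \<omega>))" for x
    using u by (intro integrable_M_bounded) (auto simp: abs_of_nonneg)
  have decay: "u x - (\<integral>\<omega>. u (x + X \<delta> \<omega>) \<partial>M) \<le> b x" for x
  proof -
    \<comment> \<open>Monotonicity in \<open>k\<close> makes room for one more step. With
      \<open>e\<close> the killing factor and \<open>s\<close> the survival,
      \<open>1 - e * s = (1 - s) + (1 - e) * s\<close> then separates \<open>u\<close> from
      \<open>g\<close>.\<close>
    have "u x \<le> 1 - killed_step \<delta> v (survival \<delta> v k) x"
      using survival_decreasing[of k x] by (simp add: u_def survival_Suc)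
    also have "\<dots> = (\<integral>\<omega>. 1 - exp (- \<delta> * v (x + X \<delta> \<omega>)) * survival \<delta> v k (x + X \<delta> \<omega>) \<partial>M)"
      unfolding killed_step_def using integrable_killed[OF survival_measurable survival_bounds]
      by (subst Bochner_Integration.integral_diff) (auto simp: prob_space)
    also have "\<dots> = (\<integral>\<omega>. u (x + X \<delta> \<omega>) + g (x + X \<delta> \<omega>) \<partial>M)"
      by (intro Bochner_Integration.integral_cong) (simp_all add: u_def g_def algebra_simps)
    also have "\<dots> = (\<integral>\<omega>. u (x + X \<delta> \<omega>) \<partial>M) + b x"
      using u_int g_int by (simp add: b_def)
    finally show ?thesis by simp
  qed
  have u_lint: "integrable lborel u" unfolding u_def[abs_def] by (rule surv.u_integrable)
  have prod_int: "integrable lborel (\<lambda>x. u x * f x)"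
    if [measurable]: "f \<in> borel_measurable borel" and "\<And>x. 0 \<le> f x" "\<And>x. f x \<le> 1" for f :: "'a \<Rightarrow> real"
    by (rule Bochner_Integration.integrable_bound[OF u_lint]) (use that u in \<open>auto simp: abs_mult mult_left_le\<close>)
  have "(\<integral>\<omega>. autocorr u (h + X \<delta> \<omega>) \<partial>M) = (\<integral>\<omega>. (\<integral>x. u x * u ((x + h) + X \<delta> \<omega>) \<partial>lborel) \<partial>M)"
    by (simp add: autocorr_def add.assoc)
  also have "\<dots> = (\<integral>x. u x * (\<integral>\<omega>. u ((x + h) + X \<delta> \<omega>) \<partial>M) \<partial>lborel)"
    by (rule integral_weight_swap[where K=1, symmetric])
      (auto simp: u u_lint finite_measure_axioms lborel.sigma_finite_measure_axioms)
  finally have "autocorr u h - (\<integral>\<omega>. autocorr u (h + X \<delta> \<omega>) \<partial>M) =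
      (\<integral>x. u x * u (x + h) - u x * (\<integral>\<omega>. u ((x + h) + X \<delta> \<omega>) \<partial>M) \<partial>lborel)"
    unfolding autocorr_def using u integral_M_bounds[of "\<lambda>\<omega>. u (_ + X \<delta> \<omega>)"]
    by (subst Bochner_Integration.integral_diff) (auto intro!: prod_int)
  also have "\<dots> \<le> (\<integral>x. b (x + h) \<partial>lborel)"
  proof (rule integral_mono)
    show "integrable lborel (\<lambda>x. u x * u (x + h) - u x * (\<integral>\<omega>. u ((x + h) + X \<delta> \<omega>) \<partial>M))"
      using u integral_M_bounds[of "\<lambda>\<omega>. u (_ + X \<delta> \<omega>)"]
      by (intro Bochner_Integration.integrable_diff prod_int) auto
    show "integrable lborel (\<lambda>x. b (x + h))" by (rule integrable_lborel_translation[OF b_int])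
    fix x
    have "u x * u (x + h) - u x * (\<integral>\<omega>. u ((x + h) + X \<delta> \<omega>) \<partial>M) \<le> u x * b (x + h)"
      unfolding right_diff_distrib[symmetric] using decay[of "x + h"] u by (intro mult_left_mono) auto
    also have "\<dots> \<le> b (x + h)" using u b by (simp add: mult_left_le_one_le)
    finally show "u x * u (x + h) - u x * (\<integral>\<omega>. u ((x + h) + X \<delta> \<omega>) \<partial>M) \<le> b (x + h)" .
  qed
  also have "\<dots> = (\<integral>x. b x \<partial>lborel)" by (rule integral_lborel_translation) simp
  finally show ?thesis using b_le unfolding u_def[abs_def] by simp
qed

text \<open>Feynman-Kac for the skeleton walk: the last increment, which is split off, is independent of
  the past.\<close>

lemma killed_step_iterate:
  assumes [measurable]: "h \<in> borel_measurable borel" and "\<And>x. 0 \<le> h x" "\<And>x. h x \<le> 1"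
  shows "(\<integral>\<omega>. exp (- \<delta> * (\<Sum>j=1..k. v (x + X (real j * \<delta>) \<omega>))) * h (x + X (real k * \<delta>) \<omega>) \<partial>M)
    = (killed_step \<delta> v ^^ k) h x"
  using assms
proof (induction k arbitrary: h)
  case 0
  have [measurable]: "X 0 \<in> borel_measurable M" by (rule random_variable_process) simp
  have "(\<integral>\<omega>. h (x + X 0 \<omega>) \<partial>M) = (\<integral>\<omega>. h x \<partial>M)"
    using start_zero 0(1) by (intro integral_cong_AE) auto
  then show ?case by (simp add: prob_space)
next
  case (Suc k)
  note [measurable] = Suc.prems(1)
  define D where "D i \<omega> = X (real (Suc i) * \<delta>) \<omega> - X (real i * \<delta>) \<omega>" for i \<omega>
  let ?P = "PiM {..<k} (\<lambda>_. borel :: 'a measure)"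
  define T where "T \<omega> = restrict (\<lambda>i. D i \<omega>) {..<k}" for \<omega>
  define S where "S j p = (\<Sum>i<j. p i)" for j and p :: "nat \<Rightarrow> 'a"
  have [measurable]: "X (real j * \<delta>) \<in> borel_measurable M" for j
    using \<delta>_pos by (intro random_variable_process) simp
  have [measurable]: "D i \<in> borel_measurable M" for i unfolding D_def[abs_def] by measurable
  have [measurable]: "S j \<in> borel_measurable ?P" if "j \<le> k" for j
    unfolding S_def[abs_def] using that by (intro borel_measurable_sum) auto
  have indep: "indep_vars (\<lambda>_. borel) D {..<Suc k}"
    unfolding D_def[abs_def] using \<delta>_pos
    by (intro independent_increments[of "\<lambda>i. real i * \<delta>" "Suc k"] monoI mult_right_mono) auto
  let ?P' = "PiM {k} (\<lambda>_. borel :: 'a measure)"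
  \<comment> \<open>The last increment is carried as a family over the singleton \<open>{k}\<close>,
    the shape in which \<open>indep_var_restrict\<close> gives its independence from the first
    \<open>k\<close> increments.\<close>
  define R where "R \<omega> = restrict (\<lambda>i. D i \<omega>) {k}" for \<omega>
  have "indep_var ?P T ?P' R"
    unfolding T_def[abs_def] R_def[abs_def] by (rule indep_var_restrict[OF indep]) auto
  then have joint: "distr M ?P T \<Otimes>\<^sub>M distr M ?P' R = distr M (?P \<Otimes>\<^sub>M ?P') (\<lambda>\<omega>. (T \<omega>, R \<omega>))"
    and T[measurable]: "T \<in> M \<rightarrow>\<^sub>M ?P" and R[measurable]: "R \<in> M \<rightarrow>\<^sub>M ?P'"
    unfolding indep_var_distribution_eq by auto
  have distr_D: "distr M borel (D k) = distr M borel (X \<delta>)"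
    unfolding D_def[abs_def] using \<delta>_pos stationary_increments[of "real k * \<delta>" "real (Suc k) * \<delta>"]
    by (simp add: algebra_simps)
  \<comment> \<open>The increments telescope to the position only when the path starts at 0, which
    holds almost surely.\<close>
  have S_T: "AE \<omega> in M. \<forall>j\<le>k. X (real j * \<delta>) \<omega> = S j (T \<omega>)"
    using start_zero
  proof eventually_elim
    case (elim \<omega>)
    have "X (real j * \<delta>) \<omega> = S j (T \<omega>)" if "j \<le> k" for j
      using that
    proof (induction j)
      case (Suc j)
      then have "S (Suc j) (T \<omega>) = S j (T \<omega>) + D j \<omega>" by (simp add: S_def T_def)
      with Suc show ?case by (simp add: D_def)
    qed (simp add: S_def elim)
    then show ?case by blast
  qed
  define F where "F p = exp (- \<delta> * (\<Sum>j=1..k. v (x + S j p)))" for p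
  have [measurable]: "F \<in> borel_measurable ?P"
  proof -
    have [measurable]: "(\<lambda>p. \<Sum>j=1..k. v (x + S j p)) \<in> borel_measurable ?P"
    proof (rule borel_measurable_sum)
      fix j assume "j \<in> {1..k}"
      then have [measurable]: "S j \<in> borel_measurable ?P" by simp
      show "(\<lambda>p. v (x + S j p)) \<in> borel_measurable ?P" by measurable
    qed
    show ?thesis unfolding F_def[abs_def] by measurable
  qed
  have F: "0 < F p" "F p \<le> 1" for p
    using \<delta>_pos v_nonneg by (auto simp: F_def intro!: mult_nonneg_nonneg sum_nonneg)
  define g where "g y = exp (- \<delta> * v y) * h y" for y
  have [measurable]: "g \<in> borel_measurable borel" unfolding g_def[abs_def] by measurable
  have g: "0 \<le> g y" "g y \<le> 1" for y
    using exp_v[of y] Suc.prems(2,3)[of y] by (auto simp: g_def mult_le_one less_imp_le simp del: mult_minus_left)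
  define f where "f = (\<lambda>(p, q :: nat \<Rightarrow> 'a). F p * g (x + S k p + q k))"
  have [measurable]: "f \<in> borel_measurable (?P \<Otimes>\<^sub>M ?P')" unfolding f_def by measurable
  have f_bd: "\<bar>f z\<bar> \<le> 1" for z
    using F[of "fst z"] g by (auto simp: f_def case_prod_beta abs_mult mult_le_one)
  interpret PT: prob_space "distr M ?P T" by (rule prob_space_distr) simp
  interpret PD: prob_space "distr M ?P' R" by (rule prob_space_distr) simp
  interpret pair_prob_space "distr M ?P T" "distr M ?P' R" ..
  have "(\<integral>\<omega>. exp (- \<delta> * (\<Sum>j=1..Suc k. v (x + X (real j * \<delta>) \<omega>))) * h (x + X (real (Suc k) * \<delta>) \<omega>) \<partial>M) =
     (\<integral>\<omega>. f (T \<omega>, R \<omega>) \<partial>M)"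
  proof (rule integral_cong_AE)
    show "AE \<omega> in M. exp (- \<delta> * (\<Sum>j=1..Suc k. v (x + X (real j * \<delta>) \<omega>))) * h (x + X (real (Suc k) * \<delta>) \<omega>) =
      f (T \<omega>, R \<omega>)"
      using S_T
    proof eventually_elim
      case (elim \<omega>)
      have e1: "x + S k (T \<omega>) + D k \<omega> = x + X (real (Suc k) * \<delta>) \<omega>"
        using elim by (simp add: D_def add.assoc)
      have e2: "F (T \<omega>) = exp (- \<delta> * (\<Sum>j=1..k. v (x + X (real j * \<delta>) \<omega>)))"
        using elim by (simp add: F_def)
      have "f (T \<omega>, R \<omega>) = F (T \<omega>) * g (x + S k (T \<omega>) + D k \<omega>)"
        by (simp add: f_def R_def)
      then have "f (T \<omega>, R \<omega>) = exp (- \<delta> * (\<Sum>j=1..k. v (x + X (real j * \<delta>) \<omega>))) * g (x + X (real (Suc k) * \<delta>) \<omega>)"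
        unfolding e1 e2 .
      then show ?case
        by (simp add: g_def exp_diff exp_minus field_simps del: of_nat_Suc)
    qed
  qed measurable
  also have "\<dots> = (\<integral>z. f z \<partial>(distr M ?P T \<Otimes>\<^sub>M distr M ?P' R))"
    unfolding joint by (subst integral_distr) auto
  also have "\<dots> = (\<integral>p. (\<integral>d. f (p, d) \<partial>distr M ?P' R) \<partial>distr M ?P T)"
    using f_bd by (intro integral_fst'[symmetric] P.integrable_const_bound[of _ 1]) auto
  also have "\<dots> = (\<integral>p. F p * killed_step \<delta> v h (x + S k p) \<partial>distr M ?P T)"
  proof (rule Bochner_Integration.integral_cong)
    fix p
    have "(\<integral>d. f (p, d) \<partial>distr M ?P' R) = (\<integral>\<omega>. F p * g (x + S k p + D k \<omega>) \<partial>M)"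
      by (subst integral_distr) (auto simp: f_def R_def)
    also have "\<dots> = (\<integral>d. F p * g (x + S k p + d) \<partial>distr M borel (D k))"
      by (subst integral_distr) auto
    also have "\<dots> = (\<integral>\<omega>. F p * g (x + S k p + X \<delta> \<omega>) \<partial>M)"
      unfolding distr_D by (subst integral_distr) auto
    finally show "(\<integral>d. f (p, d) \<partial>distr M ?P' R) = F p * killed_step \<delta> v h (x + S k p)"
      by (simp add: killed_step_def g_def)
  qed simp
  also have "\<dots> = (\<integral>\<omega>. F (T \<omega>) * killed_step \<delta> v h (x + S k (T \<omega>)) \<partial>M)"
    by (subst integral_distr) auto
  also have "\<dots> = (\<integral>\<omega>. exp (- \<delta> * (\<Sum>j=1..k. v (x + X (real j * \<delta>) \<omega>))) * killed_step \<delta> v h (x + X (real k * \<delta>) \<omega>) \<partial>M)"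
    using S_T by (intro integral_cong_AE) (auto simp: F_def elim!: eventually_mono)
  \<comment> \<open>The function \<open>killed_step \<delta> v h\<close> again takes values in
    [0, 1], so it may take the place of \<open>h\<close> in the induction hypothesis.\<close>
  also have "\<dots> = (killed_step \<delta> v ^^ k) (killed_step \<delta> v h) x"
    using Suc.prems by (intro Suc.IH killed_step_measurable killed_step_bounds)
  also have "\<dots> = (killed_step \<delta> v ^^ Suc k) h x" by (simp add: funpow_swap1)
  finally show ?case .
qed

lemma survival_eq:
  "survival \<delta> v k x = (\<integral>\<omega>. exp (- \<delta> * (\<Sum>j=1..k. v (x + X (real j * \<delta>) \<omega>))) \<partial>M)"
  using killed_step_iterate[where h="\<lambda>_. 1" and k=k and x=x] by (simp add: survival_def)

end

section \<open>Passage to continuous time\<close>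

lemma exp_neg_bounds: "0 \<le> exp_neg a" "exp_neg a \<le> 1"
  by (auto simp: exp_neg_def)

lemma exp_neg_ennreal: "0 \<le> a \<Longrightarrow> exp_neg (ennreal a) = exp (- a)"
  by (simp add: exp_neg_def)

lemma borel_measurable_exp_neg[measurable]: "exp_neg \<in> borel_measurable borel"
  unfolding exp_neg_def[abs_def] by measurable

lemma exp_minus_diff_le:
  fixes a b :: real
  assumes "0 \<le> a" "0 \<le> b"
  shows "\<bar>exp (- a) - exp (- b)\<bar> \<le> \<bar>a - b\<bar>"
proof -
  have *: "exp (- a) - exp (- b) \<le> b - a" if "0 \<le> a" "a \<le> b" for a b :: real
  proof -
    have "exp (- a) - exp (- b) = exp (- a) * (1 - exp (a - b))"
      by (simp add: right_diff_distrib exp_add[symmetric])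
    also have "1 - exp (a - b) \<le> b - a"
      using exp_ge_add_one_self[of "a - b"] by linarith
    then have "exp (- a) * (1 - exp (a - b)) \<le> 1 * (b - a)"
      using that by (intro mult_mono) auto
    finally show ?thesis by simp
  qed
  show ?thesis
    using *[of a b] *[of b a] assms by (cases "a \<le> b") (auto simp: abs_if)
qed

text \<open>The hypotheses express that \<open>A\<close> and \<open>B\<close> differ by at most
  \<open>D\<close> without subtracting in [0, infinity]. If exactly one of them is infinite, then so
  is \<open>D\<close>; if both are, the left side vanishes; for finite values the exponential is
  1-Lipschitz.\<close>

lemma exp_neg_diff_le:
  assumes "A \<le> B + D" "B \<le> A + D"
  shows "ennreal \<bar>exp_neg A - exp_neg B\<bar> \<le> D"
proof (cases "D = \<infinity> \<or> A = \<infinity> \<or> B = \<infinity>")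
  case True
  then show ?thesis using assms by (auto simp: top_unique ennreal_add_eq_top exp_neg_def)
next
  case False
  then obtain a b d where abd: "A = ennreal a" "B = ennreal b" "D = ennreal d" "0 \<le> a" "0 \<le> b" "0 \<le> d"
    by (metis ennreal_cases infinity_ennreal_def)
  have "a \<le> b + d" "b \<le> a + d"
    using assms abd by (simp_all add: ennreal_plus[symmetric] ennreal_le_iff del: ennreal_plus)
  then have "\<bar>a - b\<bar> \<le> d" by simp
  then show ?thesis using exp_minus_diff_le[of a b] abd
    by (simp add: exp_neg_ennreal ennreal_leI)
qed

lemma exp_neg_nn_integral_diff_le:
  fixes f g :: "'x \<Rightarrow> real"
  assumes [measurable]: "f \<in> borel_measurable M" "g \<in> borel_measurable M"
  shows "ennreal \<bar>exp_neg (\<integral>\<^sup>+x. ennreal (f x) \<partial>M) - exp_neg (\<integral>\<^sup>+x. ennreal (g x) \<partial>M)\<bar>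
    \<le> (\<integral>\<^sup>+x. ennreal \<bar>f x - g x\<bar> \<partial>M)"
proof (rule exp_neg_diff_le)
  have *: "(\<integral>\<^sup>+x. ennreal (f x) \<partial>M) \<le> (\<integral>\<^sup>+x. ennreal (g x) \<partial>M) + (\<integral>\<^sup>+x. ennreal \<bar>f x - g x\<bar> \<partial>M)"
    if [measurable]: "f \<in> borel_measurable M" "g \<in> borel_measurable M" for f g :: "'x \<Rightarrow> real"
  proof -
    have "ennreal (f x) \<le> ennreal (g x) + ennreal \<bar>f x - g x\<bar>" for x
    proof -
      have "ennreal (f x) \<le> ennreal (max 0 (g x) + \<bar>f x - g x\<bar>)" by (intro ennreal_leI) auto
      also have "\<dots> = ennreal (max 0 (g x)) + ennreal \<bar>f x - g x\<bar>" by (intro ennreal_plus) auto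
      also have "ennreal (max 0 (g x)) = ennreal (g x)" by (auto simp: max_def ennreal_neg)
      finally show ?thesis .
    qed
    then have "(\<integral>\<^sup>+x. ennreal (f x) \<partial>M) \<le> (\<integral>\<^sup>+x. ennreal (g x) + ennreal \<bar>f x - g x\<bar> \<partial>M)"
      by (rule nn_integral_mono)
    then show ?thesis by (simp add: nn_integral_add)
  qed
  show "(\<integral>\<^sup>+x. ennreal (f x) \<partial>M) \<le> (\<integral>\<^sup>+x. ennreal (g x) \<partial>M) + (\<integral>\<^sup>+x. ennreal \<bar>f x - g x\<bar> \<partial>M)"
    by (rule *) simp_all
  show "(\<integral>\<^sup>+x. ennreal (g x) \<partial>M) \<le> (\<integral>\<^sup>+x. ennreal (f x) \<partial>M) + (\<integral>\<^sup>+x. ennreal \<bar>f x - g x\<bar> \<partial>M)"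
    using *[of g f] by (simp add: abs_minus_commute)
qed

lemma nn_integral_step_function:
  fixes f :: "nat \<Rightarrow> ennreal"
  shows "(\<integral>\<^sup>+r\<in>{0..<real K / real (Suc n)}. f (nat \<lfloor>r * real (Suc n)\<rfloor>) \<partial>lborel)
    = (\<Sum>j<K. f j * ennreal (1 / real (Suc n)))"
proof (induction K)
  case (Suc K)
  let ?m = "real (Suc n)"
  let ?J = "{real K / ?m..<real (Suc K) / ?m}"
  have [measurable]: "(\<lambda>r. f (nat \<lfloor>r * ?m\<rfloor>)) \<in> borel_measurable borel" by measurable
  have ind: "indicator {0..<real (Suc K) / ?m} r = indicator {0..<real K / ?m} r + (indicator ?J r :: ennreal)" for r
  proof -
    have "0 \<le> real K / ?m" "real K / ?m \<le> real (Suc K) / ?m" by (auto intro!: divide_right_mono)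
    then show ?thesis using order_trans[of 0 "real K / ?m" r] by (auto simp: indicator_def simp del: of_nat_Suc)
  qed
  have "(\<integral>\<^sup>+r\<in>{0..<real (Suc K) / ?m}. f (nat \<lfloor>r * ?m\<rfloor>) \<partial>lborel) =
     (\<integral>\<^sup>+r\<in>{0..<real K / ?m}. f (nat \<lfloor>r * ?m\<rfloor>) \<partial>lborel) + (\<integral>\<^sup>+r\<in>?J. f (nat \<lfloor>r * ?m\<rfloor>) \<partial>lborel)"
    unfolding ind distrib_left by (rule nn_integral_add) measurable
  also have "(\<integral>\<^sup>+r\<in>?J. f (nat \<lfloor>r * ?m\<rfloor>) \<partial>lborel) = (\<integral>\<^sup>+r. f K * indicator ?J r \<partial>lborel)"
  proof (rule nn_integral_cong)
    fix r
    have "nat \<lfloor>r * ?m\<rfloor> = K" if "r \<in> ?J"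
    proof -
      have "real K \<le> r * ?m" "r * ?m < real K + 1"
        using that by (auto simp: divide_simps split: if_splits)
      then have "\<lfloor>r * ?m\<rfloor> = int K" by (intro floor_unique) auto
      then show ?thesis by simp
    qed
    then show "f (nat \<lfloor>r * ?m\<rfloor>) * indicator ?J r = f K * indicator ?J r"
      by (simp add: indicator_def)
  qed
  also have "\<dots> = f K * ennreal (1 / ?m)"
    by (simp add: nn_integral_cmult_indicator divide_right_mono diff_divide_distrib[symmetric])
  finally show ?case by (simp only: Suc.IH sum.lessThan_Suc)
qed simp

context levy_process
begin

text \<open>The path is sampled at the right endpoint of the grid interval containing
  \<open>r\<close>. This time is strictly later than \<open>r\<close>, so right continuity alone
  gives convergence, and the first sample is at one full step, in agreement with killing on
  arrival.\<close>

definition skeleton :: "nat \<Rightarrow> real \<Rightarrow> 'w \<Rightarrow> 'a" where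
  "skeleton n r \<omega> = X (real (Suc (nat \<lfloor>r * real (Suc n)\<rfloor>)) / real (Suc n)) \<omega>"

text \<open>The locale says nothing about measurability at negative times.\<close>

definition path_at :: "real \<Rightarrow> 'w \<Rightarrow> 'a" where
  "path_at r = X (max 0 r)"

lemma skeleton_measurable[measurable]: "case_prod (skeleton n) \<in> borel_measurable (borel \<Otimes>\<^sub>M M)"
proof -
  have "(\<lambda>z. (\<lambda>i z. X (real (Suc i) / real (Suc n)) (snd z)) (nat \<lfloor>fst z * real (Suc n)\<rfloor>) z)
      \<in> borel_measurable (borel \<Otimes>\<^sub>M M)"
  proof (rule measurable_compose_countable[where f="\<lambda>i z. X (real (Suc i) / real (Suc n)) (snd z)"])
    fix i :: nat
    have [measurable]: "X (real (Suc i) / real (Suc n)) \<in> borel_measurable M"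
      by (rule random_variable_process) simp
    show "(\<lambda>z. X (real (Suc i) / real (Suc n)) (snd z)) \<in> borel_measurable (borel \<Otimes>\<^sub>M M)" by measurable
  qed measurable
  then show ?thesis by (simp add: skeleton_def case_prod_beta')
qed

lemma skeleton_tendsto:
  assumes "0 \<le> r" "\<omega> \<in> space M"
  shows "(\<lambda>n. skeleton n r \<omega>) \<longlonglongrightarrow> X r \<omega>"
proof -
  define t where "t n = real (Suc (nat \<lfloor>r * real (Suc n)\<rfloor>)) / real (Suc n)" for n
  have t: "r < t n \<and> t n \<le> r + 1 / real (Suc n)" for n
  proof -
    have "real (nat \<lfloor>r * real (Suc n)\<rfloor>) = real_of_int \<lfloor>r * real (Suc n)\<rfloor>"
      using assms by (simp add: of_nat_nat)
    then have "r * real (Suc n) < real (Suc (nat \<lfloor>r * real (Suc n)\<rfloor>))"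
      "real (Suc (nat \<lfloor>r * real (Suc n)\<rfloor>)) \<le> r * real (Suc n) + 1"
      by linarith+
    then show ?thesis unfolding t_def by (simp add: field_simps del: of_nat_Suc)
  qed
  have "t \<longlonglongrightarrow> r"
  proof (rule tendsto_sandwich[of "\<lambda>_. r" t _ "\<lambda>n. r + 1 / real (Suc n)"])
    show "(\<lambda>n. r + 1 / real (Suc n)) \<longlonglongrightarrow> r"
      using tendsto_add[OF tendsto_const[of r] LIMSEQ_inverse_real_of_nat] by (simp add: inverse_eq_divide)
    show "(\<lambda>_. r) \<longlonglongrightarrow> r" by simp
  qed (use t in \<open>auto intro!: always_eventually less_imp_le\<close>)
  then have "filterlim t (at_right r) sequentially"
    using t by (auto simp: filterlim_at intro!: always_eventually)
  from filterlim_compose[OF right_continuous_paths[OF assms(2,1)] this]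
  show ?thesis by (simp add: skeleton_def t_def)
qed

text \<open>Right continuity exhibits the process as a pointwise limit of skeletons, and so yields
  the measurability jointly in time and path on which the later interchanges of integrals
  rest.\<close>

lemma path_at_measurable[measurable]: "case_prod path_at \<in> borel_measurable (borel \<Otimes>\<^sub>M M)"
proof (rule borel_measurable_LIMSEQ_metric)
  fix n
  show "(\<lambda>z :: real \<times> 'w. skeleton n (max 0 (fst z)) (snd z)) \<in> borel_measurable (borel \<Otimes>\<^sub>M M)" by measurable
next
  fix z :: "real \<times> 'w" assume "z \<in> space (borel \<Otimes>\<^sub>M M)"
  then show "(\<lambda>n. skeleton n (max 0 (fst z)) (snd z)) \<longlonglongrightarrow> case_prod path_at z"
    using skeleton_tendsto[of "max 0 (fst z)" "snd z"] by (auto simp: path_at_def space_pair_measure)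
qed

end

section \<open>Survival in continuous time and its skeleton approximation\<close>

context levy_potential
begin

text \<open>The time set is a parameter: \<open>{0..<real N}\<close> gives the finite-horizon
  functions that enter the energy estimates, \<open>{0..}\<close> the complement of the capacitory
  potential.\<close>

definition survival_prob :: "real set \<Rightarrow> 'a \<Rightarrow> real" where
  "survival_prob I x = (\<integral>\<omega>. exp_neg (\<integral>\<^sup>+s\<in>I. ennreal (v (x + X s \<omega>)) \<partial>lborel) \<partial>M)"

lemma occupation_eq_path:
  assumes "I \<subseteq> {0..}"
  shows "(\<integral>\<^sup>+s\<in>I. ennreal (v (x + X s \<omega>)) \<partial>lborel) = (\<integral>\<^sup>+s. ennreal (v (x + path_at s \<omega>) * indicator I s) \<partial>lborel)"
  using assms by (intro nn_integral_cong) (auto simp: path_at_def indicator_def)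

lemma occupation_measurable[measurable]:
  assumes [measurable]: "I \<in> sets borel" and "I \<subseteq> {0..}"
  shows "(\<lambda>(x, \<omega>). \<integral>\<^sup>+s\<in>I. ennreal (v (x + X s \<omega>)) \<partial>lborel) \<in> borel_measurable (borel \<Otimes>\<^sub>M M)"
  unfolding occupation_eq_path[OF assms(2)] by measurable

lemma integrable_exp_neg_occupation:
  assumes "I \<in> sets borel" "I \<subseteq> {0..}"
  shows "integrable M (\<lambda>\<omega>. exp_neg (\<integral>\<^sup>+s\<in>I. ennreal (v (x + X s \<omega>)) \<partial>lborel))"
proof (rule integrable_const_bound[of _ 1])
  note [measurable] = occupation_measurable[OF assms]
  show "(\<lambda>\<omega>. exp_neg (\<integral>\<^sup>+s\<in>I. ennreal (v (x + X s \<omega>)) \<partial>lborel)) \<in> borel_measurable M" by measurable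
qed (auto simp: exp_neg_bounds)

lemma survival_prob_measurable:
  assumes "I \<in> sets borel" "I \<subseteq> {0..}"
  shows "survival_prob I \<in> borel_measurable borel"
  unfolding survival_prob_def[abs_def] using occupation_measurable[OF assms] by measurable

lemma survival_prob_bounds:
  assumes "I \<in> sets borel" "I \<subseteq> {0..}"
  shows "0 \<le> survival_prob I x" "survival_prob I x \<le> 1"
proof -
  show "0 \<le> survival_prob I x"
    unfolding survival_prob_def by (intro integral_nonneg_AE) (auto simp: exp_neg_bounds)
  have "survival_prob I x \<le> (\<integral>\<omega>. 1 \<partial>M)"
    unfolding survival_prob_def
    by (intro integral_mono integrable_exp_neg_occupation[OF assms]) (auto simp: exp_neg_bounds)
  then show "survival_prob I x \<le> 1" by (simp add: prob_space)
qed

lemma levy_killing: "0 < \<delta> \<Longrightarrow> levy_killing M X v \<delta>"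
  by unfold_locales

text \<open>The grid of \<open>N * Suc n\<close> steps covers \<open>[0, N)\<close>, and the
  Feynman-Kac sum over right endpoints is the time integral of \<open>v\<close> along the
  skeleton.\<close>

lemma survival_eq_skeleton:
  "survival (1 / real (Suc n)) v (N * Suc n) x =
    (\<integral>\<omega>. exp_neg (\<integral>\<^sup>+r\<in>{0..<real N}. ennreal (v (x + skeleton n r \<omega>)) \<partial>lborel) \<partial>M)"
proof -
  let ?m = "real (Suc n)"
  interpret levy_killing M X v "1 / ?m" by (rule levy_killing) simp
  have m_nz: "?m \<noteq> 0" by simp
  have "exp (- (1 / ?m) * (\<Sum>j=1..N * Suc n. v (x + X (real j * (1 / ?m)) \<omega>))) =
      exp_neg (\<integral>\<^sup>+r\<in>{0..<real N}. ennreal (v (x + skeleton n r \<omega>)) \<partial>lborel)" for \<omega>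
  proof -
    have "(\<integral>\<^sup>+r\<in>{0..<real N}. ennreal (v (x + skeleton n r \<omega>)) \<partial>lborel) =
       (\<Sum>j<N * Suc n. ennreal (v (x + X (real (Suc j) / ?m) \<omega>)) * ennreal (1 / ?m))"
      using nn_integral_step_function[where K="N * Suc n" and n=n and f="\<lambda>j. ennreal (v (x + X (real (Suc j) / ?m) \<omega>))"]
      unfolding of_nat_mult nonzero_mult_div_cancel_right[OF m_nz] by (simp only: skeleton_def)
    also have "\<dots> = (\<Sum>j<N * Suc n. ennreal (v (x + X (real (Suc j) / ?m) \<omega>) * (1 / ?m)))"
      by (simp only: ennreal_mult'[OF v_nonneg])
    also have "\<dots> = ennreal (\<Sum>j<N * Suc n. v (x + X (real (Suc j) / ?m) \<omega>) * (1 / ?m))"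
      by (intro sum_ennreal) (simp add: v_nonneg)
    also have "(\<Sum>j<N * Suc n. v (x + X (real (Suc j) / ?m) \<omega>) * (1 / ?m)) =
        1 / ?m * (\<Sum>j=1..N * Suc n. v (x + X (real j * (1 / ?m)) \<omega>))"
    proof -
      have "(\<Sum>j=1..N * Suc n. v (x + X (real j * (1 / ?m)) \<omega>)) = (\<Sum>j<N * Suc n. v (x + X (real (Suc j) * (1 / ?m)) \<omega>))"
        by (rule sum.reindex_bij_witness[of _ Suc "\<lambda>j. j - 1"]) auto
      then show ?thesis by (simp add: sum_distrib_left mult.commute del: of_nat_Suc)
    qed
    finally have "(\<integral>\<^sup>+r\<in>{0..<real N}. ennreal (v (x + skeleton n r \<omega>)) \<partial>lborel) =
      ennreal (1 / ?m * (\<Sum>j=1..N * Suc n. v (x + X (real j * (1 / ?m)) \<omega>)))" .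
    then show ?thesis
      by (simp only:) (subst exp_neg_ennreal, auto intro!: divide_nonneg_nonneg sum_nonneg v_nonneg simp del: of_nat_Suc)
  qed
  then show ?thesis unfolding survival_eq by simp
qed

text \<open>Along a single path the Riemann sums of an integrable \<open>v\<close> need not
  converge. By the Lipschitz bound for \<open>exp_neg\<close> it is enough to integrate
  \<open>|v (x + skeleton n r \<omega>) - v (x + path_at r \<omega>)|\<close> over start, time and
  path. With the start innermost this is an L1 translation difference of \<open>v\<close> whose
  shift tends to 0.\<close>

lemma survival_tendsto_L1:
  "(\<lambda>n. \<integral>\<^sup>+x. ennreal \<bar>survival (1 / real (Suc n)) v (N * Suc n) x - survival_prob {0..<real N} x\<bar> \<partial>lborel) \<longlonglongrightarrow> 0"
proof -
  let ?I = "{0..<real N}"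
  interpret lM: pair_sigma_finite "lborel :: real measure" M ..
  interpret lM_sf: sigma_finite_measure "(lborel :: real measure) \<Otimes>\<^sub>M M"
    by (rule sigma_finite_pair_measure) unfold_locales
  interpret llM: pair_sigma_finite "(lborel :: real measure) \<Otimes>\<^sub>M M" "lborel :: 'a measure" ..
  define d where "d n r \<omega> = (\<integral>\<^sup>+x. ennreal \<bar>v (x + skeleton n r \<omega>) - v (x + path_at r \<omega>)\<bar> \<partial>lborel) * indicator ?I r" for n r \<omega>
  have [measurable]: "case_prod (d n) \<in> borel_measurable (lborel \<Otimes>\<^sub>M M)" for n
    unfolding d_def[abs_def] by measurable
  have le: "(\<integral>\<^sup>+x. ennreal \<bar>survival (1 / real (Suc n)) v (N * Suc n) x - survival_prob ?I x\<bar> \<partial>lborel)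
      \<le> (\<integral>\<^sup>+z. case_prod (d n) z \<partial>(lborel \<Otimes>\<^sub>M M))" for n
  proof -
    let ?e = "\<lambda>x r \<omega>. ennreal (\<bar>v (x + skeleton n r \<omega>) - v (x + path_at r \<omega>)\<bar> * indicator ?I r)"
    have "(\<integral>\<^sup>+x. ennreal \<bar>survival (1 / real (Suc n)) v (N * Suc n) x - survival_prob ?I x\<bar> \<partial>lborel)
        \<le> (\<integral>\<^sup>+x. (\<integral>\<^sup>+\<omega>. (\<integral>\<^sup>+r. ?e x r \<omega> \<partial>lborel) \<partial>M) \<partial>lborel)"
    proof (rule nn_integral_mono)
      fix x
      let ?A = "\<lambda>\<omega>. \<integral>\<^sup>+r. ennreal (v (x + skeleton n r \<omega>) * indicator ?I r) \<partial>lborel"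
      let ?B = "\<lambda>\<omega>. \<integral>\<^sup>+r. ennreal (v (x + path_at r \<omega>) * indicator ?I r) \<partial>lborel"
      have A: "integrable M (\<lambda>\<omega>. exp_neg (?A \<omega>))" and B: "integrable M (\<lambda>\<omega>. exp_neg (?B \<omega>))"
        by (rule integrable_const_bound[of _ 1]; (auto simp: exp_neg_bounds; fail)?; measurable)+
      have "survival (1 / real (Suc n)) v (N * Suc n) x = (\<integral>\<omega>. exp_neg (?A \<omega>) \<partial>M)"
        unfolding survival_eq_skeleton by (auto intro!: arg_cong[where f=exp_neg] Bochner_Integration.integral_cong nn_integral_cong simp: indicator_def)
      moreover have "survival_prob ?I x = (\<integral>\<omega>. exp_neg (?B \<omega>) \<partial>M)"
        unfolding survival_prob_def by (subst occupation_eq_path) auto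
      ultimately have "\<bar>survival (1 / real (Suc n)) v (N * Suc n) x - survival_prob ?I x\<bar>
         = \<bar>\<integral>\<omega>. exp_neg (?A \<omega>) - exp_neg (?B \<omega>) \<partial>M\<bar>"
        using A B by simp
      also have "\<dots> \<le> (\<integral>\<omega>. \<bar>exp_neg (?A \<omega>) - exp_neg (?B \<omega>)\<bar> \<partial>M)" by (rule integral_abs_bound)
      finally have "ennreal \<bar>survival (1 / real (Suc n)) v (N * Suc n) x - survival_prob ?I x\<bar>
         \<le> ennreal (\<integral>\<omega>. \<bar>exp_neg (?A \<omega>) - exp_neg (?B \<omega>)\<bar> \<partial>M)" by (rule ennreal_leI)
      also have "\<dots> = (\<integral>\<^sup>+\<omega>. ennreal \<bar>exp_neg (?A \<omega>) - exp_neg (?B \<omega>)\<bar> \<partial>M)"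
        using A B by (intro nn_integral_eq_integral[symmetric]) auto
      also have "\<dots> \<le> (\<integral>\<^sup>+\<omega>. (\<integral>\<^sup>+r. ?e x r \<omega> \<partial>lborel) \<partial>M)"
      proof (rule nn_integral_mono)
        fix \<omega> assume [measurable]: "\<omega> \<in> space M"
        have "ennreal \<bar>exp_neg (?A \<omega>) - exp_neg (?B \<omega>)\<bar>
            \<le> (\<integral>\<^sup>+r. ennreal \<bar>v (x + skeleton n r \<omega>) * indicator ?I r - v (x + path_at r \<omega>) * indicator ?I r\<bar> \<partial>lborel)"
          by (rule exp_neg_nn_integral_diff_le) measurable
        then show "ennreal \<bar>exp_neg (?A \<omega>) - exp_neg (?B \<omega>)\<bar> \<le> (\<integral>\<^sup>+r. ?e x r \<omega> \<partial>lborel)"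
          by (simp add: left_diff_distrib[symmetric] abs_mult)
      qed
      finally show "ennreal \<bar>survival (1 / real (Suc n)) v (N * Suc n) x - survival_prob ?I x\<bar>
        \<le> (\<integral>\<^sup>+\<omega>. (\<integral>\<^sup>+r. ?e x r \<omega> \<partial>lborel) \<partial>M)" .
    qed
    also have "\<dots> = (\<integral>\<^sup>+x. (\<integral>\<^sup>+z. ?e x (fst z) (snd z) \<partial>(lborel \<Otimes>\<^sub>M M)) \<partial>lborel)"
      by (intro nn_integral_cong, subst lM.nn_integral_snd[symmetric]) simp_all
    also have "\<dots> = (\<integral>\<^sup>+z. (\<integral>\<^sup>+x. ?e x (fst z) (snd z) \<partial>lborel) \<partial>(lborel \<Otimes>\<^sub>M M))"
      by (rule llM.Fubini') measurable
    also have "\<dots> = (\<integral>\<^sup>+z. case_prod (d n) z \<partial>(lborel \<Otimes>\<^sub>M M))"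
      by (intro nn_integral_cong) (auto simp: d_def indicator_def)
    finally show ?thesis .
  qed
  \<comment> \<open>For each path and each time below \<open>N\<close>, the integral over the start
    is at most twice the integral of \<open>v\<close>; a constant is an admissible majorant because
    \<open>[0, N)\<close> times \<open>space M\<close> has finite measure.\<close>
  define w where "w z = ennreal (2 * (\<integral>x. v x \<partial>lborel)) * indicator (?I \<times> space M) z" for z :: "real \<times> 'w"
  have lim: "(\<lambda>n. \<integral>\<^sup>+z. case_prod (d n) z \<partial>(lborel \<Otimes>\<^sub>M M)) \<longlonglongrightarrow> (\<integral>\<^sup>+z. 0 \<partial>((lborel :: real measure) \<Otimes>\<^sub>M M))"
  proof (rule nn_integral_dominated_convergence[where w=w and u="\<lambda>n. case_prod (d n)" and u'="\<lambda>_. 0"])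
    have v_nn: "(\<integral>\<^sup>+x. ennreal (v (x + a)) \<partial>lborel) = ennreal (\<integral>x. v x \<partial>lborel)" for a
      by (subst nn_integral_lborel_translation) (auto simp: nn_integral_eq_integral v_integrable v_nonneg)
    have "0 \<le> (\<integral>x. v x \<partial>lborel)" by (simp add: integral_nonneg_AE v_nonneg)
    show "AE z in lborel \<Otimes>\<^sub>M M. case_prod (d n) z \<le> w z" for n
    proof (rule AE_I2)
      fix z :: "real \<times> 'w" assume z: "z \<in> space (lborel \<Otimes>\<^sub>M M)"
      obtain r \<omega> where z_eq: "z = (r, \<omega>)" by fastforce
      have "(\<integral>\<^sup>+x. ennreal \<bar>v (x + skeleton n r \<omega>) - v (x + path_at r \<omega>)\<bar> \<partial>lborel)
        \<le> (\<integral>\<^sup>+x. ennreal (v (x + skeleton n r \<omega>)) + ennreal (v (x + path_at r \<omega>)) \<partial>lborel)"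
      proof (rule nn_integral_mono)
        fix x
        show "ennreal \<bar>v (x + skeleton n r \<omega>) - v (x + path_at r \<omega>)\<bar> \<le> ennreal (v (x + skeleton n r \<omega>)) + ennreal (v (x + path_at r \<omega>))"
          using v_nonneg[of "x + skeleton n r \<omega>"] v_nonneg[of "x + path_at r \<omega>"]
          by (subst ennreal_plus[symmetric]) (auto intro!: ennreal_leI simp del: ennreal_plus)
      qed
      also have "\<dots> = ennreal (2 * (\<integral>x. v x \<partial>lborel))"
        using \<open>0 \<le> (\<integral>x. v x \<partial>lborel)\<close>
        by (subst nn_integral_add) (simp_all add: v_nn ennreal_plus[symmetric] del: ennreal_plus)
      finally show "case_prod (d n) z \<le> w z"
        using z by (auto simp: z_eq d_def w_def indicator_def space_pair_measure)
    qed
    have "?I \<times> space M \<in> sets (lborel \<Otimes>\<^sub>M M)" by measurable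
    then show "(\<integral>\<^sup>+z. w z \<partial>(lborel \<Otimes>\<^sub>M M)) < \<infinity>"
      unfolding w_def
      by (subst nn_integral_cmult_indicator)
        (auto simp: emeasure_pair_measure_Times emeasure_space_1 ennreal_mult_less_top)
    show "w \<in> borel_measurable (lborel \<Otimes>\<^sub>M M)" unfolding w_def[abs_def] by measurable
    show "AE z in lborel \<Otimes>\<^sub>M M. (\<lambda>n. case_prod (d n) z) \<longlonglongrightarrow> 0"
    proof (rule AE_I2)
      fix z :: "real \<times> 'w" assume z: "z \<in> space (lborel \<Otimes>\<^sub>M M)"
      obtain r \<omega> where z_eq: "z = (r, \<omega>)" by fastforce
      show "(\<lambda>n. case_prod (d n) z) \<longlonglongrightarrow> 0"
      proof (cases "r \<in> ?I")
        case True
        have "(\<lambda>n. skeleton n r \<omega> - path_at r \<omega>) \<longlonglongrightarrow> 0"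
          using skeleton_tendsto[of r \<omega>] True z
          by (intro LIM_zero) (auto simp: z_eq space_pair_measure path_at_def max_def)
        from translation_L1_tendsto[OF v_integrable this]
        have "(\<lambda>n. ennreal (\<integral>x. \<bar>v (x + (skeleton n r \<omega> - path_at r \<omega>)) - v x\<bar> \<partial>lborel)) \<longlonglongrightarrow> ennreal 0"
          by (rule tendsto_ennrealI)
        moreover have "ennreal (\<integral>x. \<bar>v (x + (skeleton n r \<omega> - path_at r \<omega>)) - v x\<bar> \<partial>lborel) = case_prod (d n) z" for n
        proof -
          have "ennreal (\<integral>x. \<bar>v (x + (skeleton n r \<omega> - path_at r \<omega>)) - v x\<bar> \<partial>lborel) =
            (\<integral>\<^sup>+x. ennreal \<bar>v (x + (skeleton n r \<omega> - path_at r \<omega>)) - v x\<bar> \<partial>lborel)"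
            by (intro nn_integral_eq_integral[symmetric] integrable_abs Bochner_Integration.integrable_diff
                integrable_lborel_translation v_integrable) auto
          also have "\<dots> = (\<integral>\<^sup>+x. ennreal \<bar>v (x + skeleton n r \<omega>) - v (x + path_at r \<omega>)\<bar> \<partial>lborel)"
            by (subst nn_integral_lborel_translation[of _ "path_at r \<omega>", symmetric]) (simp_all add: add.assoc)
          finally show ?thesis using True by (simp add: z_eq d_def)
        qed
        ultimately show ?thesis by simp
      qed (simp add: z_eq d_def)
    qed
  qed measurable
  show ?thesis
    by (rule tendsto_sandwich[OF _ _ tendsto_const]) (use le lim in auto)
qed

end

section \<open>Spectral energy of the finite-horizon potential\<close>

lemma power_spectrum_tendsto:
  fixes u :: "nat \<Rightarrow> 'a::euclidean_space \<Rightarrow> real"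
  assumes u: "\<And>n. integrable lborel (u n)" and f: "integrable lborel f"
    and lim: "(\<lambda>n. \<integral>\<^sup>+x. ennreal \<bar>u n x - f x\<bar> \<partial>lborel) \<longlonglongrightarrow> 0"
  shows "(\<lambda>n. power_spectrum (u n) \<xi>) \<longlonglongrightarrow> power_spectrum f \<xi>"
proof -
  have *: "(\<lambda>n. \<integral>x. u n x * k x \<partial>lborel) \<longlonglongrightarrow> (\<integral>x. f x * k x \<partial>lborel)"
    if [measurable]: "k \<in> borel_measurable borel" and k: "\<And>x. \<bar>k x\<bar> \<le> 1" for k :: "'a \<Rightarrow> real"
  proof (rule tendsto_L1_int)
    have int: "integrable lborel (\<lambda>x. g x * k x)" if "integrable lborel g" for g :: "'a \<Rightarrow> real"
      by (rule Bochner_Integration.integrable_bound[OF that])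
        (use that k in \<open>auto simp: abs_mult mult_left_le\<close>)
    show "integrable lborel (\<lambda>x. u n x * k x)" for n by (rule int[OF u])
    show "integrable lborel (\<lambda>x. f x * k x)" by (rule int[OF f])
    show "(\<lambda>n. \<integral>\<^sup>+x. norm (u n x * k x - f x * k x) \<partial>lborel) \<longlonglongrightarrow> 0"
    proof (rule tendsto_sandwich[OF _ _ tendsto_const lim])
      show "\<forall>\<^sub>F n in sequentially. (\<integral>\<^sup>+x. norm (u n x * k x - f x * k x) \<partial>lborel) \<le> (\<integral>\<^sup>+x. ennreal \<bar>u n x - f x\<bar> \<partial>lborel)"
        using k by (intro always_eventually allI nn_integral_mono ennreal_leI)
          (simp add: left_diff_distrib[symmetric] abs_mult mult_left_le)
    qed simp
  qed
  show ?thesis unfolding power_spectrum_def by (intro tendsto_intros *) auto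
qed

lemma exp_difference_quotient_tendsto:
  fixes a :: real
  assumes "\<delta> \<longlonglongrightarrow> 0" "\<And>n. 0 < \<delta> n"
  shows "(\<lambda>n. (1 - exp (- \<delta> n * a)) / \<delta> n) \<longlonglongrightarrow> a"
proof -
  have "((\<lambda>x. 1 - exp (- x * a)) has_real_derivative a) (at 0)"
    by (auto intro!: derivative_eq_intros)
  then have "((\<lambda>x. (1 - exp (- x * a)) / x) \<longlongrightarrow> a) (at 0)"
    by (simp add: DERIV_def)
  moreover have "filterlim \<delta> (at 0) sequentially"
    using assms by (auto simp: filterlim_at less_imp_neq[symmetric] intro!: always_eventually)
  ultimately show ?thesis by (rule filterlim_compose)
qed

locale stable_potential = symmetric_stable_process \<alpha> M X + levy_potential M X v
  for \<alpha> :: real and M :: "'w measure" and X :: "real \<Rightarrow> 'w \<Rightarrow> 'a::euclidean_space" and v :: "'a \<Rightarrow> real"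
begin

lemma integral_cos_process:
  assumes "0 \<le> t"
  shows "(\<integral>\<omega>. cos (\<xi> \<bullet> X t \<omega>) \<partial>M) = exp (- t * norm \<xi> powr \<alpha>)"
proof -
  have [measurable]: "X t \<in> borel_measurable M" using assms by (rule random_variable_process)
  have int: "integrable M (\<lambda>\<omega>. iexp (\<xi> \<bullet> X t \<omega>))"
    by (rule integrable_const_bound[of _ 1]) auto
  have "(\<integral>\<omega>. cos (\<xi> \<bullet> X t \<omega>) \<partial>M) = (\<integral>\<omega>. Re (iexp (\<xi> \<bullet> X t \<omega>)) \<partial>M)"
    by (simp add: Re_exp)
  also have "\<dots> = exp (- t * norm \<xi> powr \<alpha>)"
    by (subst integral_Re[OF int], subst characteristic_function[OF assms]) simp
  finally show ?thesis .
qed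

text \<open>\<open>spectral_energy_le\<close> is applied with \<open>Y = X \<delta>\<close>, whose
  characteristic function is real, and with the bound of \<open>autocorr_decay_le\<close>. Dividing
  by \<open>\<delta>\<close> cancels the explicit factor on the right, which then stays bounded as
  the time step shrinks.\<close>

lemma survival_energy_le:
  assumes "0 < \<delta>" "0 < \<sigma>"
  shows "(\<integral>\<^sup>+\<zeta>. ennreal (\<sigma> ^ DIM('a) * gauss (0::'a) * ((1 - exp (- \<delta> * norm (\<sigma> *\<^sub>R \<zeta>) powr \<alpha>)) / \<delta> *
      power_spectrum (\<lambda>x. 1 - survival \<delta> v k x) (\<sigma> *\<^sub>R \<zeta>))) \<partial>gauss_measure)
    \<le> ennreal (\<integral>x. v x * survival \<delta> v k x \<partial>lborel)"
proof -
  interpret levy_killing M X v \<delta> by (rule levy_killing[OF \<open>0 < \<delta>\<close>])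
  let ?c = "\<sigma> ^ DIM('a) * gauss (0::'a)"
  let ?m = "power_spectrum (\<lambda>x. 1 - survival \<delta> v k x)"
  let ?\<psi> = "\<lambda>\<xi>. exp (- \<delta> * norm \<xi> powr \<alpha>)"
  have c: "0 \<le> ?c" using assms gauss_zero_pos[where 'a='a] by simp
  have le: "?c * (\<integral>\<zeta>. (1 - ?\<psi> (\<sigma> *\<^sub>R \<zeta>)) * ?m (\<sigma> *\<^sub>R \<zeta>) \<partial>gauss_measure) \<le> \<delta> * (\<integral>x. v x * survival \<delta> v k x \<partial>lborel)"
    by (rule surv.spectral_energy_le[OF prob_space_axioms X_measurable])
      (use assms autocorr_decay_le in \<open>auto simp: integral_cos_process\<close>)
  have \<psi>: "0 \<le> 1 - ?\<psi> \<xi>" "1 - ?\<psi> \<xi> \<le> 1" for \<xi> :: 'a using assms by auto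
  have int: "integrable gauss_measure (\<lambda>\<zeta>. (1 - ?\<psi> (\<sigma> *\<^sub>R \<zeta>)) * ?m (\<sigma> *\<^sub>R \<zeta>))"
  proof (rule surv.integrable_power_spectrum_gauss)
    show "\<bar>1 - ?\<psi> (\<sigma> *\<^sub>R \<zeta>)\<bar> \<le> 1" for \<zeta> :: 'a using \<psi>[of "\<sigma> *\<^sub>R \<zeta>"] by linarith
  qed measurable
  have "(\<integral>\<^sup>+\<zeta>. ennreal (?c * ((1 - ?\<psi> (\<sigma> *\<^sub>R \<zeta>)) / \<delta> * ?m (\<sigma> *\<^sub>R \<zeta>))) \<partial>gauss_measure) =
     (\<integral>\<^sup>+\<zeta>. ennreal (?c / \<delta> * ((1 - ?\<psi> (\<sigma> *\<^sub>R \<zeta>)) * ?m (\<sigma> *\<^sub>R \<zeta>))) \<partial>gauss_measure)"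
    by (simp add: field_simps)
  also have "\<dots> = ennreal (\<integral>\<zeta>. ?c / \<delta> * ((1 - ?\<psi> (\<sigma> *\<^sub>R \<zeta>)) * ?m (\<sigma> *\<^sub>R \<zeta>)) \<partial>gauss_measure)"
    using c \<psi> assms power_spectrum_nonneg
    by (intro nn_integral_eq_integral integrable_mult_right int AE_I2 mult_nonneg_nonneg divide_nonneg_pos)
      (auto simp: gauss_nonneg)
  also have "\<dots> \<le> ennreal (\<integral>x. v x * survival \<delta> v k x \<partial>lborel)"
  proof (rule ennreal_leI)
    have "(\<integral>\<zeta>. ?c / \<delta> * ((1 - ?\<psi> (\<sigma> *\<^sub>R \<zeta>)) * ?m (\<sigma> *\<^sub>R \<zeta>)) \<partial>gauss_measure) =
        ?c * (\<integral>\<zeta>. (1 - ?\<psi> (\<sigma> *\<^sub>R \<zeta>)) * ?m (\<sigma> *\<^sub>R \<zeta>) \<partial>gauss_measure) / \<delta>"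
      by (subst integral_mult_right_zero) (simp only: times_divide_eq_left)
    also have "\<dots> \<le> (\<integral>x. v x * survival \<delta> v k x \<partial>lborel)"
      using le by (simp only: pos_divide_le_eq[OF \<open>0 < \<delta>\<close>] mult.commute)
    finally show "(\<integral>\<zeta>. ?c / \<delta> * ((1 - ?\<psi> (\<sigma> *\<^sub>R \<zeta>)) * ?m (\<sigma> *\<^sub>R \<zeta>)) \<partial>gauss_measure)
      \<le> (\<integral>x. v x * survival \<delta> v k x \<partial>lborel)" .
  qed
  finally show ?thesis .
qed

lemma potential_function_survival_prob: "potential_function (\<lambda>x. 1 - survival_prob {0..<real N} x)"
proof
  let ?s = "survival_prob {0..<real N}"
  have sets: "{0..<real N} \<in> sets borel" "{0..<real N} \<subseteq> {0..}" by auto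
  note [measurable] = survival_prob_measurable[OF sets]
  \<comment> \<open>A single skeleton at L1 distance below 1 suffices to transfer integrability to
    the continuous-time function.\<close>
  obtain n where n: "(\<integral>\<^sup>+x. ennreal \<bar>survival (1 / real (Suc n)) v (N * Suc n) x - ?s x\<bar> \<partial>lborel) < 1"
    using order_tendstoD(2)[OF survival_tendsto_L1[of N], of 1]
    by (auto simp: eventually_sequentially)
  interpret levy_killing M X v "1 / real (Suc n)" by (rule levy_killing) simp
  have "(\<integral>\<^sup>+x. ennreal (1 - ?s x) \<partial>lborel) \<le>
    (\<integral>\<^sup>+x. ennreal (1 - survival (1 / real (Suc n)) v (N * Suc n) x) +
      ennreal \<bar>survival (1 / real (Suc n)) v (N * Suc n) x - ?s x\<bar> \<partial>lborel)"
  proof (rule nn_integral_mono)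
    fix x
    show "ennreal (1 - ?s x) \<le> ennreal (1 - survival (1 / real (Suc n)) v (N * Suc n) x) +
      ennreal \<bar>survival (1 / real (Suc n)) v (N * Suc n) x - ?s x\<bar>"
      using survival_bounds(2)[of "N * Suc n" x]
      by (subst ennreal_plus[symmetric]) (auto intro!: ennreal_leI simp del: ennreal_plus)
  qed
  also have "\<dots> = (\<integral>\<^sup>+x. ennreal (1 - survival (1 / real (Suc n)) v (N * Suc n) x) \<partial>lborel) +
      (\<integral>\<^sup>+x. ennreal \<bar>survival (1 / real (Suc n)) v (N * Suc n) x - ?s x\<bar> \<partial>lborel)"
    by (rule nn_integral_add) measurable
  also have "\<dots> < \<infinity>"
    using one_minus_survival_finite[of "N * Suc n"] less_trans[OF n, of \<infinity>] by simp
  finally show "integrable lborel (\<lambda>x. 1 - ?s x)"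
    using survival_prob_bounds[OF sets] by (intro integrableI_nonneg) auto
  show "0 \<le> 1 - ?s x" "1 - ?s x \<le> 1" for x
    using survival_prob_bounds[OF sets, of x] by auto
qed

lemma finite_energy_survival_prob:
  "potential_function.finite_energy (\<lambda>x. 1 - survival_prob {0..<real N} x) \<alpha>
     (\<integral>x. v x * survival_prob {0..<real N} x \<partial>lborel)"
proof -
  let ?s = "survival_prob {0..<real N}"
  define S where "S n = survival (1 / real (Suc n)) v (N * Suc n)" for n
  interpret u: potential_function "\<lambda>x. 1 - ?s x" by (rule potential_function_survival_prob)
  have sets: "{0..<real N} \<in> sets borel" "{0..<real N} \<subseteq> {0..}" by auto
  note [measurable] = survival_prob_measurable[OF sets]
  have pf: "potential_function (\<lambda>x. 1 - S n x)" for n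
  proof -
    interpret levy_killing M X v "1 / real (Suc n)" by (rule levy_killing) simp
    show ?thesis unfolding S_def by (rule surv.potential_function_axioms)
  qed
  have S_int: "integrable lborel (\<lambda>x. 1 - S n x)" for n by (rule potential_function.u_integrable[OF pf])
  have S_bounds: "0 \<le> S n x" "S n x \<le> 1" for n x
    using potential_function.u_nonneg[OF pf, of n x] potential_function.u_le_1[OF pf, of n x] by auto
  have S_meas[measurable]: "S n \<in> borel_measurable borel" for n
  proof -
    interpret levy_killing M X v "1 / real (Suc n)" by (rule levy_killing) simp
    show ?thesis unfolding S_def by measurable
  qed
  have L1: "(\<lambda>n. \<integral>\<^sup>+x. ennreal \<bar>(1 - S n x) - (1 - ?s x)\<bar> \<partial>lborel) \<longlonglongrightarrow> 0"
    using survival_tendsto_L1[of N] by (simp add: S_def abs_minus_commute)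
  have "ennreal (\<integral>x. norm ((1 - S n x) - (1 - ?s x)) \<partial>lborel) = (\<integral>\<^sup>+x. ennreal \<bar>(1 - S n x) - (1 - ?s x)\<bar> \<partial>lborel)" for n
    by (subst nn_integral_eq_integral[OF integrable_norm[OF
            Bochner_Integration.integrable_diff[OF S_int u.u_integrable]], symmetric]) simp_all
  then have "(\<lambda>n. ennreal (\<integral>x. norm ((1 - S n x) - (1 - ?s x)) \<partial>lborel)) \<longlonglongrightarrow> ennreal 0"
    using L1 by simp
  then have "(\<lambda>n. \<integral>x. norm ((1 - S n x) - (1 - ?s x)) \<partial>lborel) \<longlonglongrightarrow> 0"
    by (subst (asm) tendsto_ennreal_iff) (auto intro!: always_eventually)
  \<comment> \<open>\<open>v\<close> may be unbounded, so L1 convergence of \<open>S n\<close> alone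
    does not control the integrals of \<open>v * S n\<close>. Almost everywhere convergence along a
    subsequence does, with \<open>v\<close> as majorant, and Fatou's lemma is content with a
    subsequence.\<close>
  from tendsto_L1_AE_subseq[OF Bochner_Integration.integrable_diff[OF S_int u.u_integrable] this] obtain r where r: "strict_mono r"
    and AE_lim: "AE x in lborel. (\<lambda>n. (1 - S (r n) x) - (1 - ?s x)) \<longlonglongrightarrow> 0"
    by blast
  have \<Gamma>_lim: "(\<lambda>n. \<integral>x. v x * S (r n) x \<partial>lborel) \<longlonglongrightarrow> (\<integral>x. v x * ?s x \<partial>lborel)"
  proof (rule integral_dominated_convergence[where w=v])
    show "AE x in lborel. (\<lambda>n. v x * S (r n) x) \<longlonglongrightarrow> v x * ?s x"
      using AE_lim
    proof eventually_elim
      case (elim x)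
      have "(\<lambda>n. 1 - ((1 - S (r n) x) - (1 - ?s x)) - (1 - ?s x)) \<longlonglongrightarrow> 1 - 0 - (1 - ?s x)"
        by (intro tendsto_diff tendsto_const elim)
      then have "(\<lambda>n. S (r n) x) \<longlonglongrightarrow> ?s x" by simp
      then show ?case by (rule tendsto_mult_left)
    qed
    show "AE x in lborel. norm (v x * S (r n) x) \<le> v x" for n
      using S_bounds v_nonneg by (auto simp: abs_mult mult_left_le)
  qed (auto simp: v_integrable)
  show ?thesis
    unfolding u.finite_energy_def
  proof (intro allI impI)
    fix \<sigma> :: real assume \<sigma>: "0 < \<sigma>"
    let ?c = "\<sigma> ^ DIM('a) * gauss (0::'a)"
    have c: "0 \<le> ?c" using \<sigma> gauss_zero_pos[where 'a='a] by simp
    define \<delta> where "\<delta> n = 1 / real (Suc (r n))" for n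
    define F where "F n \<zeta> = ennreal (?c * ((1 - exp (- \<delta> n * norm (\<sigma> *\<^sub>R \<zeta>) powr \<alpha>)) / \<delta> n *
        power_spectrum (\<lambda>x. 1 - S (r n) x) (\<sigma> *\<^sub>R \<zeta>)))" for n and \<zeta> :: 'a
    have [measurable]: "power_spectrum (\<lambda>x. 1 - S n x) \<in> borel_measurable borel" for n
      by (rule potential_function.borel_measurable_power_spectrum[OF pf])
    have [measurable]: "F n \<in> borel_measurable gauss_measure" for n
      unfolding F_def[abs_def] by measurable
    have \<delta>: "0 < \<delta> n" for n by (simp add: \<delta>_def)
    have "(\<lambda>n. 1 / real (Suc n)) \<longlonglongrightarrow> 0"
      using LIMSEQ_inverse_real_of_nat by (simp add: inverse_eq_divide)
    then have \<delta>_lim: "\<delta> \<longlonglongrightarrow> 0"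
      unfolding \<delta>_def using LIMSEQ_subseq_LIMSEQ[OF _ r] by (auto simp: comp_def)
    have L1r: "(\<lambda>n. \<integral>\<^sup>+x. ennreal \<bar>(1 - S (r n) x) - (1 - ?s x)\<bar> \<partial>lborel) \<longlonglongrightarrow> 0"
      using LIMSEQ_subseq_LIMSEQ[OF L1 r] by (simp add: comp_def)
    have F_lim: "(\<lambda>n. F n \<zeta>) \<longlonglongrightarrow> ennreal (?c * (norm (\<sigma> *\<^sub>R \<zeta>) powr \<alpha> * power_spectrum (\<lambda>x. 1 - ?s x) (\<sigma> *\<^sub>R \<zeta>)))" for \<zeta>
      unfolding F_def
      by (intro tendsto_ennrealI tendsto_mult tendsto_const exp_difference_quotient_tendsto \<delta>_lim \<delta>
          power_spectrum_tendsto[OF S_int u.u_integrable L1r])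
    have "ennreal ?c * (\<integral>\<^sup>+\<zeta>. ennreal (norm (\<sigma> *\<^sub>R \<zeta>) powr \<alpha> * power_spectrum (\<lambda>x. 1 - ?s x) (\<sigma> *\<^sub>R \<zeta>)) \<partial>gauss_measure) =
      (\<integral>\<^sup>+\<zeta>. ennreal (?c * (norm (\<sigma> *\<^sub>R \<zeta>) powr \<alpha> * power_spectrum (\<lambda>x. 1 - ?s x) (\<sigma> *\<^sub>R \<zeta>))) \<partial>gauss_measure)"
      by (subst nn_integral_cmult[symmetric]) (simp_all add: ennreal_mult'[OF c])
    also have "\<dots> = (\<integral>\<^sup>+\<zeta>. liminf (\<lambda>n. F n \<zeta>) \<partial>gauss_measure)"
      by (intro nn_integral_cong lim_imp_Liminf[OF _ F_lim, symmetric]) simp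
    also have "\<dots> \<le> liminf (\<lambda>n. \<integral>\<^sup>+\<zeta>. F n \<zeta> \<partial>gauss_measure)"
      by (rule nn_integral_liminf) simp
    also have "\<dots> \<le> liminf (\<lambda>n. ennreal (\<integral>x. v x * S (r n) x \<partial>lborel))"
      unfolding F_def S_def \<delta>_def
      by (intro Liminf_mono always_eventually allI survival_energy_le \<sigma>) simp
    also have "\<dots> = ennreal (\<integral>x. v x * ?s x \<partial>lborel)"
      by (intro lim_imp_Liminf tendsto_ennrealI \<Gamma>_lim) simp
    finally show "ennreal ?c * (\<integral>\<^sup>+\<zeta>. ennreal (norm (\<sigma> *\<^sub>R \<zeta>) powr \<alpha> * power_spectrum (\<lambda>x. 1 - ?s x) (\<sigma> *\<^sub>R \<zeta>)) \<partial>gauss_measure)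
      \<le> ennreal (\<integral>x. v x * ?s x \<partial>lborel)" .
  qed
qed

end

section \<open>The Rayleigh quotient\<close>

context potential_function
begin

text \<open>On a set inside the ball of radius \<open>R\<close> the unnormalised Gaussian is at
  least \<open>exp (- R\<^sup>2 / 2)\<close>.\<close>

lemma integral_on_bounded_le:
  assumes [measurable]: "\<Omega> \<in> sets borel" and R: "\<And>x. x \<in> \<Omega> \<Longrightarrow> norm x \<le> R"
  shows "(\<integral>x. indicator \<Omega> x * u x \<partial>lborel) \<le> exp (R\<^sup>2 / 2) * (\<integral>x. u x * exp (- (norm x)\<^sup>2 / 2) \<partial>lborel)"
proof -
  have int: "integrable lborel (\<lambda>x. u x * exp (- (norm x)\<^sup>2 / 2))"
    by (rule integrable_mult_bounded) auto
  have "(\<integral>x. indicator \<Omega> x * u x \<partial>lborel) \<le> (\<integral>x. exp (R\<^sup>2 / 2) * (u x * exp (- (norm x)\<^sup>2 / 2)) \<partial>lborel)"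
  proof (rule integral_mono)
    show "integrable lborel (\<lambda>x. indicator \<Omega> x * u x)"
      using integrable_mult_bounded[of "indicator \<Omega>"] by (simp add: mult.commute)
    show "integrable lborel (\<lambda>x. exp (R\<^sup>2 / 2) * (u x * exp (- (norm x)\<^sup>2 / 2)))"
      using int by simp
    fix x
    show "indicator \<Omega> x * u x \<le> exp (R\<^sup>2 / 2) * (u x * exp (- (norm x)\<^sup>2 / 2))"
    proof (cases "x \<in> \<Omega>")
      case True
      have "(norm x)\<^sup>2 \<le> R\<^sup>2" using R[OF True] by (intro power_mono) auto
      then have "1 \<le> exp (R\<^sup>2 / 2) * exp (- (norm x)\<^sup>2 / 2)"
        by (simp add: exp_add[symmetric])
      from mult_left_mono[OF this u_nonneg[of x]] show ?thesis
        using True by (simp add: mult_ac)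
    qed (simp add: u_nonneg)
  qed
  then show ?thesis by simp
qed

text \<open>For the test function \<open>1 - u\<close> the form contributes
  \<open>2 * C * \<Gamma>\<close> and the potential term \<open>\<Gamma>\<close>, while the squared
  norm on \<open>\<Omega>\<close> is at least half the volume; the quotient of these bounds is the
  stated constant.\<close>

lemma first_eigenvalue_le:
  assumes C: "\<And>\<xi>::'a. (\<integral>\<^sup>+y. ennreal ((1 - cos (\<xi> \<bullet> y)) / norm y powr (real DIM('a) + \<alpha>)) \<partial>lborel) \<le> ennreal (C * norm \<xi> powr \<alpha>)"
    and "C > 0" "finite_energy \<alpha> \<Gamma>" "0 \<le> \<Gamma>"
    and \<Omega>[measurable]: "\<Omega> \<in> sets borel" and fin: "emeasure lborel \<Omega> < \<infinity>" and m: "measure lborel \<Omega> > 0"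
    and pot: "(\<integral>\<^sup>+x\<in>\<Omega>. ennreal (v x * (1 - u x)\<^sup>2) \<partial>lborel) \<le> ennreal \<Gamma>"
    and small: "4 * (\<integral>x. indicator \<Omega> x * u x \<partial>lborel) \<le> measure lborel \<Omega>"
  shows "first_eigenvalue \<alpha> \<Omega> v \<le> ennreal (2 * (2 * C + 1) / measure lborel \<Omega> * \<Gamma>)"
proof -
  let ?m = "measure lborel \<Omega>"
  define \<phi> where "\<phi> x = 1 - u x" for x
  have [measurable]: "\<phi> \<in> borel_measurable borel" unfolding \<phi>_def[abs_def] by measurable
  have \<phi>: "0 \<le> \<phi> x" "\<phi> x \<le> 1" for x using u_nonneg u_le_1 by (auto simp: \<phi>_def)
  have neumann: "neumann_form \<alpha> \<Omega> \<phi> \<le> ennreal (2 * C * \<Gamma>)"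
    unfolding \<phi>_def[abs_def] by (rule neumann_form_le[OF assms(1-3)])
  have ind: "integrable lborel (indicator \<Omega> :: 'a \<Rightarrow> real)" using fin by simp
  have sq_int: "integrable lborel (\<lambda>x. indicator \<Omega> x * (\<phi> x)\<^sup>2)"
    by (rule Bochner_Integration.integrable_bound[OF ind])
      (use \<phi> in \<open>auto simp: indicator_def power_le_one\<close>)
  have u_int: "integrable lborel (\<lambda>x. indicator \<Omega> x * u x)"
    using integrable_mult_bounded[of "indicator \<Omega>"] by (simp add: mult.commute)
  \<comment> \<open>The linear bound \<open>1 - 2 * u x \<le> (1 - u x)\<^sup>2\<close> lets the
    first moment of \<open>u\<close> on \<open>\<Omega>\<close> control the denominator from
    below.\<close>
  have "?m / 2 \<le> ?m - 2 * (\<integral>x. indicator \<Omega> x * u x \<partial>lborel)" using small by simp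
  also have "\<dots> = (\<integral>x. indicator \<Omega> x - 2 * (indicator \<Omega> x * u x) \<partial>lborel)"
    using ind u_int by simp
  also have "\<dots> \<le> (\<integral>x. indicator \<Omega> x * (\<phi> x)\<^sup>2 \<partial>lborel)"
  proof (rule integral_mono)
    fix x
    have "1 - 2 * u x \<le> (\<phi> x)\<^sup>2"
      using zero_le_power2[of "u x"] by (simp add: \<phi>_def power2_eq_square algebra_simps)
    then show "indicator \<Omega> x - 2 * (indicator \<Omega> x * u x) \<le> indicator \<Omega> x * (\<phi> x)\<^sup>2"
      by (simp add: indicator_def)
  qed (use ind u_int sq_int in auto)
  finally have "ennreal (?m / 2) \<le> ennreal (\<integral>x. indicator \<Omega> x * (\<phi> x)\<^sup>2 \<partial>lborel)" by (rule ennreal_leI)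
  also have "\<dots> = (\<integral>\<^sup>+x\<in>\<Omega>. ennreal ((\<phi> x)\<^sup>2) \<partial>lborel)"
    by (subst nn_integral_eq_integral[OF sq_int, symmetric])
      (auto intro!: nn_integral_cong simp: indicator_def)
  finally have denom: "ennreal (?m / 2) \<le> (\<integral>\<^sup>+x\<in>\<Omega>. ennreal ((\<phi> x)\<^sup>2) \<partial>lborel)" .
  have sobolev: "\<phi> \<in> frac_sobolev \<alpha> \<Omega>"
    unfolding frac_sobolev_def set_borel_measurable_def set_integrable_def
    using neumann sq_int by (auto intro: le_less_trans)
  have nontriv: "\<not> (AE x in lborel. x \<in> \<Omega> \<longrightarrow> \<phi> x = 0)"
  proof
    assume "AE x in lborel. x \<in> \<Omega> \<longrightarrow> \<phi> x = 0"
    then have "(\<integral>\<^sup>+x\<in>\<Omega>. ennreal ((\<phi> x)\<^sup>2) \<partial>lborel) = (\<integral>\<^sup>+x. 0 \<partial>(lborel :: 'a measure))"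
      by (intro nn_integral_cong_AE) (auto elim!: eventually_mono simp: indicator_def)
    then show False using denom m by (simp add: ennreal_eq_0_iff)
  qed
  have "first_eigenvalue \<alpha> \<Omega> v \<le> (neumann_form \<alpha> \<Omega> \<phi> + (\<integral>\<^sup>+x\<in>\<Omega>. ennreal (v x * (\<phi> x)\<^sup>2) \<partial>lborel))
          / (\<integral>\<^sup>+x\<in>\<Omega>. ennreal ((\<phi> x)\<^sup>2) \<partial>lborel)"
    unfolding first_eigenvalue_def using sobolev nontriv by (intro INF_lower) simp
  also have "\<dots> \<le> ennreal (2 * (2 * C + 1) / ?m * \<Gamma>)"
  proof (rule divide_le_posI_ennreal)
    have "0 < ennreal (?m / 2)" using m by simp
    then show "0 < (\<integral>\<^sup>+x\<in>\<Omega>. ennreal ((\<phi> x)\<^sup>2) \<partial>lborel)" using denom by (rule less_le_trans)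
    have "neumann_form \<alpha> \<Omega> \<phi> + (\<integral>\<^sup>+x\<in>\<Omega>. ennreal (v x * (\<phi> x)\<^sup>2) \<partial>lborel) \<le> ennreal (2 * C * \<Gamma>) + ennreal \<Gamma>"
      using pot by (intro add_mono neumann) (simp add: \<phi>_def)
    also have "\<dots> = ennreal (2 * C * \<Gamma> + \<Gamma>)"
      using \<open>C > 0\<close> \<open>0 \<le> \<Gamma>\<close> by (intro ennreal_plus[symmetric]) auto
    also have "2 * C * \<Gamma> + \<Gamma> = ?m / 2 * (2 * (2 * C + 1) / ?m * \<Gamma>)"
      using m by (simp add: field_simps)
    also have "ennreal \<dots> = ennreal (?m / 2) * ennreal (2 * (2 * C + 1) / ?m * \<Gamma>)"
      using m by (intro ennreal_mult') simp
    also have "\<dots> \<le> (\<integral>\<^sup>+x\<in>\<Omega>. ennreal ((\<phi> x)\<^sup>2) \<partial>lborel) * ennreal (2 * (2 * C + 1) / ?m * \<Gamma>)"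
      by (intro mult_right_mono denom) simp
    finally show "neumann_form \<alpha> \<Omega> \<phi> + (\<integral>\<^sup>+x\<in>\<Omega>. ennreal (v x * (\<phi> x)\<^sup>2) \<partial>lborel) \<le>
      (\<integral>\<^sup>+x\<in>\<Omega>. ennreal ((\<phi> x)\<^sup>2) \<partial>lborel) * ennreal (2 * (2 * C + 1) / ?m * \<Gamma>)" .
  qed
  finally show ?thesis .
qed

end

section \<open>The limit of an infinite time horizon and the choice of constants\<close>

lemma exp_neg_tendsto:
  fixes a :: "nat \<Rightarrow> ennreal"
  assumes "a \<longlonglongrightarrow> b"
  shows "(\<lambda>n. exp_neg (a n)) \<longlonglongrightarrow> exp_neg b"
proof (cases "b = \<infinity>")
  case True
  show ?thesis unfolding True
  proof (rule LIMSEQ_I)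
    fix e :: real assume "0 < e"
    have "\<forall>\<^sub>F n in sequentially. ennreal (- ln e) < a n"
      using order_tendstoD(1)[OF assms, of "ennreal (- ln e)"] True by simp
    then obtain n0 where n0: "\<And>n. n \<ge> n0 \<Longrightarrow> ennreal (- ln e) < a n"
      by (auto simp: eventually_sequentially)
    have "exp_neg (a n) < e" if "n \<ge> n0" for n
    proof (cases "a n" rule: ennreal_cases)
      case (real r)
      \<comment> \<open>For \<open>e > 1\<close> the threshold \<open>ennreal (- ln e)\<close>
        collapses to 0, but then \<open>- ln e\<close> is negative and lies below \<open>r\<close>
        anyway.\<close>
      then have "- ln e < r" using n0[OF that] by (cases "0 \<le> - ln e") (auto simp: ennreal_less_iff)
      then have "exp (- r) < exp (ln e)" by simp
      then show ?thesis using real \<open>0 < e\<close> by (simp add: exp_neg_ennreal)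
    qed (use \<open>0 < e\<close> in \<open>simp add: exp_neg_def\<close>)
    then show "\<exists>n0. \<forall>n\<ge>n0. norm (exp_neg (a n) - exp_neg \<infinity>) < e"
      by (intro exI[of _ n0]) (simp add: exp_neg_bounds exp_neg_def[of \<top>])
  qed
next
  case False
  then have "\<forall>\<^sub>F n in sequentially. a n < \<infinity>"
    using assms by (intro order_tendstoD) (auto simp: less_top)
  then have "\<forall>\<^sub>F n in sequentially. exp (- enn2real (a n)) = exp_neg (a n)"
    by eventually_elim (auto simp: exp_neg_def)
  moreover have "(\<lambda>n. exp (- enn2real (a n))) \<longlonglongrightarrow> exp (- enn2real b)"
    using False assms by (intro tendsto_intros tendsto_enn2real) (auto simp: less_top)
  ultimately show ?thesis
    using False by (simp add: exp_neg_def[of b] filterlim_cong[OF refl refl])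
qed

context levy_potential
begin

lemma survival_prob_tendsto:
  "(\<lambda>N. survival_prob {0..<real N} x) \<longlonglongrightarrow> survival_prob {0..} x"
  unfolding survival_prob_def
proof (rule integral_dominated_convergence[where w="\<lambda>_. 1"])
  have sets: "{0..<real N} \<in> sets borel" "{0..<real N} \<subseteq> {0..}" for N by auto
  show "(\<lambda>\<omega>. exp_neg (\<integral>\<^sup>+s\<in>{0..}. ennreal (v (x + X s \<omega>)) \<partial>lborel)) \<in> borel_measurable M"
    using integrable_exp_neg_occupation[of "{0..}" x] by auto
  show "(\<lambda>\<omega>. exp_neg (\<integral>\<^sup>+s\<in>{0..<real N}. ennreal (v (x + X s \<omega>)) \<partial>lborel)) \<in> borel_measurable M" for N
    using integrable_exp_neg_occupation[OF sets] by auto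
  show "AE \<omega> in M. (\<lambda>N. exp_neg (\<integral>\<^sup>+s\<in>{0..<real N}. ennreal (v (x + X s \<omega>)) \<partial>lborel))
      \<longlonglongrightarrow> exp_neg (\<integral>\<^sup>+s\<in>{0..}. ennreal (v (x + X s \<omega>)) \<partial>lborel)"
  proof (rule AE_I2, rule exp_neg_tendsto)
    fix \<omega> assume [measurable]: "\<omega> \<in> space M"
    have "(\<lambda>N. \<integral>\<^sup>+s. ennreal (v (x + path_at s \<omega>) * indicator {0..<real N} s) \<partial>lborel)
      \<longlonglongrightarrow> (\<integral>\<^sup>+s. ennreal (v (x + path_at s \<omega>) * indicator {0..} s) \<partial>lborel)"
    proof (rule nn_integral_LIMSEQ)
      show "incseq (\<lambda>N s. ennreal (v (x + path_at s \<omega>) * indicator {0..<real N} s))"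
        by (auto simp: incseq_def le_fun_def indicator_def v_nonneg)
      fix s
      obtain N0 :: nat where "s < real N0" using reals_Archimedean2 by blast
      then have "\<forall>\<^sub>F N in sequentially. ennreal (v (x + path_at s \<omega>) * indicator {0..<real N} s) = ennreal (v (x + path_at s \<omega>) * indicator {0..} s)"
        by (intro eventually_sequentiallyI[of N0]) (auto simp: indicator_def)
      then show "(\<lambda>N. ennreal (v (x + path_at s \<omega>) * indicator {0..<real N} s)) \<longlonglongrightarrow> ennreal (v (x + path_at s \<omega>) * indicator {0..} s)"
        by (rule tendsto_eventually)
    qed measurable
    then show "(\<lambda>N. \<integral>\<^sup>+s\<in>{0..<real N}. ennreal (v (x + X s \<omega>)) \<partial>lborel)
      \<longlonglongrightarrow> (\<integral>\<^sup>+s\<in>{0..}. ennreal (v (x + X s \<omega>)) \<partial>lborel)"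
      by (simp add: occupation_eq_path[OF sets(2)] occupation_eq_path[of "{0..}"])
  qed
qed (auto simp: exp_neg_bounds)

lemma integral_v_survival_prob_tendsto:
  "(\<lambda>N. \<integral>x. v x * survival_prob {0..<real N} x \<partial>lborel) \<longlonglongrightarrow> (\<integral>x. v x * survival_prob {0..} x \<partial>lborel)"
proof (rule integral_dominated_convergence[where w=v])
  have sets: "{0..<real N} \<in> sets borel" "{0..<real N} \<subseteq> {0..}" for N by auto
  note [measurable] = survival_prob_measurable[OF sets] survival_prob_measurable[of "{0..}", simplified]
  show "(\<lambda>x. v x * survival_prob {0..} x) \<in> borel_measurable lborel" by measurable
  show "(\<lambda>x. v x * survival_prob {0..<real N} x) \<in> borel_measurable lborel" for N by measurable
  show "AE x in lborel. (\<lambda>N. v x * survival_prob {0..<real N} x) \<longlonglongrightarrow> v x * survival_prob {0..} x"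
    by (intro AE_I2 tendsto_mult_left survival_prob_tendsto)
  show "AE x in lborel. norm (v x * survival_prob {0..<real N} x) \<le> v x" for N
    using survival_prob_bounds[OF sets[of N]] v_nonneg by (auto simp: abs_mult mult_left_le)
qed (rule v_integrable)

lemma capacitory_potential_eq: "capacitory_potential M X v x = 1 - survival_prob {0..} x"
  unfolding capacitory_potential_def survival_prob_def
  using integrable_exp_neg_occupation[of "{0..}" x] by (simp add: prob_space)

end

theorem mainTheorem2:
  fixes \<alpha> :: real and \<Omega> :: "'a::euclidean_space set"
  assumes "0 < \<alpha>" "\<alpha> < 2" "\<alpha> < real DIM('a)"
    and "open \<Omega>" "connected \<Omega>" "\<Omega> \<noteq> {}" "bounded \<Omega>"
  shows "\<exists>\<beta>>0. \<exists>C\<^sub>2>0.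
           \<forall>(M :: 'w measure) X. symmetric_stable_process \<alpha> M X \<longrightarrow>
             (\<forall>v :: 'a \<Rightarrow> real. set_integrable lborel \<Omega> v \<longrightarrow>
                (AE x in lborel. x \<in> \<Omega> \<longrightarrow> 0 \<le> v x) \<longrightarrow>
                scattering_length M X (zero_extension \<Omega> v) \<le> \<beta> \<longrightarrow>
                first_eigenvalue \<alpha> \<Omega> v
                  \<le> ennreal (C\<^sub>2 * scattering_length M X (zero_extension \<Omega> v)))"
proof -
  obtain C where "C > 0" and C: "\<And>\<xi>::'a. (\<integral>\<^sup>+y. ennreal ((1 - cos (\<xi> \<bullet> y)) / norm y powr (real DIM('a) + \<alpha>)) \<partial>lborel)
      \<le> ennreal (C * norm \<xi> powr \<alpha>)"
    using nn_integral_one_minus_cos_le[OF assms(1,2), where 'a='a] by blast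
  obtain K where "K > 0" and K: "(\<integral>\<^sup>+x. ennreal (norm (x::'a) powr (- \<alpha>)) \<partial>gauss_measure) \<le> ennreal K"
  proof -
    obtain k where k: "0 \<le> k" "(\<integral>\<^sup>+x. ennreal (norm (x::'a) powr (- \<alpha>)) \<partial>gauss_measure) = ennreal k"
      using gauss_measure_powr_finite[OF assms(1,3)]
      by (cases "\<integral>\<^sup>+x. ennreal (norm (x::'a) powr (- \<alpha>)) \<partial>gauss_measure" rule: ennreal_cases) auto
    \<comment> \<open>Adding 1 makes \<open>K\<close> strictly positive, so that
      \<open>\<eta>\<close> below is positive as well.\<close>
    show thesis by (rule that[of "k + 1"]) (use k in \<open>auto intro: ennreal_leI\<close>)
  qed
  obtain R where R: "\<And>x. x \<in> \<Omega> \<Longrightarrow> norm x \<le> R"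
    using \<open>bounded \<Omega>\<close> unfolding bounded_iff by blast
  define m where "m = measure lborel \<Omega>"
  have [measurable]: "\<Omega> \<in> sets borel" using \<open>open \<Omega>\<close> by simp
  have fin: "emeasure lborel \<Omega> < \<infinity>" using emeasure_bounded_finite[OF \<open>bounded \<Omega>\<close>] by simp
  have m: "m > 0"
    using open_not_negligible[OF \<open>open \<Omega>\<close> \<open>\<Omega> \<noteq> {}\<close>] fin
    by (auto simp: m_def negligible_iff_emeasure0 zero_less_measure_iff emeasure_eq_ennreal_measure)
  \<comment> \<open>\<open>\<kappa>\<close> is the loss from comparing \<open>\<Omega>\<close> with
    the Gaussian weight. \<open>\<eta>\<close> is chosen to make
    \<open>\<kappa> * K / (4 * \<eta>)\<close> equal to \<open>m / 8\<close>, and then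
    \<open>\<beta>\<close> to make \<open>\<kappa> * \<eta> * \<beta> / gauss 0\<close> equal to
    \<open>m / 8\<close>. Together they bound the integral of \<open>u\<close> on
    \<open>\<Omega>\<close> by \<open>m / 4\<close>, the smallness that
    \<open>first_eigenvalue_le\<close> requires.\<close>
  define \<kappa> where "\<kappa> = exp (R\<^sup>2 / 2)"
  define \<eta> where "\<eta> = 2 * \<kappa> * K / m"
  define \<beta> where "\<beta> = m * gauss (0::'a) / (8 * \<kappa> * \<eta>)"
  have pos: "\<kappa> > 0" "\<eta> > 0" "\<beta> > 0" "gauss (0::'a) > 0"
    using m \<open>K > 0\<close> by (auto simp: \<kappa>_def \<eta>_def \<beta>_def gauss_zero_pos)
  define C2 where "C2 = 2 * (2 * C + 1) / m"
  have "C2 > 0" using \<open>C > 0\<close> m by (simp add: C2_def)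
  have main: "first_eigenvalue \<alpha> \<Omega> v \<le> ennreal (C2 * scattering_length M X (zero_extension \<Omega> v))"
    if proc: "symmetric_stable_process \<alpha> M X" and v_int: "set_integrable lborel \<Omega> v"
      and v_nn: "AE x in lborel. x \<in> \<Omega> \<longrightarrow> 0 \<le> v x"
      and \<Gamma>_le: "scattering_length M X (zero_extension \<Omega> v) \<le> \<beta> / 2"
    for M :: "'w measure" and X and v :: "'a \<Rightarrow> real"
  proof -
    \<comment> \<open>The positive part turns nonnegativity almost everywhere on
      \<open>\<Omega>\<close> into nonnegativity everywhere, as \<open>levy_potential\<close>
      demands.\<close>
    define w where "w x = max 0 (indicator \<Omega> x * v x)" for x
    interpret symmetric_stable_process \<alpha> M X by (rule proc)
    have w_int: "integrable lborel w"
      using v_int unfolding w_def[abs_def] set_integrable_def by auto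
    have w_nonneg: "0 \<le> w x" for x by (simp add: w_def)
    interpret stable_potential \<alpha> M X w
      by unfold_locales (use w_int w_nonneg in auto)
    \<comment> \<open>\<open>ennreal\<close> cuts negative values to 0, so this identity holds at
      every point. The path integrals agree for every path, even one that visits the exceptional
      null set.\<close>
    have ennreal_w: "ennreal (zero_extension \<Omega> v x) = ennreal (w x)" for x
      by (auto simp: zero_extension_def w_def max_def ennreal_neg)
    define \<Gamma> where "\<Gamma> N = (\<integral>x. w x * survival_prob {0..<real N} x \<partial>lborel)" for N
    have sets: "{0..<real N} \<in> sets borel" "{0..<real N} \<subseteq> {0..}" for N by auto
    have \<Gamma>_nonneg: "0 \<le> \<Gamma> N" for N
      unfolding \<Gamma>_def using w_nonneg survival_prob_bounds(1)[OF sets] by (intro integral_nonneg_AE) auto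
    have "capacitory_potential M X (zero_extension \<Omega> v) x = 1 - survival_prob {0..} x" for x
      unfolding capacitory_potential_eq[symmetric] capacitory_potential_def ennreal_w ..
    then have "scattering_length M X (zero_extension \<Omega> v) = (\<integral>x. zero_extension \<Omega> v x * survival_prob {0..} x \<partial>lborel)"
      by (simp add: scattering_length_def capacitory_density_def)
    also have "\<dots> = (\<integral>x. w x * survival_prob {0..} x \<partial>lborel)"
    proof (rule integral_cong_AE)
      note [measurable] = survival_prob_measurable[of "{0..}", simplified] borel_measurable_integrable[OF w_int]
      have [measurable]: "zero_extension \<Omega> v \<in> borel_measurable lborel"
      proof -
        have "zero_extension \<Omega> v = (\<lambda>x. indicator \<Omega> x *\<^sub>R v x)" by (auto simp: zero_extension_def)
        then show ?thesis using v_int unfolding set_integrable_def by (simp only: borel_measurable_integrable)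
      qed
      show "(\<lambda>x. zero_extension \<Omega> v x * survival_prob {0..} x) \<in> borel_measurable lborel" by measurable
      show "(\<lambda>x. w x * survival_prob {0..} x) \<in> borel_measurable lborel" by measurable
      show "AE x in lborel. zero_extension \<Omega> v x * survival_prob {0..} x = w x * survival_prob {0..} x"
        using v_nn by eventually_elim (auto simp: zero_extension_def w_def max_def)
    qed
    finally have \<Gamma>_lim: "\<Gamma> \<longlonglongrightarrow> scattering_length M X (zero_extension \<Omega> v)"
      using integral_v_survival_prob_tendsto by (simp add: \<Gamma>_def[abs_def])
    have step: "first_eigenvalue \<alpha> \<Omega> v \<le> ennreal (C2 * \<Gamma> N)" if "\<Gamma> N < \<beta>" for N
    proof -
      let ?s = "survival_prob {0..<real N}"
      interpret u: potential_function "\<lambda>x. 1 - ?s x" by (rule potential_function_survival_prob)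
      have energy: "u.finite_energy \<alpha> (\<Gamma> N)" unfolding \<Gamma>_def by (rule finite_energy_survival_prob)
      have "first_eigenvalue \<alpha> \<Omega> v \<le> ennreal (2 * (2 * C + 1) / measure lborel \<Omega> * \<Gamma> N)"
      proof (rule u.first_eigenvalue_le[OF C \<open>C > 0\<close> energy \<Gamma>_nonneg _ fin])
        have "(\<integral>\<^sup>+x\<in>\<Omega>. ennreal (v x * (1 - (1 - ?s x))\<^sup>2) \<partial>lborel) \<le> (\<integral>\<^sup>+x. ennreal (w x * ?s x) \<partial>lborel)"
        proof (rule nn_integral_mono)
          fix x
          have s: "0 \<le> ?s x" "?s x \<le> 1" using survival_prob_bounds[OF sets] by auto
          \<comment> \<open>The test function is the survival probability itself; one of its two
            factors is bounded by 1, which leaves the density of \<open>\<Gamma> N\<close>.\<close>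
          have "v x * (?s x)\<^sup>2 \<le> w x * ?s x" if "x \<in> \<Omega>"
          proof -
            have "v x * (?s x)\<^sup>2 \<le> w x * (?s x)\<^sup>2" using that by (intro mult_right_mono) (auto simp: w_def)
            also have "\<dots> \<le> w x * ?s x"
              using s w_nonneg[of x] by (intro mult_left_mono) (auto simp: power2_eq_square mult_left_le)
            finally show ?thesis .
          qed
          then show "ennreal (v x * (1 - (1 - ?s x))\<^sup>2) * indicator \<Omega> x \<le> ennreal (w x * ?s x)"
            by (auto simp: indicator_def intro: ennreal_leI)
        qed
        also have "\<dots> = ennreal (\<Gamma> N)"
          unfolding \<Gamma>_def
        proof (rule nn_integral_eq_integral)
          note [measurable] = survival_prob_measurable[OF sets]
          show "integrable lborel (\<lambda>x. w x * ?s x)"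
            by (rule Bochner_Integration.integrable_bound[OF w_int])
              (use survival_prob_bounds[OF sets] w_nonneg in \<open>auto simp: abs_mult mult_left_le\<close>)
        qed (use survival_prob_bounds(1)[OF sets] w_nonneg in auto)
        finally show "(\<integral>\<^sup>+x\<in>\<Omega>. ennreal (v x * (1 - (1 - ?s x))\<^sup>2) \<partial>lborel) \<le> ennreal (\<Gamma> N)" .
        have "(\<integral>x. indicator \<Omega> x * (1 - ?s x) \<partial>lborel) \<le> \<kappa> * (\<integral>x. (1 - ?s x) * exp (- (norm x)\<^sup>2 / 2) \<partial>lborel)"
          unfolding \<kappa>_def using R by (intro u.integral_on_bounded_le) auto
        also have "\<dots> \<le> \<kappa> * (\<eta> * \<Gamma> N / gauss (0::'a) + K / (4 * \<eta>))"
          using u.gauss_average_le[OF K energy \<open>\<eta> > 0\<close> \<Gamma>_nonneg] \<open>K > 0\<close> pos by (intro mult_left_mono) auto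
        also have "\<dots> \<le> \<kappa> * (\<eta> * \<beta> / gauss (0::'a) + K / (4 * \<eta>))"
          using that pos by (intro mult_left_mono add_right_mono divide_right_mono) auto
        also have "\<dots> = m / 4"
          using pos m \<open>K > 0\<close> by (simp add: \<beta>_def \<eta>_def field_simps)
        finally show "4 * (\<integral>x. indicator \<Omega> x * (1 - ?s x) \<partial>lborel) \<le> measure lborel \<Omega>"
          by (simp add: m_def)
      qed (use m in \<open>auto simp: m_def\<close>)
      then show ?thesis by (simp only: C2_def m_def)
    qed
    \<comment> \<open>The limit is at most \<open>\<beta> / 2\<close>, strictly below
      \<open>\<beta>\<close>; halving the threshold provides the room needed to pass from the limit
      to finite horizons.\<close>
    have "\<forall>\<^sub>F N in sequentially. \<Gamma> N < \<beta>"
      using \<Gamma>_le pos by (intro order_tendstoD(2)[OF \<Gamma>_lim]) auto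
    then have "\<forall>\<^sub>F N in sequentially. first_eigenvalue \<alpha> \<Omega> v \<le> ennreal (C2 * \<Gamma> N)"
      by eventually_elim (rule step)
    moreover have "(\<lambda>N. ennreal (C2 * \<Gamma> N)) \<longlonglongrightarrow> ennreal (C2 * scattering_length M X (zero_extension \<Omega> v))"
      by (intro tendsto_ennrealI tendsto_mult_left \<Gamma>_lim)
    ultimately show ?thesis by (intro tendsto_lowerbound) auto
  qed
  show ?thesis
    using main pos \<open>C2 > 0\<close> by (intro exI[of _ "\<beta> / 2"] exI[of _ C2] conjI allI impI) auto
qed

end
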